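(* $\mathbf{FPC}=\mathbf{FP}$: a function $f:\mathbb Z^m\to\mathbb Z$ (for any $m\ge 0$) is computed by some well-typed CorePolyC program if and only if it is computable by a deterministic Turing machine in time polynomial in the total binary length of its input.
   Context: CorePolyC. Types are $\mathtt{iint},\mathtt{int},\mathtt{bool}$; $\mathsf{Int}=\{\mathtt{iint},\mathtt{int}\}$, ordered by $\mathtt{iint}\preccurlyeq\mathtt{int}$. Values are unbounded integers ($\mathbb Z$) and booleans $\#t,\#f$. Expressions: variables $x$; constants (nonempty decimal digit strings denoting natural numbers; $\mathtt{true}$, $\mathtt{false}$); operator applications $\mathtt{op}(e_1,\dots,e_m)$; parenthesized $(e)$. Operators and semantics: unary $-$ (negation); binary $+,-,/,\%$ (integer addition, subtraction, division, remainder, with division and remainder by $0$ returning $0$); $\mathtt{size}$, with $\mathtt{size}(v)=\lceil\log_2(\mathrm{abs}(v)+1)\rceil$; comparisons $\texttt{>=},\texttt{<=},\texttt{>},\texttt{<},\texttt{==},\texttt{!=}$ on integers returning booleans; boolean $\texttt{!},\texttt{\&\&},\texttt{||}$. There is no multiplication operator. Statements: declaration $t\ x;$; assignment $x=e;$; block $\{s_1\dots s_m\}$; conditional $\mathbf{if}(e)\ s_1\ \mathbf{else}\ s_2$; loop $\mathbf{for}(x<\mathtt{size}(e))\ s$ (loop bounds are always syntactically of the form $\mathtt{size}(e)$). A program is $\mathbf{int\ main}(\mathbf{int}\ x_1,\dots,\mathbf{int}\ x_m)\{s_1\dots s_k\ \mathbf{return}\ e;\}$. Semantics (big-step). A store $\Sigma$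 is a finite partial map from variables to values; $\Sigma[x\mapsto v]$ is the update. $\Sigma\vdash e\Downarrow v$: a variable $x\in\mathrm{dom}\,\Sigma$ evaluates to $\Sigma(x)$, constants to their value, $\mathtt{op}(e_1,\dots,e_m)$ to $\mathtt{op}$ applied to the values of the $e_i$. $\Sigma\vdash s\Downarrow\Sigma'$: $t\ x;$ gives $\Sigma[x\mapsto 0]$ if $t\in\mathsf{Int}$ and $\Sigma[x\mapsto\#f]$ if $t=\mathtt{bool}$; $x=e;$ (with $x\in\mathrm{dom}\,\Sigma$) gives $\Sigma[x\mapsto v]$ where $\Sigma\vdash e\Downarrow v$; a sequence or block executes its statements in order threading the store (a block returns the final store); a conditional evaluates its guard to a boolean and executes the corresponding branch; $\mathbf{for}(x<e)\ s$ evaluates $e$ once to an integer $i$, sets $\Sigma_0=\Sigma$, executes $s$ from $\Sigma_j[x\mapsto j]$ obtaining $\Sigma_{j+1}$ for $j=0,\dots,i-1$, and ends in $\Sigma_i$ (i.e. in $\Sigma$ if $i\le 0$). A program on inputs $v_1,\dots,v_m$ runs its statements from the store $[x_1\mapsto v_1,\dots,x_m\mapsto v_m]$ and outputs the value of its return expression in the resulting store. Type system. A typing environment $\Gamma$ is a finite partial map from variables to types; $\ell\in\{\#t,\#f\}$ is the loop indicator. Expression typing $\Gamma,\ell\vdash e:t$: a variable $x\in\mathrm{dom}\,\Gamma$ has type $\Gamma(x)$; digit literals have type $\mathtt{iint}$, $\mathtt{true},\mathtt{false}$ have type $\mathtt{bool}$; $\texttt{!},\texttt{\&\&},\texttt{||}$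 take $\mathtt{bool}$ arguments to $\mathtt{bool}$; comparisons take arguments with types in $\mathsf{Int}$ to $\mathtt{bool}$; $+,-,/,\%$ take arguments with types in $\mathsf{Int}$ to their supremum under $\preccurlyeq$ ($\mathtt{iint}$ iff all arguments are $\mathtt{iint}$); $\mathtt{size}$ takes only an $\mathtt{iint}$ argument, giving $\mathtt{iint}$; parentheses preserve types. Statement typing $\Gamma,\ell\vdash s:\Gamma'$: $t\ x;$ is typable iff $x\notin\mathrm{dom}\,\Gamma$ and not($\ell=\#t$ and $t=\mathtt{iint}$), giving $\Gamma[x\mapsto t]$; $x=e;$ is typable iff $x\in\mathrm{dom}\,\Gamma$, not($\ell=\#t$ and $\Gamma(x)=\mathtt{iint}$), and $\Gamma,\ell\vdash e:t$ with $t,\Gamma(x)$ both in $\mathsf{Int}$ or both $\mathtt{bool}$, giving $\Gamma$; a sequence $s_1\dots s_m$ threads $\Gamma_0=\Gamma$, $\Gamma_{i-1},\ell\vdash s_i:\Gamma_i$, giving $\Gamma_m$; a block $\{\tilde s\}$ is typable if its sequence is, giving $\Gamma$; a conditional needs a guard of type $\mathtt{bool}$ and both branches typable under $\Gamma,\ell$, giving $\Gamma$; $\mathbf{for}(x<e)\ s$ needs $\Gamma,\ell\vdash e:\mathtt{iint}$, $x\notin\mathrm{dom}\,\Gamma$, and $\Gamma[x\mapsto\mathtt{iint}],\#t\vdash s:\Gamma'$ for some $\Gamma'$, giving $\Gamma$. A program is well-typed if its statements are typable starting from $[x_1\mapsto\mathtt{int},\dots,x_m\mapsto\mathtt{int}]$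 with $\ell=\#f$, ending in some $\Gamma'$, and its return expression has a type in $\mathsf{Int}$ under $\Gamma',\#f$. Every well-typed program $p$ with $m$ inputs terminates on all inputs with an integer output, so computes a total function $[\![p]\!]:\mathbb Z^m\to\mathbb Z$. $\mathbf{FPC}$ is the set of all such functions $[\![p]\!]$. $\mathbf{FP}$ is the class of total functions $\mathbb Z^m\to\mathbb Z$ ($m\ge 0$) computable by a deterministic Turing machine in time polynomial in the total bit-length of the input (integers encoded in binary). *)

theory Defs
  imports Complex_Main
begin

datatype ty = TIInt | TInt | TBool

definition is_int_ty :: "ty \<Rightarrow> bool" where
  "is_int_ty t \<longleftrightarrow> t = TIInt \<or> t = TInt"

(* supremum in the order iint \<preccurlyeq> int *)
definition ty_sup :: "ty \<Rightarrow> ty \<Rightarrow> ty" where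
  "ty_sup t1 t2 = (if t1 = TIInt \<and> t2 = TIInt then TIInt else TInt)"

datatype oper = ONeg | OAdd | OSub | ODiv | OMod | OSize
  | OGe | OLe | OGt | OLt | OEq | ONe | ONot | OAnd | OOr

type_synonym vname = string

datatype expr = Var vname | Num nat | ETrue | EFalse | Op oper "expr list" | Paren expr

(* For x e s  represents  for(x < size(e)) s  : loop bounds are syntactically size(e) *)
datatype stmt = Decl ty vname | Assign vname expr | Block "stmt list"
  | If expr stmt stmt | For vname expr stmt

record prog =
  params :: "vname list"
  body :: "stmt list"
  ret :: expr

datatype val = VInt int | VBool bool

type_synonym store = "vname \<Rightarrow> val option"

definition size_int :: "int \<Rightarrow> int" where
  "size_int v = \<lceil>log 2 (real_of_int (\<bar>v\<bar> + 1))\<rceil>"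

(* integer division / remainder (truncating, C-style); by 0 they return 0 *)
definition tdiv :: "int \<Rightarrow> int \<Rightarrow> int" where
  "tdiv a b = (if b = 0 then 0 else sgn a * sgn b * (\<bar>a\<bar> div \<bar>b\<bar>))"

definition tmod :: "int \<Rightarrow> int \<Rightarrow> int" where
  "tmod a b = (if b = 0 then 0 else a - b * tdiv a b)"

fun args_int1 :: "val list \<Rightarrow> int option" where
  "args_int1 [VInt a] = Some a"
| "args_int1 _ = None"

fun args_int2 :: "val list \<Rightarrow> (int \<times> int) option" where
  "args_int2 [VInt a, VInt b] = Some (a, b)"
| "args_int2 _ = None"

fun args_bool1 :: "val list \<Rightarrow> bool option" where
  "args_bool1 [VBool a] = Some a"
| "args_bool1 _ = None"

fun args_bool2 :: "val list \<Rightarrow> (bool \<times> bool) option" where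
  "args_bool2 [VBool a, VBool b] = Some (a, b)"
| "args_bool2 _ = None"

definition op_sem :: "oper \<Rightarrow> val list \<Rightarrow> val option" where
  "op_sem f vs = (case f of
      ONeg \<Rightarrow> map_option (\<lambda>a. VInt (- a)) (args_int1 vs)
    | OAdd \<Rightarrow> map_option (\<lambda>(a, b). VInt (a + b)) (args_int2 vs)
    | OSub \<Rightarrow> map_option (\<lambda>(a, b). VInt (a - b)) (args_int2 vs)
    | ODiv \<Rightarrow> map_option (\<lambda>(a, b). VInt (tdiv a b)) (args_int2 vs)
    | OMod \<Rightarrow> map_option (\<lambda>(a, b). VInt (tmod a b)) (args_int2 vs)
    | OSize \<Rightarrow> map_option (\<lambda>a. VInt (size_int a)) (args_int1 vs)
    | OGe \<Rightarrow> map_option (\<lambda>(a, b). VBool (a \<ge> b)) (args_int2 vs)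
    | OLe \<Rightarrow> map_option (\<lambda>(a, b). VBool (a \<le> b)) (args_int2 vs)
    | OGt \<Rightarrow> map_option (\<lambda>(a, b). VBool (a > b)) (args_int2 vs)
    | OLt \<Rightarrow> map_option (\<lambda>(a, b). VBool (a < b)) (args_int2 vs)
    | OEq \<Rightarrow> map_option (\<lambda>(a, b). VBool (a = b)) (args_int2 vs)
    | ONe \<Rightarrow> map_option (\<lambda>(a, b). VBool (a \<noteq> b)) (args_int2 vs)
    | ONot \<Rightarrow> map_option (\<lambda>a. VBool (\<not> a)) (args_bool1 vs)
    | OAnd \<Rightarrow> map_option (\<lambda>(a, b). VBool (a \<and> b)) (args_bool2 vs)
    | OOr \<Rightarrow> map_option (\<lambda>(a, b). VBool (a \<or> b)) (args_bool2 vs))"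

inductive eval :: "store \<Rightarrow> expr \<Rightarrow> val \<Rightarrow> bool" where
  EVar: "\<Sigma> x = Some v \<Longrightarrow> eval \<Sigma> (Var x) v"
| ENum: "eval \<Sigma> (Num n) (VInt (int n))"
| ETrue: "eval \<Sigma> ETrue (VBool True)"
| EFalse: "eval \<Sigma> EFalse (VBool False)"
| EOp: "list_all2 (eval \<Sigma>) es vs \<Longrightarrow> op_sem f vs = Some v \<Longrightarrow> eval \<Sigma> (Op f es) v"
| EParen: "eval \<Sigma> e v \<Longrightarrow> eval \<Sigma> (Paren e) v"

inductive exec :: "store \<Rightarrow> stmt \<Rightarrow> store \<Rightarrow> bool"
  and execs :: "store \<Rightarrow> stmt list \<Rightarrow> store \<Rightarrow> bool"
  and loop :: "vname \<Rightarrow> stmt \<Rightarrow> int \<Rightarrow> int \<Rightarrow> store \<Rightarrow> store \<Rightarrow> bool"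
where
  XDeclI: "is_int_ty t \<Longrightarrow> exec \<Sigma> (Decl t x) (\<Sigma>(x \<mapsto> VInt 0))"
| XDeclB: "exec \<Sigma> (Decl TBool x) (\<Sigma>(x \<mapsto> VBool False))"
| XAssign: "x \<in> dom \<Sigma> \<Longrightarrow> eval \<Sigma> e v \<Longrightarrow> exec \<Sigma> (Assign x e) (\<Sigma>(x \<mapsto> v))"
| XBlock: "execs \<Sigma> ss \<Sigma>' \<Longrightarrow> exec \<Sigma> (Block ss) \<Sigma>'"
| XIfT: "eval \<Sigma> e (VBool True) \<Longrightarrow> exec \<Sigma> s1 \<Sigma>' \<Longrightarrow> exec \<Sigma> (If e s1 s2) \<Sigma>'"
| XIfF: "eval \<Sigma> e (VBool False) \<Longrightarrow> exec \<Sigma> s2 \<Sigma>' \<Longrightarrow> exec \<Sigma> (If e s1 s2) \<Sigma>'"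
| XFor: "eval \<Sigma> (Op OSize [e]) (VInt i) \<Longrightarrow> loop x s 0 i \<Sigma> \<Sigma>' \<Longrightarrow> exec \<Sigma> (For x e s) \<Sigma>'"
| XNil: "execs \<Sigma> [] \<Sigma>"
| XCons: "exec \<Sigma> s \<Sigma>1 \<Longrightarrow> execs \<Sigma>1 ss \<Sigma>' \<Longrightarrow> execs \<Sigma> (s # ss) \<Sigma>'"
| LStop: "i \<le> j \<Longrightarrow> loop x s j i \<Sigma> \<Sigma>"
| LStep: "j < i \<Longrightarrow> exec (\<Sigma>(x \<mapsto> VInt j)) s \<Sigma>1 \<Longrightarrow> loop x s (j + 1) i \<Sigma>1 \<Sigma>'
          \<Longrightarrow> loop x s j i \<Sigma> \<Sigma>'"

type_synonym tyenv = "vname \<Rightarrow> ty option"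

definition arith_ty :: "ty list \<Rightarrow> ty option" where
  "arith_ty ts = (case ts of [t1, t2] \<Rightarrow>
      (if is_int_ty t1 \<and> is_int_ty t2 then Some (ty_sup t1 t2) else None) | _ \<Rightarrow> None)"

definition cmp_ty :: "ty list \<Rightarrow> ty option" where
  "cmp_ty ts = (case ts of [t1, t2] \<Rightarrow>
      (if is_int_ty t1 \<and> is_int_ty t2 then Some TBool else None) | _ \<Rightarrow> None)"

definition bool2_ty :: "ty list \<Rightarrow> ty option" where
  "bool2_ty ts = (case ts of [t1, t2] \<Rightarrow>
      (if t1 = TBool \<and> t2 = TBool then Some TBool else None) | _ \<Rightarrow> None)"

definition op_ty :: "oper \<Rightarrow> ty list \<Rightarrow> ty option" where
  "op_ty f ts = (case f of
      ONeg \<Rightarrow> (case ts of [t] \<Rightarrow> (if is_int_ty t then Some t else None) | _ \<Rightarrow> None)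
    | OAdd \<Rightarrow> arith_ty ts | OSub \<Rightarrow> arith_ty ts | ODiv \<Rightarrow> arith_ty ts | OMod \<Rightarrow> arith_ty ts
    | OSize \<Rightarrow> (case ts of [t] \<Rightarrow> (if t = TIInt then Some TIInt else None) | _ \<Rightarrow> None)
    | OGe \<Rightarrow> cmp_ty ts | OLe \<Rightarrow> cmp_ty ts | OGt \<Rightarrow> cmp_ty ts | OLt \<Rightarrow> cmp_ty ts
    | OEq \<Rightarrow> cmp_ty ts | ONe \<Rightarrow> cmp_ty ts
    | ONot \<Rightarrow> (case ts of [t] \<Rightarrow> (if t = TBool then Some TBool else None) | _ \<Rightarrow> None)
    | OAnd \<Rightarrow> bool2_ty ts | OOr \<Rightarrow> bool2_ty ts)"

(* Gamma, l |- e : t  (l is the loop indicator) *)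
inductive has_ty :: "tyenv \<Rightarrow> bool \<Rightarrow> expr \<Rightarrow> ty \<Rightarrow> bool" where
  TVar: "\<Gamma> x = Some t \<Longrightarrow> has_ty \<Gamma> l (Var x) t"
| TNum: "has_ty \<Gamma> l (Num n) TIInt"
| TTrue: "has_ty \<Gamma> l ETrue TBool"
| TFalse: "has_ty \<Gamma> l EFalse TBool"
| TOp: "list_all2 (has_ty \<Gamma> l) es ts \<Longrightarrow> op_ty f ts = Some t \<Longrightarrow> has_ty \<Gamma> l (Op f es) t"
| TParen: "has_ty \<Gamma> l e t \<Longrightarrow> has_ty \<Gamma> l (Paren e) t"

inductive stmt_ty :: "tyenv \<Rightarrow> bool \<Rightarrow> stmt \<Rightarrow> tyenv \<Rightarrow> bool"
  and stmts_ty :: "tyenv \<Rightarrow> bool \<Rightarrow> stmt list \<Rightarrow> tyenv \<Rightarrow> bool"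
where
  TDecl: "x \<notin> dom \<Gamma> \<Longrightarrow> \<not> (l \<and> t = TIInt) \<Longrightarrow> stmt_ty \<Gamma> l (Decl t x) (\<Gamma>(x \<mapsto> t))"
| TAssign: "\<Gamma> x = Some tx \<Longrightarrow> \<not> (l \<and> tx = TIInt) \<Longrightarrow> has_ty \<Gamma> l e t \<Longrightarrow>
            (is_int_ty t \<and> is_int_ty tx) \<or> (t = TBool \<and> tx = TBool) \<Longrightarrow>
            stmt_ty \<Gamma> l (Assign x e) \<Gamma>"
| TBlock: "stmts_ty \<Gamma> l ss \<Gamma>' \<Longrightarrow> stmt_ty \<Gamma> l (Block ss) \<Gamma>"
| TIf: "has_ty \<Gamma> l e TBool \<Longrightarrow> stmt_ty \<Gamma> l s1 \<Gamma>1 \<Longrightarrow> stmt_ty \<Gamma> l s2 \<Gamma>2 \<Longrightarrow>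
        stmt_ty \<Gamma> l (If e s1 s2) \<Gamma>"
| TFor: "has_ty \<Gamma> l (Op OSize [e]) TIInt \<Longrightarrow> x \<notin> dom \<Gamma> \<Longrightarrow>
         stmt_ty (\<Gamma>(x \<mapsto> TIInt)) True s \<Gamma>' \<Longrightarrow> stmt_ty \<Gamma> l (For x e s) \<Gamma>"
| TNil: "stmts_ty \<Gamma> l [] \<Gamma>"
| TCons: "stmt_ty \<Gamma> l s \<Gamma>1 \<Longrightarrow> stmts_ty \<Gamma>1 l ss \<Gamma>' \<Longrightarrow> stmts_ty \<Gamma> l (s # ss) \<Gamma>'"

definition well_typed :: "prog \<Rightarrow> bool" where
  "well_typed p \<longleftrightarrow>
     (\<exists>\<Gamma>' t. stmts_ty (Map.empty(params p [\<mapsto>] replicate (length (params p)) TInt)) False (body p) \<Gamma>'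
        \<and> has_ty \<Gamma>' False (ret p) t \<and> is_int_ty t)"

definition prog_out :: "prog \<Rightarrow> int list \<Rightarrow> int \<Rightarrow> bool" where
  "prog_out p vs v \<longleftrightarrow>
     (\<exists>\<Sigma>'. execs (Map.empty(params p [\<mapsto>] map VInt vs)) (body p) \<Sigma>' \<and> eval \<Sigma>' (ret p) (VInt v))"

definition in_FPC :: "nat \<Rightarrow> (int list \<Rightarrow> int) \<Rightarrow> bool" where
  "in_FPC m f \<longleftrightarrow> (\<exists>p. well_typed p \<and> length (params p) = m \<and>
                        (\<forall>vs. length vs = m \<longrightarrow> prog_out p vs (f vs)))"

(* states {0..<tm_states}, tape symbols {0..<tm_syms}, 0 = blank;
   transition gives (new state, written symbol, head move in {-1,0,1}) *)
record tm =
  tm_states :: nat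
  tm_syms :: nat
  tm_delta :: "nat \<Rightarrow> nat \<Rightarrow> nat \<times> nat \<times> int"
  tm_start :: nat
  tm_halt :: nat

definition wf_tm :: "tm \<Rightarrow> bool" where
  "wf_tm M \<longleftrightarrow> 6 \<le> tm_syms M \<and> tm_start M < tm_states M \<and> tm_halt M < tm_states M \<and>
     (\<forall>q < tm_states M. \<forall>a < tm_syms M.
        (case tm_delta M q a of (q', b, d) \<Rightarrow> q' < tm_states M \<and> b < tm_syms M \<and> d \<in> {-1, 0, 1}))"

type_synonym config = "nat \<times> (int \<Rightarrow> nat) \<times> int"

definition tm_step :: "tm \<Rightarrow> config \<Rightarrow> config" where
  "tm_step M c = (case c of (q, tp, h) \<Rightarrow>
     if q = tm_halt M then (q, tp, h)
     else (case tm_delta M q (tp h) of (q', b, d) \<Rightarrow> (q', tp(h := b), h + d)))"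

(* binary digits of a natural number, most significant first; symbol 1 = bit 0, 2 = bit 1 *)
fun bin :: "nat \<Rightarrow> nat list" where
  "bin n = (if n = 0 then [] else bin (n div 2) @ [n mod 2 + 1])"

(* sign symbol (3 = '+', 4 = '-') followed by binary digits of |v| *)
definition enc_int :: "int \<Rightarrow> nat list" where
  "enc_int v = (if v < 0 then 4 else 3) # bin (nat \<bar>v\<bar>)"

(* each input followed by separator symbol 5 *)
definition enc_input :: "int list \<Rightarrow> nat list" where
  "enc_input vs = concat (map (\<lambda>v. enc_int v @ [5]) vs)"

definition init_config :: "tm \<Rightarrow> nat list \<Rightarrow> config" where
  "init_config M w = (tm_start M, (\<lambda>i. if 0 \<le> i \<and> i < int (length w) then w ! nat i else 0), 0)"

definition tape_holds :: "(int \<Rightarrow> nat) \<Rightarrow> nat list \<Rightarrow> bool" where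
  "tape_holds tp w \<longleftrightarrow> (\<forall>i < length w. tp (int i) = w ! i) \<and> tp (int (length w)) = 0"

definition bit_length :: "int \<Rightarrow> nat" where
  "bit_length v = length (bin (nat \<bar>v\<bar>))"

definition input_size :: "int list \<Rightarrow> nat" where
  "input_size vs = sum_list (map bit_length vs)"

definition in_FP :: "nat \<Rightarrow> (int list \<Rightarrow> int) \<Rightarrow> bool" where
  "in_FP m f \<longleftrightarrow> (\<exists>M c k. wf_tm M \<and>
     (\<forall>vs. length vs = m \<longrightarrow>
        (\<exists>t \<le> c * (input_size vs + 1) ^ k.
           (case (tm_step M ^^ t) (init_config M (enc_input vs)) of (q, tp, h) \<Rightarrow>
              q = tm_halt M \<and> tape_holds tp (enc_int (f vs))))))"

end

theory Submission
  imports Defs "HOL-Library.Countable"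
begin

text \<open>From programs to machines: the intermediate model is a while language over integer registers
  whose only operations are affine-linear assignments and sign tests. A Turing machine keeps register
  \<open>r\<close> in two's complement on bit \<open>r\<close> of its tape symbols, so one left-to-right sweep with a bounded
  carry evaluates an affine form, and the input word, whose symbols are less than 8, already is the
  contents of registers 0, 1 and 2. Division and \<open>size\<close> are programmed by repeated doubling. Inside a
  loop the \<open>iint\<close> variables are constant, so the number of steps is polynomial in the bit length of
  the \<open>iint\<close> values at loop entry, and since there is no multiplication every step adds only
  constantly many bits to the variables.

  From machines to programs: the two halves of the tape are numerals in base \<open>tm_syms\<close>, a machine step
  is a case distinction on state and scanned symbol, and \<open>k\<close> nested loops over an \<open>iint\<close> bound of
  bit length \<open>X\<close> iterate it \<open>X ^ k\<close> times; running past the halting time is harmless.\<close>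

subsection \<open>A register language\<close>

text \<open>The obstacle in the first direction is finite control: values grow, but an affine form
  with fixed coefficients has carries bounded by the sum of its absolute coefficients, so carry and
  continuation fit into the state. A sweep widens the tape by a constant number of cells, so
  \<open>n\<close> register steps take time of the order of \<open>n\<close> times the input length
  plus \<open>n\<close> squared. \<open>in_FPC\<close> supplies an execution for every input, and
  the cost analysis annotates that execution. Growth inside loops has to be additive, because a
  polynomial composed with itself once per iteration would become exponential; outside loops
  finitely many polynomials are composed, which is harmless. In the other direction the type system
  lets an \<open>int\<close> value flow into an \<open>iint\<close> variable only outside loops. The
  generated program uses this to build \<open>2 + \<Sum> 2|v|\<close> over its inputs. The bit
  length \<open>X\<close> of this number is at least 2 and at least the bit length of each input, so
  a power of \<open>X\<close> whose exponent depends only on the machine's time bound and on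
  \<open>m\<close> exceeds that bound.\<close>

type_synonym lin = "int \<times> (nat \<times> int) list"
type_synonym regs = "nat \<Rightarrow> int"

definition lval :: "lin \<Rightarrow> regs \<Rightarrow> int" where
  "lval l \<sigma> = fst l + (\<Sum>(r, a)\<leftarrow>snd l. a * \<sigma> r)"

datatype com = Asn nat lin | Seq com com | Cond lin com com | While lin com

text \<open>The step count is exactly that of the continuation machine \<open>kstep\<close>, where
  unfolding a sequence or testing a guard is a step of its own; hence the \<open>Suc\<close> in the
  composite rules.\<close>

inductive lexec :: "com \<Rightarrow> regs \<Rightarrow> nat \<Rightarrow> regs \<Rightarrow> bool" where
  LAsn: "lexec (Asn d l) \<sigma> 1 (\<sigma>(d := lval l \<sigma>))"
| LSeq: "lexec c1 \<sigma> n1 \<sigma>1 \<Longrightarrow> lexec c2 \<sigma>1 n2 \<sigma>2 \<Longrightarrow> lexec (Seq c1 c2) \<sigma> (Suc (n1 + n2)) \<sigma>2"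
| LCondT: "lval l \<sigma> < 0 \<Longrightarrow> lexec c1 \<sigma> n \<tau> \<Longrightarrow> lexec (Cond l c1 c2) \<sigma> (Suc n) \<tau>"
| LCondF: "\<not> lval l \<sigma> < 0 \<Longrightarrow> lexec c2 \<sigma> n \<tau> \<Longrightarrow> lexec (Cond l c1 c2) \<sigma> (Suc n) \<tau>"
| LWhileF: "\<not> lval l \<sigma> < 0 \<Longrightarrow> lexec (While l c) \<sigma> 1 \<sigma>"
| LWhileT: "lval l \<sigma> < 0 \<Longrightarrow> lexec c \<sigma> n1 \<sigma>1 \<Longrightarrow> lexec (While l c) \<sigma>1 n2 \<sigma>2
    \<Longrightarrow> lexec (While l c) \<sigma> (Suc (n1 + n2)) \<sigma>2"

fun next_cont :: "bool \<Rightarrow> com list \<Rightarrow> com list" where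
  "next_cont b [] = []"
| "next_cont b (Asn d l # K) = K"
| "next_cont b (Seq c1 c2 # K) = c1 # c2 # K"
| "next_cont b (Cond l c1 c2 # K) = (if b then c1 else c2) # K"
| "next_cont b (While l c # K) = (if b then c # While l c # K else K)"

text \<open>A sequence is assigned the zero form, so that every step has the same shape, evaluating
  one affine form, and the Turing machine needs only one kind of sweep.\<close>

fun head_lin :: "com list \<Rightarrow> lin" where
  "head_lin (Asn d l # K) = l"
| "head_lin (Cond l c1 c2 # K) = l"
| "head_lin (While l c # K) = l"
| "head_lin _ = (0, [])"

fun head_upd :: "com list \<Rightarrow> int \<Rightarrow> regs \<Rightarrow> regs" where
  "head_upd (Asn d l # K) v \<sigma> = \<sigma>(d := v)"
| "head_upd _ v \<sigma> = \<sigma>"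

fun kstep :: "com list \<times> regs \<Rightarrow> com list \<times> regs" where
  "kstep (K, \<sigma>) = (let v = lval (head_lin K) \<sigma> in (next_cont (v < 0) K, head_upd K v \<sigma>))"

lemma lexec_kstep: "lexec c \<sigma> n \<tau> \<Longrightarrow> (kstep ^^ n) (c # K, \<sigma>) = (K, \<tau>)"
proof (induction arbitrary: K rule: lexec.induct)
  case (LSeq c1 \<sigma> n1 \<sigma>1 c2 n2 \<sigma>2)
  have "(kstep ^^ (n2 + n1)) (c1 # c2 # K, \<sigma>) = (K, \<sigma>2)"
    by (simp only: funpow_add o_apply LSeq.IH)
  then show ?case by (simp add: funpow_swap1 funpow_Suc_right add.commute del: funpow.simps)
next
  case (LWhileT l \<sigma> c n1 \<sigma>1 n2 \<sigma>2)
  have "(kstep ^^ (n2 + n1)) (c # While l c # K, \<sigma>) = (K, \<sigma>2)"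
    by (simp only: funpow_add o_apply LWhileT.IH)
  with LWhileT(1) show ?case by (simp add: funpow_swap1 funpow_Suc_right add.commute del: funpow.simps)
qed (simp_all add: funpow_Suc_right del: funpow.simps)

text \<open>A finite set containing all nonempty continuations reachable from \<open>[c]\<close>. It
  is finite because a loop puts itself back behind its body, so the depth of a continuation is
  bounded by the nesting of \<open>c\<close>.\<close>

primrec conts :: "com \<Rightarrow> com list set" where
  "conts (Asn d l) = {[Asn d l]}"
| "conts (Seq c1 c2) = {[Seq c1 c2]} \<union> (\<lambda>k. k @ [c2]) ` conts c1 \<union> conts c2"
| "conts (Cond l c1 c2) = {[Cond l c1 c2]} \<union> conts c1 \<union> conts c2"
| "conts (While l c) = {[While l c]} \<union> (\<lambda>k. k @ [While l c]) ` conts c"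

lemma finite_conts: "finite (conts c)"
  by (induction c) auto

lemma self_conts: "[c] \<in> conts c"
  by (induction c) auto

lemma next_cont_append: "k \<noteq> [] \<Longrightarrow> next_cont b (k @ L) = next_cont b k @ L"
  by (cases "(b, k)" rule: next_cont.cases) auto

lemma conts_nonempty: "k \<in> conts c \<Longrightarrow> k \<noteq> []"
  by (induction c) auto

text \<open>When the inner continuation runs empty, what remains is \<open>[c2]\<close> or
  \<open>[While l c]\<close>, again a member; only a finished program leaves the set, through
  \<open>[]\<close>.\<close>

lemma next_cont_conts: "k \<in> conts c \<Longrightarrow> next_cont b k \<in> insert [] (conts c)"
proof (induction c arbitrary: k)
  case (Seq c1 c2)
  from Seq.prems consider "k = [Seq c1 c2]" | k' where "k' \<in> conts c1" "k = k' @ [c2]" | "k \<in> conts c2"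
    by auto
  then show ?case
  proof cases
    case 1
    then show ?thesis using self_conts[of c1] by force
  next
    case 2
    then have "next_cont b k = next_cont b k' @ [c2]"
      by (simp add: next_cont_append conts_nonempty)
    then show ?thesis using Seq.IH(1)[OF 2(1)] self_conts[of c2] by auto
  next
    case 3
    then show ?thesis using Seq.IH(2) by auto
  qed
next
  case (While l c)
  from While.prems consider "k = [While l c]" | k' where "k' \<in> conts c" "k = k' @ [While l c]"
    by auto
  then show ?case
  proof cases
    case 1
    then show ?thesis using self_conts[of c] by force
  next
    case 2
    then have "next_cont b k = next_cont b k' @ [While l c]"
      by (simp add: next_cont_append conts_nonempty)
    then show ?thesis using While.IH[OF 2(1)] by auto
  qed
qed (use self_conts in auto)

text \<open>\<open>2 ^ E\<close> bounds the total weight of the form. The same \<open>E\<close> then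
  bounds the carry, the bits added to a value by one assignment and, up to one, the cells added to
  the tape.\<close>

definition lin_ok :: "nat set \<Rightarrow> nat \<Rightarrow> lin \<Rightarrow> bool" where
  "lin_ok R E l \<longleftrightarrow> fst ` set (snd l) \<subseteq> R \<and> \<bar>fst l\<bar> + (\<Sum>(r, a)\<leftarrow>snd l. \<bar>a\<bar>) \<le> 2 ^ E"

primrec com_ok :: "nat set \<Rightarrow> nat \<Rightarrow> com \<Rightarrow> bool" where
  "com_ok R E (Asn d l) = (d \<in> R \<and> lin_ok R E l)"
| "com_ok R E (Seq c1 c2) = (com_ok R E c1 \<and> com_ok R E c2)"
| "com_ok R E (Cond l c1 c2) = (lin_ok R E l \<and> com_ok R E c1 \<and> com_ok R E c2)"
| "com_ok R E (While l c) = (lin_ok R E l \<and> com_ok R E c)"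

primrec com_regs :: "com \<Rightarrow> nat set" where
  "com_regs (Asn d l) = insert d (fst ` set (snd l))"
| "com_regs (Seq c1 c2) = com_regs c1 \<union> com_regs c2"
| "com_regs (Cond l c1 c2) = fst ` set (snd l) \<union> com_regs c1 \<union> com_regs c2"
| "com_regs (While l c) = fst ` set (snd l) \<union> com_regs c"

lemma finite_com_regs: "finite (com_regs c)"
  by (induction c) auto

lemma lin_ok_mono: "lin_ok R E l \<Longrightarrow> R \<subseteq> R' \<Longrightarrow> E \<le> E' \<Longrightarrow> lin_ok R' E' l"
  unfolding lin_ok_def by (meson order_trans power_increasing one_le_numeral)

lemma com_ok_mono: "com_ok R E c \<Longrightarrow> R \<subseteq> R' \<Longrightarrow> E \<le> E' \<Longrightarrow> com_ok R' E' c"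
  by (induction c) (auto intro: lin_ok_mono)

lemma ex_lin_ok:
  assumes "fst ` set (snd l) \<subseteq> R"
  shows "\<exists>E. lin_ok R E l"
proof -
  define s where "s = \<bar>fst l\<bar> + (\<Sum>(r, a)\<leftarrow>snd l. \<bar>a\<bar>)"
  have "s \<le> int (nat s)" by simp
  also have "\<dots> \<le> 2 ^ nat s"
    by (metis less_exp of_nat_le_iff of_nat_numeral of_nat_power order_less_imp_le)
  finally show ?thesis
    using assms unfolding lin_ok_def s_def by blast
qed

lemma ex_com_ok: "com_regs c \<subseteq> R \<Longrightarrow> \<exists>E. com_ok R E c"
proof (induction c)
  case (Asn d l) then show ?case using ex_lin_ok by auto
next
  case (Seq c1 c2)
  then obtain E1 E2 where "com_ok R E1 c1" "com_ok R E2 c2" by auto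
  then have "com_ok R (max E1 E2) c1" "com_ok R (max E1 E2) c2" by (auto intro: com_ok_mono)
  then show ?case by auto
next
  case (Cond l c1 c2)
  then obtain E1 E2 E3 where "com_ok R E1 c1" "com_ok R E2 c2" "lin_ok R E3 l"
    using ex_lin_ok[of l R] by auto
  then have "com_ok R (max E1 (max E2 E3)) c1" "com_ok R (max E1 (max E2 E3)) c2"
    "lin_ok R (max E1 (max E2 E3)) l"
    by (auto intro: com_ok_mono lin_ok_mono)
  then show ?case by auto
next
  case (While l c)
  then obtain E1 E3 where "com_ok R E1 c" "lin_ok R E3 l"
    using ex_lin_ok[of l R] by auto
  then have "com_ok R (max E1 E3) c" "lin_ok R (max E1 E3) l"
    by (auto intro: com_ok_mono lin_ok_mono)
  then show ?case by auto
qed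

lemma lin_ok_head_lin: "\<forall>c\<in>set K. com_ok R E c \<Longrightarrow> lin_ok R E (head_lin K)"
  by (cases K rule: head_lin.cases) (auto simp: lin_ok_def)

subsection \<open>Executing the register language on a Turing machine\<close>

text \<open>The contribution of one tape cell: a symbol \<open>s\<close> carries one bit of every
  register, so a single read yields a whole column of the addition.\<close>

definition bit_sum :: "lin \<Rightarrow> nat \<Rightarrow> int" where
  "bit_sum l s = (\<Sum>(r, a)\<leftarrow>snd l. a * of_bool (bit s r))"

fun write_bit :: "com list \<Rightarrow> bool \<Rightarrow> nat \<Rightarrow> nat" where
  "write_bit (Asn d l # K) b s = (if b then set_bit d s else unset_bit d s)"
| "write_bit _ b s = s"

text \<open>The \<open>k\<close>-th bits of the symbols of a word, read as a numeral with the first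
  symbol least significant.\<close>

primrec plane :: "nat \<Rightarrow> nat list \<Rightarrow> int" where
  "plane k [] = 0"
| "plane k (a # w) = of_bool (bit a k) + 2 * plane k w"

lemma bit_plane: "bit (plane k w) p = (p < length w \<and> bit (w ! p) k)"
proof (induction w arbitrary: p)
  case (Cons a w)
  then show ?case
    by (cases p) (auto simp: bit_0 bit_Suc)
qed simp

lemma plane_bounds: "0 \<le> plane k w" "plane k w < 2 ^ length w"
  by (induction w) auto

definition planes :: "nat list \<Rightarrow> regs" where
  "planes w k = (if k < 3 then plane k w else 0)"

definition input_tape :: "nat list \<Rightarrow> int \<Rightarrow> nat" where
  "input_tape w i = (if 0 \<le> i \<and> i < int (length w) then w ! nat i else 0)"

section \<open>Sign extension and column-wise carries in two's complement\<close>

lemma bit_sign: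
  fixes v :: int
  assumes "- (2 ^ k) \<le> v" "v < 2 ^ k" "k \<le> p"
  shows "bit v p = (v < 0)"
proof -
  have le: "(2::int) ^ k \<le> 2 ^ p" using assms(3) by (simp add: power_increasing)
  show ?thesis
  proof (cases "v < 0")
    case True
    have "(v + 2 ^ p) div 2 ^ p = v div 2 ^ p + 1" by simp
    moreover have "(v + 2 ^ p) div 2 ^ p = 0" using True assms le by (intro div_pos_pos_trivial) linarith+
    ultimately have "v div 2 ^ p = - 1" by simp
    then show ?thesis using True by (simp add: bit_iff_odd)
  next
    case False
    then have "v div 2 ^ p = 0" using assms le by (intro div_pos_pos_trivial) linarith+
    then show ?thesis using False by (simp add: bit_iff_odd)
  qed
qed

text \<open>The carry into column \<open>p\<close> in closed form: what the shifted result has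
  beyond the combination of the shifted registers. Since \<open>div\<close> rounds down, it is also
  right for negative values and coefficients.\<close>

definition carry :: "lin \<Rightarrow> regs \<Rightarrow> nat \<Rightarrow> int" where
  "carry l \<sigma> p = lval l \<sigma> div 2 ^ p - (\<Sum>(r, a)\<leftarrow>snd l. a * (\<sigma> r div 2 ^ p))"

definition col_sum :: "lin \<Rightarrow> regs \<Rightarrow> nat \<Rightarrow> int" where
  "col_sum l \<sigma> p = (\<Sum>(r, a)\<leftarrow>snd l. a * of_bool (bit (\<sigma> r) p))"

lemma carry_0: "carry l \<sigma> 0 = fst l"
  by (simp add: carry_def lval_def)

text \<open>Splits the lowest remaining bit off every register; the output bit and the next carry
  then follow by parity and halving.\<close>

lemma sum_div_split:
  fixes \<sigma> :: regs
  shows "(\<Sum>(r, a)\<leftarrow>snd l. a * (\<sigma> r div 2 ^ p)) =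
    2 * (\<Sum>(r, a)\<leftarrow>snd l. a * (\<sigma> r div 2 ^ Suc p)) + col_sum l \<sigma> p"
proof -
  have "x div 2 ^ p = 2 * (x div 2 ^ Suc p) + of_bool (bit x p)" for x :: int
  proof -
    have "x div 2 ^ Suc p = x div 2 ^ p div 2"
      using zdiv_zmult2_eq[of 2 x "2 ^ p"] by (simp add: mult.commute)
    moreover have "of_bool (bit x p) = (x div 2 ^ p) mod 2"
      by (simp add: bit_iff_odd mod2_eq_if)
    ultimately show ?thesis by presburger
  qed
  then have *: "a * (\<sigma> r div 2 ^ p) = 2 * (a * (\<sigma> r div 2 ^ Suc p)) + a * of_bool (bit (\<sigma> r) p)" for a r
    by (metis distrib_left mult.left_commute)
  have "(\<Sum>(r, a)\<leftarrow>xs. a * (\<sigma> r div 2 ^ p)) =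
    2 * (\<Sum>(r, a)\<leftarrow>xs. a * (\<sigma> r div 2 ^ Suc p)) + (\<Sum>(r, a)\<leftarrow>xs. a * of_bool (bit (\<sigma> r) p))" for xs
    by (induction xs) (simp_all add: case_prod_beta * del: power_Suc)
  then show ?thesis by (simp add: col_sum_def)
qed

lemma bit_carry: "bit (lval l \<sigma>) p = odd (carry l \<sigma> p + col_sum l \<sigma> p)"
  unfolding bit_iff_odd[of "lval l \<sigma>"] carry_def sum_div_split[of \<sigma> p l] by simp

lemma carry_Suc: "carry l \<sigma> (Suc p) = (carry l \<sigma> p + col_sum l \<sigma> p) div 2"
proof -
  have "lval l \<sigma> div 2 ^ Suc p = lval l \<sigma> div 2 ^ p div 2"
    using zdiv_zmult2_eq[of 2 "lval l \<sigma>" "2 ^ p"] by (simp add: mult.commute)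
  moreover have "x div 2 - s = (x - (2 * s + c) + c) div 2" for x s c :: int
    by presburger
  ultimately show ?thesis
    unfolding carry_def sum_div_split[of \<sigma> p l] by metis
qed

lemma bit_sum_bound: "\<bar>bit_sum l s\<bar> \<le> (\<Sum>(r, a)\<leftarrow>snd l. \<bar>a\<bar>)"
proof -
  have "\<bar>(\<Sum>(r, a)\<leftarrow>xs. a * of_bool (bit s r))\<bar> \<le> (\<Sum>(r, a)\<leftarrow>xs. \<bar>a\<bar>)" for xs :: "(nat \<times> int) list"
    by (induction xs) auto
  then show ?thesis by (simp add: bit_sum_def)
qed

text \<open>The control state holds a continuation, of which only finitely many are reachable. Bit 3 of a
  symbol marks the cells in use. \<open>Fwd K c pv j\<close> sweeps right, executing the head of \<open>K\<close> with carry
  \<open>c\<close>; at the right end the last symbol \<open>pv\<close> is copied to \<open>j + 1\<close> fresh cells, which sign-extends all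
  registers so that no result overflows.\<close>

datatype state = Init | Fwd "com list" int nat nat | Back "com list" | Fin | Halt

text \<open>Register 3 is excluded because bit 3 of a symbol is the marker; registers 0, 1 and 2
  must be represented because they hold the input and output words.\<close>

locale machine =
  fixes P :: com and R :: "nat set" and E Kb :: nat
  assumes ok: "com_ok R E P" and three: "3 \<notin> R" and Rb: "R \<subseteq> {..<Kb}" and io: "{0, 1, 2} \<subseteq> R"
    and Kb: "4 \<le> Kb"
begin

text \<open>The carry starts as the constant term of the form. The previous symbol 0 is a dummy: a
  represented tape has at least one marked cell, which replaces it.\<close>

definition start :: "com list \<Rightarrow> state" where
  "start K = (if K = [] then Fin else Fwd K (fst (head_lin K)) 0 E)"

text \<open>\<open>Init\<close> marks the input and closes it with 8, a marked cell whose register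
  bits are all 0 and which serves as a nonnegative sign cell. In \<open>Fwd\<close> the remembered
  \<open>pv\<close> is the symbol before writing, so sign extension uses the old register contents.
  At \<open>j = 0\<close> the computed bit is the sign of the value and selects the next
  continuation.\<close>

fun delta :: "state \<Rightarrow> nat \<Rightarrow> state \<times> nat \<times> int" where
  "delta Init s = (if s = 0 then (Back [P], 8, -1) else (Init, set_bit 3 s, 1))"
| "delta (Fwd K c pv j) s =
    (if bit s 3
     then (Fwd K ((c + bit_sum (head_lin K) s) div 2) s j,
           write_bit K (odd (c + bit_sum (head_lin K) s)) s, 1)
     else let b = odd (c + bit_sum (head_lin K) pv) in
       if j = 0 then (Back (next_cont b K), write_bit K b pv, -1)
       else (Fwd K ((c + bit_sum (head_lin K) pv) div 2) pv (j - 1), write_bit K b pv, 1))"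
| "delta (Back K) s = (if bit s 3 then (Back K, s, -1) else (start K, s, 1))"
| "delta Fin s = (if bit s 3 then (Fin, take_bit 3 s, 1) else (Halt, s, 0))"
| "delta Halt s = (Halt, s, 0)"

fun astep :: "state \<times> (int \<Rightarrow> nat) \<times> int \<Rightarrow> state \<times> (int \<Rightarrow> nat) \<times> int" where
  "astep (q, tp, h) = (if q = Halt then (q, tp, h)
     else case delta q (tp h) of (q', b, d) \<Rightarrow> (q', tp(h := b), h + d))"

section \<open>Finiteness of the control\<close>

definition conts0 :: "com list set" where "conts0 = insert [] (conts P)"

definition states :: "state set" where
  "states = {Init, Fin, Halt} \<union> Back ` conts0 \<union>
     (\<lambda>(K, c, pv, j). Fwd K c pv j) ` (conts0 \<times> {-(2 ^ E)..2 ^ E} \<times> {..<2 ^ Kb} \<times> {..E})"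

lemma finite_states: "finite states"
  by (simp add: states_def conts0_def finite_conts)

lemma conts0_ok: "K \<in> conts0 \<Longrightarrow> \<forall>c\<in>set K. com_ok R E c"
proof -
  have "K \<in> conts c \<Longrightarrow> com_ok R E c \<Longrightarrow> \<forall>c'\<in>set K. com_ok R E c'" for c
    by (induction c arbitrary: K) fastforce+
  then show "K \<in> conts0 \<Longrightarrow> \<forall>c\<in>set K. com_ok R E c" using ok by (auto simp: conts0_def)
qed

lemma conts0_next: "K \<in> conts0 \<Longrightarrow> next_cont b K \<in> conts0"
  using next_cont_conts[of K P b] by (auto simp: conts0_def)

text \<open>Both summands are at most \<open>2 ^ E\<close> in absolute value and halving restores
  the bound, so sweeps of any length get by with finitely many carries.\<close>

lemma carry_bound:
  assumes "K \<in> conts0" "\<bar>c\<bar> \<le> 2 ^ E"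
  shows "\<bar>(c + bit_sum (head_lin K) s) div 2\<bar> \<le> 2 ^ E"
proof -
  have "\<bar>bit_sum (head_lin K) s\<bar> \<le> 2 ^ E"
    using bit_sum_bound[of "head_lin K" s] lin_ok_head_lin[OF conts0_ok[OF assms(1)]]
    unfolding lin_ok_def by linarith
  with assms(2) show ?thesis by linarith
qed

lemma write_bit_less:
  assumes "K \<in> conts0" "s < 2 ^ Kb"
  shows "write_bit K b s < 2 ^ Kb"
proof (cases K)
  case (Cons c K')
  show ?thesis
  proof (cases c)
    case (Asn d l)
    then have "d < Kb" using conts0_ok[OF assms(1)] Cons Rb by auto
    moreover have "take_bit Kb s = s" using assms(2) by (simp add: take_bit_nat_eq_self_iff)
    ultimately have "take_bit Kb (write_bit K b s) = write_bit K b s"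
      using Cons Asn by (simp add: take_bit_set_bit_eq take_bit_unset_bit_eq)
    then show ?thesis by (simp add: take_bit_nat_eq_self_iff)
  qed (use Cons assms in auto)
qed (use assms in auto)

lemma delta_states:
  assumes "q \<in> states" "s < 2 ^ Kb" "delta q s = (q', b, d)"
  shows "q' \<in> states \<and> b < 2 ^ Kb \<and> d \<in> {-1, 0, 1}"
proof -
  have st: "start K \<in> states" if "K \<in> conts0" for K
  proof -
    have "\<bar>fst (head_lin K)\<bar> \<le> 2 ^ E"
      using lin_ok_head_lin[OF conts0_ok[OF that]] bit_sum_bound[of "head_lin K" 0]
      unfolding lin_ok_def by linarith
    then show ?thesis using that by (auto simp: start_def states_def image_iff)
  qed
  have P: "[P] \<in> conts0" by (simp add: conts0_def self_conts)
  have s3: "set_bit 3 s < 2 ^ Kb"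
  proof -
    have "take_bit Kb s = s" using assms(2) by (simp add: take_bit_nat_eq_self_iff)
    then have "take_bit Kb (set_bit 3 s) = set_bit 3 s"
      using Kb by (simp add: take_bit_set_bit_eq)
    then show ?thesis by (simp add: take_bit_nat_eq_self_iff)
  qed
  have e8: "(8::nat) < 2 ^ Kb" using power_increasing[OF Kb, of "2::nat"] by simp
  have t3: "take_bit 3 s < 2 ^ Kb" using assms(2) by (meson le_less_trans take_bit_nat_less_eq_self)
  show ?thesis
  proof (cases q)
    case (Fwd K c pv j)
    with assms(1) have K: "K \<in> conts0" and c: "\<bar>c\<bar> \<le> 2 ^ E" and pv: "pv < 2 ^ Kb" and j: "j \<le> E"
      by (auto simp: states_def)
    note cb = carry_bound[OF K c, of s] carry_bound[OF K c, of pv]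
    note w = write_bit_less[OF K assms(2)] write_bit_less[OF K pv]
    have F: "Fwd K c' pv' j' \<in> states" if "\<bar>c'\<bar> \<le> 2 ^ E" "pv' < 2 ^ Kb" "j' \<le> E" for c' pv' j'
      using K that by (auto simp: states_def image_iff)
    have B: "Back (next_cont b K) \<in> states" for b
      using conts0_next[OF K] by (simp add: states_def)
    show ?thesis
    proof (cases "bit s 3")
      case True
      then show ?thesis using assms(2,3) Fwd F[OF cb(1) assms(2) j] w(1) by auto
    next
      case False
      then show ?thesis
        using assms(3) Fwd F[OF cb(2) pv, of "j - 1"] j w(2) B by (cases "j = 0") (auto simp: Let_def)
    qed
  next
    case (Back K)
    with assms(1) have "K \<in> conts0" by (auto simp: states_def)
    then show ?thesis using assms Back st by (auto split: if_splits)
  next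
    case Init
    then show ?thesis using assms s3 e8 P by (auto simp: states_def split: if_splits)
  qed (use assms t3 in \<open>auto simp: states_def split: if_splits\<close>)
qed

text \<open>The width \<open>W\<close> includes a sign cell: all values fit into
  \<open>W - 1\<close> bits plus sign, so the last cell shows the signs and copying it extends every
  register at once.\<close>

definition rep :: "regs \<Rightarrow> nat \<Rightarrow> (int \<Rightarrow> nat) \<Rightarrow> bool" where
  "rep \<sigma> W tp \<longleftrightarrow> 1 \<le> W \<and> (\<forall>x. x < 0 \<or> int W \<le> x \<longrightarrow> tp x = 0) \<and>
     (\<forall>p<W. bit (tp (int p)) 3 \<and> (\<forall>r\<in>R. bit (tp (int p)) r = bit (\<sigma> r) p)) \<and>
     (\<forall>r\<in>R. - (2 ^ (W - 1)) \<le> \<sigma> r \<and> \<sigma> r < 2 ^ (W - 1))"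

lemma bit_sum_eq:
  assumes "lin_ok R E l" "\<forall>r\<in>R. bit s r = bit (\<sigma> r) p"
  shows "bit_sum l s = col_sum l \<sigma> p"
proof -
  have "map (\<lambda>(r, a). a * of_bool (bit s r)) (snd l) = map (\<lambda>(r, a). a * of_bool (bit (\<sigma> r) p)) (snd l)"
    using assms by (auto simp: lin_ok_def)
  then show ?thesis unfolding bit_sum_def col_sum_def by (rule arg_cong)
qed

lemma lval_bound:
  assumes "lin_ok R E l" "1 \<le> (M :: int)" "\<forall>r\<in>R. \<bar>\<sigma> r\<bar> \<le> M"
  shows "\<bar>lval l \<sigma>\<bar> \<le> 2 ^ E * M"
proof -
  have "fst ` set xs \<subseteq> R \<Longrightarrow> \<bar>(\<Sum>(r, a)\<leftarrow>xs. a * \<sigma> r)\<bar> \<le> (\<Sum>(r, a)\<leftarrow>xs. \<bar>a\<bar>) * M" for xs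
  proof (induction xs)
    case (Cons x xs)
    obtain r a where x: "x = (r, a)" by force
    have "\<bar>a * \<sigma> r\<bar> \<le> \<bar>a\<bar> * M" using Cons.prems x assms(3) by (simp add: abs_mult mult_left_mono)
    then show ?case using Cons x by (auto simp: distrib_right)
  qed simp
  then have "\<bar>lval l \<sigma>\<bar> \<le> \<bar>fst l\<bar> + (\<Sum>(r, a)\<leftarrow>snd l. \<bar>a\<bar>) * M"
    using assms(1) unfolding lval_def lin_ok_def by fastforce
  also have "\<dots> \<le> (\<bar>fst l\<bar> + (\<Sum>(r, a)\<leftarrow>snd l. \<bar>a\<bar>)) * M"
    using assms(2) mult_left_mono[OF assms(2), of "\<bar>fst l\<bar>"] by (simp add: distrib_right)
  also have "\<dots> \<le> 2 ^ E * M"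
    using assms(1,2) by (intro mult_right_mono) (auto simp: lin_ok_def)
  finally show ?thesis .
qed

section \<open>One sweep performs one \<open>kstep\<close>\<close>

lemma back_run:
  assumes "\<forall>x. 0 \<le> x \<and> x < int N \<longrightarrow> bit (t x) 3" "n \<le> N"
  shows "(astep ^^ n) (Back K, t, int n - 1) = (Back K, t, -1)"
  using assms(2)
proof (induction n)
  case (Suc n)
  have "astep (Back K, t, int (Suc n) - 1) = (Back K, t, int n - 1)"
    using assms(1)[rule_format, of "int n"] Suc.prems by simp
  then show ?case using Suc by (simp add: funpow_Suc_right del: funpow.simps astep.simps)
qed simp

lemma back_home:
  assumes "\<forall>x. 0 \<le> x \<and> x < int n \<longrightarrow> bit (t x) 3" "t (-1) = 0"
  shows "(astep ^^ Suc n) (Back K, t, int n - 1) = (start K, t, 0)"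
  using back_run[OF assms(1) order_refl, of K] assms(2) by (simp add: fun_upd_idem)

text \<open>Column-wise addition over \<open>W + E + 1\<close> cells and the way back,
  \<open>W + E + 1\<close> steps each. The value is below \<open>2 ^ (W + E)\<close> in absolute
  value, so the extra cells hold it, and its bit in the last of them is its sign.\<close>

lemma sweep:
  assumes rep: "rep \<sigma> W tp" and "K \<noteq> []" and K: "K \<in> conts0" and ks: "kstep (K, \<sigma>) = (K', \<sigma>')"
  shows "\<exists>tp'. (astep ^^ (2 * (W + E) + 2)) (start K, tp, 0) = (start K', tp', 0)
    \<and> rep \<sigma>' (W + E + 1) tp'"
proof -
  define l where "l = head_lin K"
  define v where "v = lval l \<sigma>"
  have K': "K' = next_cont (v < 0) K" and \<sigma>': "\<sigma>' = head_upd K v \<sigma>"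
    using ks by (simp_all add: v_def l_def Let_def)
  have ok_l: "lin_ok R E l" unfolding l_def by (rule lin_ok_head_lin[OF conts0_ok[OF K]])
  have W: "1 \<le> W" and out0: "\<And>x. x < 0 \<or> int W \<le> x \<Longrightarrow> tp x = 0"
    and reg: "\<And>p. p < W \<Longrightarrow> bit (tp (int p)) 3"
    and bits: "\<And>p r. p < W \<Longrightarrow> r \<in> R \<Longrightarrow> bit (tp (int p)) r = bit (\<sigma> r) p"
    and bnd: "\<And>r. r \<in> R \<Longrightarrow> - (2 ^ (W - 1)) \<le> \<sigma> r \<and> \<sigma> r < 2 ^ (W - 1)"
    using rep unfolding rep_def by blast+
  have "\<bar>v\<bar> \<le> 2 ^ E * 2 ^ (W - 1)"
    unfolding v_def using bnd by (intro lval_bound[OF ok_l]) fastforce+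
  also have "\<dots> = 2 ^ (W + E - 1)" using W by (simp add: power_add[symmetric] add.commute)
  also have "\<dots> < (2::int) ^ (W + E)" using W by (intro power_strict_increasing) auto
  finally have vb: "- (2 ^ (W + E)) \<le> v" "v < 2 ^ (W + E)" by auto
  \<comment> \<open>\<open>et p\<close> is the symbol of the sign-extended old tape at position
    \<open>p\<close>.\<close>
  define et where "et p = tp (int (min p (W - 1)))" for p
  have et3: "bit (et p) 3" for p using reg[of "min p (W - 1)"] W by (simp add: et_def)
  have etb: "bit (et p) r = bit (\<sigma> r) p" if "r \<in> R" for p r
  proof (cases "p < W")
    case True
    then have "min p (W - 1) = p" by simp
    then show ?thesis using bits[OF True that] by (simp add: et_def)
  next
    case False
    then have "min p (W - 1) = W - 1" by simp
    then have "bit (et p) r = bit (\<sigma> r) (W - 1)"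
      using bits[of "W - 1" r] W that by (simp only: et_def)
    also have "\<dots> = (\<sigma> r < 0)" using bnd[OF that] by (intro bit_sign[where k = "W - 1"]) auto
    also have "\<dots> = bit (\<sigma> r) p" using bnd[OF that] False by (intro bit_sign[where k = "W - 1", symmetric]) auto
    finally show ?thesis .
  qed
  have sum: "bit_sum l (et p) = col_sum l \<sigma> p" for p
    using etb by (intro bit_sum_eq[OF ok_l]) auto
  \<comment> \<open>The tape after \<open>q\<close> cells have been rewritten.\<close>
  define tq where "tq q x = (if 0 \<le> x \<and> x < int q then write_bit K (bit v (nat x)) (et (nat x)) else tp x)"
    for q x
  have tqS: "(tq q)(int q := write_bit K (bit v q) (et q)) = tq (Suc q)" for q
    by (rule ext) (auto simp: tq_def)
  have tq_at: "tq q (int q) = tp (int q)" for q by (simp add: tq_def)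
  have bv: "odd (carry l \<sigma> q + bit_sum l (et q)) = bit v q" for q
    by (simp add: sum v_def bit_carry)
  have cs: "(carry l \<sigma> q + bit_sum l (et q)) div 2 = carry l \<sigma> (Suc q)" for q
    by (simp add: sum carry_Suc)
  have prev: "et (q - 1) = et q" if "W \<le> q" for q
  proof -
    have "min (q - 1) (W - 1) = min q (W - 1)" using that by simp
    then show ?thesis by (simp only: et_def)
  qed
  \<comment> \<open>The configuration after \<open>q\<close> steps to the right; truncated
    subtraction keeps the counter at \<open>E\<close> until the old end \<open>W\<close> is
    passed.\<close>
  have main: "(astep ^^ q) (start K, tp, 0) =
     (Fwd K (carry l \<sigma> q) (if q = 0 then 0 else et (q - 1)) (E - (q - W)), tq q, int q)"
    if "q \<le> W + E" for q
    using that
  proof (induction q)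
    case 0
    have "tq 0 = tp" by (rule ext) (simp add: tq_def)
    then show ?case using \<open>K \<noteq> []\<close> by (simp add: start_def carry_0 l_def)
  next
    case (Suc q)
    have *: "astep (Fwd K (carry l \<sigma> q) (if q = 0 then 0 else et (q - 1)) (E - (q - W)), tq q, int q) =
      (Fwd K (carry l \<sigma> (Suc q)) (et q) (E - (Suc q - W)), tq (Suc q), int (Suc q))"
    proof (cases "q < W")
      case True
      then have "min q (W - 1) = q" by simp
      then have "tp (int q) = et q" by (simp only: et_def)
      then show ?thesis using True et3[of q] tqS[of q] bv[of q] cs[of q]
        by (simp add: tq_at l_def[symmetric] add.commute)
    next
      case False
      then have "q \<noteq> 0" "et (q - Suc 0) = et q" "tp (int q) = 0" "E - (q - W) \<noteq> 0"
        "E - (q - W) - 1 = E - (Suc q - W)"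
        using W out0[of "int q"] prev[of q] Suc.prems by auto
      then show ?thesis using tqS[of q] bv[of q] cs[of q]
        by (simp add: tq_at l_def[symmetric] add.commute Let_def)
    qed
    show ?case using Suc by (simp add: * del: astep.simps)
  qed
  define t where "t = tq (Suc (W + E))"
  have last: "astep (Fwd K (carry l \<sigma> (W + E)) (et (W + E)) 0, tq (W + E), int (W + E)) =
    (Back K', t, int (W + E) - 1)"
  proof -
    have "tp (int (W + E)) = 0" using out0 by auto
    moreover have "bit v (W + E) = (v < 0)" using vb by (intro bit_sign) auto
    ultimately show ?thesis using tqS[of "W + E"] bv[of "W + E"] K'
      by (simp add: tq_at[of "W + E", simplified] l_def[symmetric] Let_def t_def)
  qed
  \<comment> \<open>Targets of assignments lie in \<open>R\<close>, which does not contain 3, so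
    writing a result bit cannot destroy a marker.\<close>
  have rd: "3 \<noteq> d \<and> d \<in> R" if "K = Asn d l' # K''" for d l' K''
    using conts0_ok[OF K] that three by auto
  have w3: "bit (write_bit K b s) 3 = bit s 3" for b s
    using rd by (cases "(K, b, s)" rule: write_bit.cases) (auto simp: bit_simps)
  have t3: "\<forall>x. 0 \<le> x \<and> x < int (W + E + 1) \<longrightarrow> bit (t x) 3"
    using et3 by (auto simp: t_def tq_def w3)
  have "(astep ^^ (Suc (W + E) + Suc (W + E))) (start K, tp, 0) = (start K', t, 0)"
  proof -
    have "(astep ^^ Suc (W + E)) (start K, tp, 0) = (Back K', t, int (W + E) - 1)"
      using main[of "W + E"] last W prev[of "W + E"] by (simp del: astep.simps)
    moreover have "(astep ^^ Suc (W + E)) (Back K', t, int (W + E) - 1) = (start K', t, 0)"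
      using t3 out0[of "-1"] by (intro back_home) (auto simp: t_def tq_def)
    ultimately show ?thesis by (simp only: funpow_add o_apply)
  qed
  moreover have "rep \<sigma>' (W + E + 1) t"
    unfolding rep_def
  proof (intro conjI allI impI ballI)
    fix x assume "x < 0 \<or> int (W + E + 1) \<le> x"
    then show "t x = 0" using out0[of x] by (auto simp: t_def tq_def)
  next
    fix p assume p: "p < W + E + 1"
    then show "bit (t (int p)) 3" using t3 by auto
    fix r assume r: "r \<in> R"
    have tp: "t (int p) = write_bit K (bit v p) (et p)" using p by (simp add: t_def tq_def)
    show "bit (t (int p)) r = bit (\<sigma>' r) p"
      unfolding tp \<sigma>' using etb[OF r, of p] 
      by (cases "(K, v, \<sigma>)" rule: head_upd.cases) (auto simp: bit_simps)
  next
    fix r assume r: "r \<in> R"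
    have "(2::int) ^ (W - 1) \<le> 2 ^ (W + E + 1 - 1)" by (intro power_increasing) auto
    then have "- (2 ^ (W + E)) \<le> \<sigma> r" "\<sigma> r < 2 ^ (W + E)"
      using bnd[OF r] unfolding add_diff_cancel_right' by linarith+
    moreover have "\<sigma>' r = v \<or> \<sigma>' r = \<sigma> r"
      unfolding \<sigma>' by (cases "(K, v, \<sigma>)" rule: head_upd.cases) auto
    ultimately show "- (2 ^ (W + E + 1 - 1)) \<le> \<sigma>' r" "\<sigma>' r < 2 ^ (W + E + 1 - 1)"
      unfolding add_diff_cancel_right' using vb by metis+
  qed (use W in auto)
  moreover have "2 * (W + E) + 2 = Suc (W + E) + Suc (W + E)" by simp
  ultimately show ?thesis by metis
qed

lemma kstep_Nil: "(kstep ^^ n) ([], \<sigma>) = ([], \<sigma>)"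
  by (induction n) auto

text \<open>Each step widens the tape by \<open>E + 1\<close>, so no sweep is longer than one over
  width \<open>W + n * (E + 1)\<close>. The empty continuation idles under \<open>kstep\<close>, so
  the machine may finish before the \<open>n\<close> steps are used up.\<close>

lemma kstep_run:
  assumes "(kstep ^^ n) (K, \<sigma>) = ([], \<tau>)" "K \<in> conts0" "rep \<sigma> W tp"
  shows "\<exists>t tp' W'. (astep ^^ t) (start K, tp, 0) = (Fin, tp', 0) \<and> rep \<tau> W' tp'
     \<and> t \<le> n * (2 * (W + n * (E + 1) + E) + 2) \<and> W' \<le> W + n * (E + 1)"
  using assms
proof (induction n arbitrary: K \<sigma> W tp)
  case 0
  then show ?case by (intro exI[of _ 0] exI[of _ tp] exI[of _ W]) (auto simp: start_def)
next
  case (Suc n)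
  show ?case
  proof (cases "K = []")
    case True
    then have "\<tau> = \<sigma>" using Suc.prems(1) kstep_Nil[of "Suc n" \<sigma>] by (simp del: funpow.simps)
    then show ?thesis using True Suc.prems(3)
      by (intro exI[of _ 0] exI[of _ tp] exI[of _ W]) (auto simp: start_def)
  next
    case False
    obtain K' \<sigma>' where ks: "kstep (K, \<sigma>) = (K', \<sigma>')" by force
    obtain tp1 where s1: "(astep ^^ (2 * (W + E) + 2)) (start K, tp, 0) = (start K', tp1, 0)"
      and r1: "rep \<sigma>' (W + E + 1) tp1"
      using sweep[OF Suc.prems(3) False Suc.prems(2) ks] by blast
    have K': "K' \<in> conts0" using ks conts0_next[OF Suc.prems(2)] by (auto simp: Let_def)
    have "(kstep ^^ n) (K', \<sigma>') = ([], \<tau>)"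
      using Suc.prems(1) ks by (simp add: funpow_Suc_right del: funpow.simps kstep.simps)
    from Suc.IH[OF this K' r1] obtain t tp' W' where
      s2: "(astep ^^ t) (start K', tp1, 0) = (Fin, tp', 0)" and r2: "rep \<tau> W' tp'"
      and t: "t \<le> n * (2 * (W + E + 1 + n * (E + 1) + E) + 2)" and W': "W' \<le> W + E + 1 + n * (E + 1)"
      by blast
    have "(astep ^^ (t + (2 * (W + E) + 2))) (start K, tp, 0) = (Fin, tp', 0)"
      by (simp only: funpow_add[of t] o_apply s1 s2)
    moreover have "t + (2 * (W + E) + 2) \<le> Suc n * (2 * (W + Suc n * (E + 1) + E) + 2)"
    proof -
      have "W + E + 1 + n * (E + 1) + E = W + Suc n * (E + 1) + E" by simp
      then have "t \<le> n * (2 * (W + Suc n * (E + 1) + E) + 2)" using t by metis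
      moreover have "2 * (W + E) + 2 \<le> 2 * (W + Suc n * (E + 1) + E) + 2" by simp
      ultimately show ?thesis by (simp only: mult_Suc)
    qed
    moreover have "W' \<le> W + Suc n * (E + 1)" using W' by simp
    ultimately show ?thesis using r2 by blast
  qed
qed

section \<open>Entering the input and leaving the output\<close>

lemma fin_run:
  assumes "rep \<tau> W tp" "n \<le> W"
  shows "(astep ^^ n) (Fin, tp, 0) = (Fin, (\<lambda>x. if x < int n then take_bit 3 (tp x) else tp x), int n)"
  using assms(2)
proof (induction n)
  case 0
  have "tp x = 0" if "x < 0" for x using assms(1) that by (auto simp: rep_def)
  then show ?case by auto
next
  case (Suc n)
  have b: "bit (tp (int n)) 3" using assms(1) Suc.prems by (auto simp: rep_def)
  have "astep (Fin, (\<lambda>x. if x < int n then take_bit 3 (tp x) else tp x), int n) =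
    (Fin, (\<lambda>x. if x < int (Suc n) then take_bit 3 (tp x) else tp x), int (Suc n))"
    using b by (auto simp: add.commute)
  then show ?case using Suc by (simp del: astep.simps)
qed

lemma halt_run:
  assumes "rep \<tau> W tp"
  shows "(astep ^^ Suc W) (Fin, tp, 0) = (Halt, (\<lambda>x. take_bit 3 (tp x)), int W)"
proof -
  have z: "tp x = 0" if "int W \<le> x" for x using assms that by (auto simp: rep_def)
  have "(\<lambda>x. if x < int W then take_bit 3 (tp x) else tp x) = (\<lambda>x. take_bit 3 (tp x))"
    using z by fastforce
  then have "(astep ^^ W) (Fin, tp, 0) = (Fin, (\<lambda>x. take_bit 3 (tp x)), int W)"
    using fin_run[OF assms order_refl] by simp
  moreover have "astep (Fin, (\<lambda>x. take_bit 3 (tp x)), int W) = (Halt, (\<lambda>x. take_bit 3 (tp x)), int W)"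
    using z by (auto simp: fun_upd_idem)
  ultimately show ?thesis by (simp del: astep.simps)
qed

lemma init_run:
  assumes w: "\<forall>a\<in>set w. 0 < a \<and> a < 8"
  shows "\<exists>tp. (astep ^^ (2 * length w + 2)) (Init, input_tape w, 0) = (start [P], tp, 0)
    \<and> rep (planes w) (Suc (length w)) tp"
proof -
  let ?n = "length w"
  define tq where "tq q x = (if 0 \<le> x \<and> x < int q then set_bit 3 (input_tape w x) else input_tape w x)" for q x
  have 1: "(astep ^^ q) (Init, input_tape w, 0) = (Init, tq q, int q)" if "q \<le> ?n" for q
    using that
  proof (induction q)
    case 0
    then show ?case by (auto simp: tq_def)
  next
    case (Suc q)
    have "tq q (int q) = w ! q" "w ! q \<noteq> 0"
      using Suc.prems w nth_mem[of q w] by (auto simp: tq_def input_tape_def)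
    moreover have "(tq q)(int q := set_bit 3 (w ! q)) = tq (Suc q)"
      using Suc.prems by (intro ext) (auto simp: tq_def input_tape_def)
    ultimately have "astep (Init, tq q, int q) = (Init, tq (Suc q), int (Suc q))" by (simp add: add.commute)
    then show ?case using Suc by (simp del: astep.simps)
  qed
  have z: "set_bit 3 0 = (8::nat)" by (simp add: set_bit_eq_or)
  have "(tq ?n)(int ?n := 8) = tq (Suc ?n)"
    using z by (intro ext) (auto simp: tq_def input_tape_def)
  moreover have "tq ?n (int ?n) = 0" by (simp add: tq_def input_tape_def)
  ultimately have 2: "astep (Init, tq ?n, int ?n) = (Back [P], tq (Suc ?n), int ?n - 1)" by simp
  define t where "t = tq (Suc ?n)"
  have t3: "bit (t x) 3" if "0 \<le> x" "x < int (Suc ?n)" for x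
    using that by (simp add: t_def tq_def bit_simps)
  have 3: "(astep ^^ Suc ?n) (Back [P], t, int ?n - 1) = (start [P], t, 0)"
    using t3 by (intro back_home) (auto simp: t_def tq_def input_tape_def bit_simps)
  have "(astep ^^ Suc ?n) (Init, input_tape w, 0) = (Back [P], t, int ?n - 1)"
    using 1[of ?n] 2 by (simp add: t_def del: astep.simps)
  with 3 have "(astep ^^ (Suc ?n + Suc ?n)) (Init, input_tape w, 0) = (start [P], t, 0)"
    by (simp only: funpow_add o_apply)
  moreover have "rep (planes w) (Suc ?n) t"
    unfolding rep_def
  proof (intro conjI allI impI ballI)
    fix x assume "x < 0 \<or> int (Suc ?n) \<le> x"
    then show "t x = 0" by (auto simp: t_def tq_def input_tape_def)
  next
    fix p assume p: "p < Suc ?n"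
    then show "bit (t (int p)) 3" using t3 by auto
    fix r assume r: "r \<in> R"
    then have "r \<noteq> 3" using three by auto
    then have tb: "bit (t (int p)) r = (p < ?n \<and> bit (w ! p) r)"
      using p by (auto simp: t_def tq_def input_tape_def bit_simps)
    have "\<not> bit (w ! p) r" if "p < ?n" "3 < r"
    proof -
      have "w ! p < 2 ^ 3" using w nth_mem[OF that(1)] by auto
      then have "take_bit 3 (w ! p) = w ! p" by (simp add: take_bit_nat_eq_self_iff)
      then have "bit (w ! p) r = bit (take_bit 3 (w ! p)) r" by simp
      then show ?thesis using that(2) by (simp add: bit_take_bit_iff)
    qed
    then show "bit (t (int p)) r = bit (planes w r) p"
      using tb \<open>r \<noteq> 3\<close> by (auto simp: planes_def bit_plane)
  next
    fix r assume r: "r \<in> R"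
    have "- (2 ^ (Suc ?n - 1)) \<le> (0::int)" by simp
    moreover have "0 \<le> planes w r" using plane_bounds(1)[of r w] by (simp add: planes_def)
    ultimately show "- (2 ^ (Suc ?n - 1)) \<le> planes w r" by linarith
    show "planes w r < 2 ^ (Suc ?n - 1)"
      using plane_bounds(2)[of r w] by (simp add: planes_def)
  qed auto
  moreover have "2 * ?n + 2 = Suc ?n + Suc ?n" by simp
  ultimately show ?thesis by metis
qed

text \<open>Only the first three planes of the final tape matter, since \<open>Fin\<close> erases
  all other bits of every symbol. The time bound adds up the marking pass, the sweeps and the
  erasing pass.\<close>

lemma machine_run:
  assumes w: "\<forall>a\<in>set w. 0 < a \<and> a < 8" and u: "\<forall>a\<in>set u. a < 8"
    and ex: "lexec P (planes w) n \<tau>" and \<tau>: "\<forall>k<3. \<tau> k = plane k u"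
  shows "\<exists>t tp h. (astep ^^ t) (Init, input_tape w, 0) = (Halt, tp, h) \<and> tape_holds tp u \<and>
     t \<le> (n + 2) * (2 * (length w + (n + 2) * (E + 1)) + 2)"
proof -
  let ?n = "length w"
  obtain tp0 where r0: "(astep ^^ (2 * ?n + 2)) (Init, input_tape w, 0) = (start [P], tp0, 0)"
    and rep0: "rep (planes w) (Suc ?n) tp0"
    using init_run[OF w] by blast
  have "[P] \<in> conts0" by (simp add: conts0_def self_conts)
  from kstep_run[OF lexec_kstep[OF ex] this rep0] obtain t1 tp1 W where
    r1: "(astep ^^ t1) (start [P], tp0, 0) = (Fin, tp1, 0)" and rep1: "rep \<tau> W tp1"
    and t1: "t1 \<le> n * (2 * (Suc ?n + n * (E + 1) + E) + 2)" and W: "W \<le> Suc ?n + n * (E + 1)"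
    by blast
  have "(astep ^^ (Suc W + (t1 + (2 * ?n + 2)))) (Init, input_tape w, 0) =
     (Halt, (\<lambda>x. take_bit 3 (tp1 x)), int W)"
    by (simp only: funpow_add[of "Suc W"] funpow_add[of t1] o_apply r0 r1 halt_run[OF rep1])
  moreover have "tape_holds (\<lambda>x. take_bit 3 (tp1 x)) u"
  proof -
    have key: "bit (tp1 (int p)) k = (p < length u \<and> bit (u ! p) k)" if "k < 3" for p k
    proof -
      have kR: "k \<in> R" using io that by (auto simp: less_Suc_eq numeral_3_eq_3 numeral_2_eq_2)
      have \<tau>k: "\<tau> k = plane k u" using \<tau> that by auto
      show ?thesis
      proof (cases "p < W")
        case True
        then have "bit (tp1 (int p)) k = bit (\<tau> k) p" using rep1 kR by (auto simp: rep_def)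
        then show ?thesis by (simp add: \<tau>k bit_plane)
      next
        case False
        then have "tp1 (int p) = 0" using rep1 by (auto simp: rep_def)
        \<comment> \<open>To the right of the used cells the tape is blank, and so is the plane: it
          fits into the width and is nonnegative, hence its sign bits are 0.\<close>
        moreover have "bit (\<tau> k) p = (\<tau> k < 0)"
          using rep1 kR False by (intro bit_sign[where k = "W - 1"]) (auto simp: rep_def)
        ultimately show ?thesis using plane_bounds(1)[of k u] by (simp add: \<tau>k bit_plane)
      qed
    qed
    have "take_bit 3 (tp1 (int p)) = (if p < length u then u ! p else 0)" for p
    proof (rule bit_eqI)
      fix k
      show "bit (take_bit 3 (tp1 (int p))) k = bit (if p < length u then u ! p else 0) k"
      proof (cases "k < 3")
        case True
        then show ?thesis using key[OF True, of p] by (auto simp: bit_take_bit_iff)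
      next
        case False
        have "\<not> bit (u ! p) k" if "p < length u"
        proof -
          have "u ! p < 2 ^ 3" using u nth_mem[OF that] by auto
          then have "take_bit 3 (u ! p) = u ! p" by (simp add: take_bit_nat_eq_self_iff)
          then have "bit (u ! p) k = bit (take_bit 3 (u ! p)) k" by simp
          then show ?thesis using False by (simp add: bit_take_bit_iff)
        qed
        then show ?thesis using False by (auto simp: bit_take_bit_iff)
      qed
    qed
    then show ?thesis by (simp add: tape_holds_def)
  qed
  moreover have "Suc W + (t1 + (2 * ?n + 2)) \<le> (n + 2) * (2 * (?n + (n + 2) * (E + 1)) + 2)"
  proof -
    let ?X = "2 * (?n + (n + 2) * (E + 1)) + 2"
    have "2 * (Suc ?n + n * (E + 1) + E) + 2 \<le> ?X" by simp
    then have "t1 \<le> n * ?X" using t1 by (meson mult_le_mono2 order_trans)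
    moreover have "Suc W \<le> ?X" using W by simp
    moreover have "2 * ?n + 2 \<le> ?X" by simp
    ultimately show ?thesis by (simp only: distrib_right) simp
  qed
  ultimately show ?thesis by blast
qed

text \<open>A \<open>tm\<close> wants numbers as states, so the finitely many structured states are
  numbered by a bijection. Both machines run in lockstep on tapes with symbols below
  \<open>2 ^ Kb\<close>, and only \<open>Halt\<close> receives the halting number.\<close>

lemma ex_tm:
  "\<exists>M f. wf_tm M \<and> f Init = tm_start M \<and> (\<forall>q\<in>states. f q = tm_halt M \<longleftrightarrow> q = Halt) \<and>
    (\<forall>tp. (\<forall>x. tp x < 2 ^ Kb) \<longrightarrow> (\<forall>n. \<exists>q tp' h. q \<in> states \<and> (astep ^^ n) (Init, tp, 0) = (q, tp', h) \<and>
      (tm_step M ^^ n) (tm_start M, tp, 0) = (f q, tp', h)))"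
proof -
  obtain f where f: "bij_betw f states {0..<card states}"
    using ex_bij_betw_finite_nat[OF finite_states] by blast
  define g where "g = the_inv_into states f"
  have gf: "g (f q) = q" if "q \<in> states" for q
    using f that by (auto simp: g_def bij_betw_def the_inv_into_f_f)
  have fl: "f q < card states" if "q \<in> states" for q
    using f that by (auto simp: bij_betw_def)
  have gs: "g i \<in> states" if "i < card states" for i
    using f that unfolding g_def bij_betw_def by (metis atLeastLessThan_iff le0 subset_refl the_inv_into_into)
  define M where "M = \<lparr>tm_states = card states, tm_syms = 2 ^ Kb,
    tm_delta = (\<lambda>q a. case delta (g q) a of (q', b, d) \<Rightarrow> (f q', b, d)), tm_start = f Init, tm_halt = f Halt\<rparr>"
  have IH: "Init \<in> states" "Halt \<in> states" by (simp_all add: states_def)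
  have "(6::nat) \<le> 2 ^ Kb" using power_increasing[OF Kb, of "2::nat"] by simp
  moreover have "case tm_delta M q a of (q', b, d) \<Rightarrow> q' < tm_states M \<and> b < tm_syms M \<and> d \<in> {-1, 0, 1}"
    if "q < tm_states M" "a < tm_syms M" for q a
  proof -
    obtain q' b d where d: "delta (g q) a = (q', b, d)" by (metis prod_cases3)
    show ?thesis using delta_states[OF gs _ d] that fl d by (simp add: M_def)
  qed
  ultimately have "wf_tm M"
    using fl IH by (simp add: wf_tm_def M_def)
  moreover have inj: "f q = f Halt \<longleftrightarrow> q = Halt" if "q \<in> states" for q
    using gf[OF that] gf[OF IH(2)] by metis
  moreover have "\<exists>q tp' h. q \<in> states \<and> (\<forall>x. tp' x < 2 ^ Kb) \<and> (astep ^^ n) (Init, tp, 0) = (q, tp', h) \<and>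
      (tm_step M ^^ n) (tm_start M, tp, 0) = (f q, tp', h)"
    if "\<forall>x. tp x < 2 ^ Kb" for tp n
  proof (induction n)
    case 0
    then show ?case using that IH by (simp add: M_def)
  next
    case (Suc n)
    then obtain q tp' h where q: "q \<in> states" and tp': "\<forall>x. tp' x < 2 ^ Kb"
      and a: "(astep ^^ n) (Init, tp, 0) = (q, tp', h)"
      and m: "(tm_step M ^^ n) (tm_start M, tp, 0) = (f q, tp', h)" by blast
    obtain q' b d where d: "delta q (tp' h) = (q', b, d)" by (metis prod_cases3)
    have "q' \<in> states \<and> b < 2 ^ Kb" using delta_states[OF q _ d] tp' by blast
    moreover have "tm_step M (f q, tp', h) = (if q = Halt then (f q, tp', h) else (f q', tp'(h := b), h + d))"
      using inj[OF q] gf[OF q] d by (simp add: tm_step_def M_def)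
    ultimately show ?case using a m q tp' d by (cases "q = Halt") auto
  qed
  ultimately show ?thesis
    by (intro exI[of _ M] exI[of _ f] conjI) (simp add: M_def, simp add: M_def, simp add: M_def, metis)
qed

end

subsection \<open>Polynomial bounds\<close>

definition poly_bd :: "(nat \<Rightarrow> nat) \<Rightarrow> bool" where
  "poly_bd f \<longleftrightarrow> (\<exists>c k. \<forall>n. f n \<le> c * (n + 1) ^ k)"

lemma poly_bd_const: "poly_bd (\<lambda>n. a)"
  unfolding poly_bd_def by (rule exI[of _ a], rule exI[of _ 0]) simp

lemma poly_bd_id: "poly_bd (\<lambda>n. n)"
  unfolding poly_bd_def by (rule exI[of _ 1], rule exI[of _ 1]) simp

lemma poly_bd_mult: "poly_bd f \<Longrightarrow> poly_bd g \<Longrightarrow> poly_bd (\<lambda>n. f n * g n)"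
proof -
  assume "poly_bd f" "poly_bd g"
  then obtain c k c' k' where "\<And>n. f n \<le> c * (n + 1) ^ k" "\<And>n. g n \<le> c' * (n + 1) ^ k'"
    unfolding poly_bd_def by blast
  then have "f n * g n \<le> (c * c') * (n + 1) ^ (k + k')" for n
    using mult_le_mono[of "f n" "c * (n + 1) ^ k" "g n" "c' * (n + 1) ^ k'"]
    by (simp add: power_add algebra_simps)
  then show ?thesis unfolding poly_bd_def by blast
qed

lemma poly_bd_add: "poly_bd f \<Longrightarrow> poly_bd g \<Longrightarrow> poly_bd (\<lambda>n. f n + g n)"
proof -
  assume "poly_bd f" "poly_bd g"
  then obtain c k c' k' where f: "\<And>n. f n \<le> c * (n + 1) ^ k" and g: "\<And>n. g n \<le> c' * (n + 1) ^ k'"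
    unfolding poly_bd_def by blast
  have "f n + g n \<le> (c + c') * (n + 1) ^ (k + k')" for n
  proof -
    have "f n \<le> c * (n + 1) ^ (k + k')"
      by (rule order_trans[OF f]) (simp add: power_increasing del: power_Suc)
    moreover have "g n \<le> c' * (n + 1) ^ (k + k')"
      by (rule order_trans[OF g]) (simp add: power_increasing del: power_Suc)
    ultimately show ?thesis by (simp add: distrib_right)
  qed
  then show ?thesis unfolding poly_bd_def by blast
qed

lemma poly_bd_le: "poly_bd g \<Longrightarrow> (\<And>n. f n \<le> g n) \<Longrightarrow> poly_bd f"
  unfolding poly_bd_def by (meson order_trans)

lemma poly_bd_power: "poly_bd f \<Longrightarrow> poly_bd (\<lambda>n. f n ^ k)"
  by (induction k) (simp_all add: poly_bd_const poly_bd_mult)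

lemma poly_bd_comp: "poly_bd f \<Longrightarrow> poly_bd g \<Longrightarrow> poly_bd (\<lambda>n. f (g n))"
proof -
  assume f: "poly_bd f" and g: "poly_bd g"
  then obtain c k where "\<And>n. f n \<le> c * (n + 1) ^ k"
    unfolding poly_bd_def by blast
  then have "f (g n) \<le> c * (g n + 1) ^ k" for n by blast
  moreover have "poly_bd (\<lambda>n. c * (g n + 1) ^ k)"
    by (intro poly_bd_mult poly_bd_power poly_bd_add poly_bd_const g)
  ultimately show ?thesis using poly_bd_le[of "\<lambda>n. c * (g n + 1) ^ k" "\<lambda>n. f (g n)"] by blast
qed

lemmas poly_bd_intros = poly_bd_add poly_bd_mult poly_bd_power poly_bd_const poly_bd_id

subsection \<open>From the register language to polynomial time\<close>

declare bin.simps [simp del]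

lemma set_bin: "set (bin n) \<subseteq> {1, 2}"
proof (induction n rule: bin.induct)
  case (1 n)
  then show ?case
    by (subst bin.simps) (auto simp: mod2_eq_if)
qed

lemma set_enc_int: "set (enc_int v) \<subseteq> {1..4}"
  using set_bin[of "nat \<bar>v\<bar>"] by (force simp: enc_int_def)

lemma set_enc_input: "set (enc_input vs) \<subseteq> {1..5}"
proof
  fix a assume "a \<in> set (enc_input vs)"
  then obtain v where "a \<in> set (enc_int v) \<or> a = 5"
    by (auto simp: enc_input_def split: if_splits)
  then show "a \<in> {1..5}" using set_enc_int[of v] by auto
qed

lemma length_enc_input: "length (enc_input vs) = input_size vs + 2 * length vs"
  by (induction vs) (simp_all add: enc_input_def enc_int_def input_size_def bit_length_def)

text \<open>The interface between the two models: machine time is a polynomial in the number of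
  register steps and the word length. The word is longer than \<open>input_size\<close> by
  \<open>2 * m\<close>, for the sign and separator of each input.\<close>

lemma in_FP_if_lexec:
  assumes "3 \<notin> com_regs P" and q: "poly_bd q"
    and ex: "\<And>vs. length vs = m \<Longrightarrow> \<exists>n \<tau>. lexec P (planes (enc_input vs)) n \<tau> \<and> n \<le> q (input_size vs)
      \<and> (\<forall>k<3. \<tau> k = plane k (enc_int (f vs)))"
  shows "in_FP m f"
proof -
  define R where "R = com_regs P \<union> {0, 1, 2}"
  obtain E where E: "com_ok R E P" using ex_com_ok[of P R] by (auto simp: R_def)
  define Kb where "Kb = Suc (Max R) + 4"
  have "finite R" by (simp add: R_def finite_com_regs)
  have "R \<subseteq> {..<Kb}"
  proof
    fix x assume "x \<in> R"
    then have "x \<le> Max R" using \<open>finite R\<close> by simp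
    then show "x \<in> {..<Kb}" by (simp add: Kb_def)
  qed
  then interpret machine P R E Kb
    using E assms(1) by unfold_locales (auto simp: R_def Kb_def)
  obtain M g where wf: "wf_tm M" and g0: "g Init = tm_start M"
    and gh: "\<And>q. q \<in> states \<Longrightarrow> g q = tm_halt M \<longleftrightarrow> q = Halt"
    and run: "\<And>tp n. (\<forall>x. tp x < 2 ^ Kb) \<Longrightarrow> \<exists>q tp' h. q \<in> states \<and>
       (astep ^^ n) (Init, tp, 0) = (q, tp', h) \<and> (tm_step M ^^ n) (tm_start M, tp, 0) = (g q, tp', h)"
    using ex_tm by blast
  define T where "T x = (q x + 2) * (2 * ((x + 2 * m) + (q x + 2) * (E + 1)) + 2)" for x
  have "poly_bd T" unfolding T_def by (intro poly_bd_intros q)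
  then obtain c k where T: "\<And>x. T x \<le> c * (x + 1) ^ k" unfolding poly_bd_def by blast
  have "\<exists>t \<le> c * (input_size vs + 1) ^ k.
      (case (tm_step M ^^ t) (init_config M (enc_input vs)) of (q, tp, h) \<Rightarrow>
              q = tm_halt M \<and> tape_holds tp (enc_int (f vs)))" if len: "length vs = m" for vs
  proof -
    from ex[OF len] obtain n \<tau> where lex: "lexec P (planes (enc_input vs)) n \<tau>"
      and n: "n \<le> q (input_size vs)" and \<tau>: "\<forall>k<3. \<tau> k = plane k (enc_int (f vs))" by blast
    have w: "\<forall>a\<in>set (enc_input vs). 0 < a \<and> a < 8" using set_enc_input by fastforce
    have u: "\<forall>a\<in>set (enc_int (f vs)). a < 8" using set_enc_int by fastforce
    obtain t tp h where t: "(astep ^^ t) (Init, input_tape (enc_input vs), 0) = (Halt, tp, h)"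
      and th: "tape_holds tp (enc_int (f vs))"
      and tb: "t \<le> (n + 2) * (2 * (length (enc_input vs) + (n + 2) * (E + 1)) + 2)"
      using machine_run[OF w u lex \<tau>] by blast
    have "t \<le> T (input_size vs)"
      unfolding T_def using n len
      by (intro order_trans[OF tb] mult_le_mono add_mono le_refl) (auto simp: length_enc_input)
    then have tb': "t \<le> c * (input_size vs + 1) ^ k" using T order_trans by blast
    have "(8::nat) \<le> 2 ^ Kb" using power_increasing[of 3 Kb "2::nat"] by (simp add: Kb_def)
    moreover have "input_tape (enc_input vs) x < 8" for x
      using w nth_mem[of "nat x" "enc_input vs"] by (auto simp: input_tape_def)
    ultimately have "\<forall>x. input_tape (enc_input vs) x < 2 ^ Kb"
      by (meson less_le_trans)
    from run[OF this, of t] t have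
      "(tm_step M ^^ t) (tm_start M, input_tape (enc_input vs), 0) = (g Halt, tp, h)" by auto
    moreover have "init_config M (enc_input vs) = (tm_start M, input_tape (enc_input vs), 0)"
      by (simp add: init_config_def input_tape_def fun_eq_iff)
    moreover have "g Halt = tm_halt M" using gh[of Halt] by (simp add: states_def)
    ultimately show ?thesis using tb' th by auto
  qed
  then show ?thesis unfolding in_FP_def using wf by blast
qed

subsection \<open>Cost-bounded runs\<close>

text \<open>Total correctness with a cost bound. The postcondition may itself be a
  \<open>runs\<close> statement, which is how sequences and loops are chained without naming
  intermediate states.\<close>

definition runs :: "com \<Rightarrow> regs \<Rightarrow> nat \<Rightarrow> (regs \<Rightarrow> bool) \<Rightarrow> bool" where
  "runs c \<sigma> N Q \<longleftrightarrow> (\<exists>n \<tau>. lexec c \<sigma> n \<tau> \<and> n \<le> N \<and> Q \<tau>)"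

lemma runs_mono: "runs c \<sigma> N Q \<Longrightarrow> N \<le> N' \<Longrightarrow> (\<And>\<tau>. Q \<tau> \<Longrightarrow> Q' \<tau>) \<Longrightarrow> runs c \<sigma> N' Q'"
  unfolding runs_def by (meson order_trans)

lemma runs_Asn: "Q (\<sigma>(d := lval l \<sigma>)) \<Longrightarrow> 1 \<le> N \<Longrightarrow> runs (Asn d l) \<sigma> N Q"
  unfolding runs_def using LAsn by blast

lemma runs_Seq:
  assumes "runs c1 \<sigma> N1 (\<lambda>\<tau>. runs c2 \<tau> N2 Q)"
  shows "runs (Seq c1 c2) \<sigma> (Suc (N1 + N2)) Q"
proof -
  obtain n1 \<tau> n2 \<tau>2 where "lexec c1 \<sigma> n1 \<tau>" "n1 \<le> N1" "lexec c2 \<tau> n2 \<tau>2" "n2 \<le> N2" "Q \<tau>2"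
    using assms unfolding runs_def by blast
  then show ?thesis unfolding runs_def using LSeq[of c1 \<sigma> n1 \<tau> c2 n2 \<tau>2]
    by (intro exI[of _ "Suc (n1 + n2)"] exI[of _ \<tau>2]) auto
qed

lemma runs_Cond:
  assumes "lval l \<sigma> < 0 \<Longrightarrow> runs c1 \<sigma> N1 Q" "\<not> lval l \<sigma> < 0 \<Longrightarrow> runs c2 \<sigma> N2 Q"
  shows "runs (Cond l c1 c2) \<sigma> (Suc (max N1 N2)) Q"
proof (cases "lval l \<sigma> < 0")
  case True
  then obtain n \<tau> where "lexec c1 \<sigma> n \<tau>" "n \<le> N1" "Q \<tau>" using assms(1) unfolding runs_def by blast
  then show ?thesis unfolding runs_def using LCondT[OF True, of c1 n \<tau> c2]
    by (intro exI[of _ "Suc n"] exI[of _ \<tau>]) auto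
next
  case False
  then obtain n \<tau> where "lexec c2 \<sigma> n \<tau>" "n \<le> N2" "Q \<tau>" using assms(2) unfolding runs_def by blast
  then show ?thesis unfolding runs_def using LCondF[OF False, of c2 n \<tau> c1]
    by (intro exI[of _ "Suc n"] exI[of _ \<tau>]) auto
qed

lemma runs_WhileF: "\<not> lval l \<sigma> < 0 \<Longrightarrow> Q \<sigma> \<Longrightarrow> runs (While l c) \<sigma> 1 Q"
  unfolding runs_def using LWhileF by blast

lemma runs_WhileT:
  assumes "lval l \<sigma> < 0" "runs c \<sigma> N1 (\<lambda>\<tau>. runs (While l c) \<tau> N2 Q)"
  shows "runs (While l c) \<sigma> (Suc (N1 + N2)) Q"
proof -
  obtain n1 \<tau> n2 \<tau>2 where "lexec c \<sigma> n1 \<tau>" "n1 \<le> N1" "lexec (While l c) \<tau> n2 \<tau>2" "n2 \<le> N2" "Q \<tau>2"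
    using assms(2) unfolding runs_def by blast
  then show ?thesis unfolding runs_def using LWhileT[OF assms(1), of c n1 \<tau> n2 \<tau>2]
    by (intro exI[of _ "Suc (n1 + n2)"] exI[of _ \<tau>2]) auto
qed

text \<open>The index of \<open>I\<close> is a variant: a successful test must find a successor and
  the body must lower it, so at most \<open>k\<close> iterations of cost \<open>N + 1\<close> and
  one failing test occur.\<close>

lemma runs_While:
  assumes "\<And>k \<tau>. I k \<tau> \<Longrightarrow> lval l \<tau> < 0 \<Longrightarrow> \<exists>k'. k = Suc k' \<and> runs c \<tau> N (I k')"
    and "\<And>k \<tau>. I k \<tau> \<Longrightarrow> \<not> lval l \<tau> < 0 \<Longrightarrow> Q \<tau>"
    and "I k \<sigma>"
  shows "runs (While l c) \<sigma> (Suc (k * Suc N)) Q"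
  using assms(3)
proof (induction k arbitrary: \<sigma>)
  case 0
  then have F: "\<not> lval l \<sigma> < 0" using assms(1) by blast
  then show ?case using runs_WhileF[of l \<sigma> Q c] assms(2)[OF 0] by simp
next
  case (Suc k)
  show ?case
  proof (cases "lval l \<sigma> < 0")
    case True
    then have "runs c \<sigma> N (I k)" using assms(1)[OF Suc.prems True] by simp
    then have "runs c \<sigma> N (\<lambda>\<tau>. runs (While l c) \<tau> (Suc (k * Suc N)) Q)"
      by (rule runs_mono) (simp, rule Suc.IH)
    from runs_WhileT[OF True this] show ?thesis by (rule runs_mono) auto
  next
    case False
    then have "runs (While l c) \<sigma> 1 Q"
      using assms(2)[OF Suc.prems False] by (rule runs_WhileF)
    then show ?thesis by (rule runs_mono) auto
  qed
qed

text \<open>Even registers are temporaries, odd ones program variables; 0, 1 and 2 hold the input and output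
  word and 3 is the marker bit of the machine.\<close>

definition tmp :: "nat \<Rightarrow> nat" where "tmp n = 2 * n + 4"

definition vreg :: "vname \<Rightarrow> nat" where "vreg x = 2 * to_nat x + 5"

lemma tmp_eq [simp]: "tmp i = tmp j \<longleftrightarrow> i = j" by (simp add: tmp_def)
lemma vreg_eq [simp]: "vreg x = vreg y \<longleftrightarrow> x = y" by (simp add: vreg_def)
lemma tmp_vreg [simp]: "tmp i \<noteq> vreg x" "vreg x \<noteq> tmp i"
  by (simp_all add: tmp_def vreg_def, presburger+)
lemma tmp_ge [simp]: "k < 3 \<Longrightarrow> tmp i \<noteq> k" "k < 3 \<Longrightarrow> k \<noteq> tmp i" by (auto simp: tmp_def)
lemma vreg_ge [simp]: "k < 3 \<Longrightarrow> vreg x \<noteq> k" "k < 3 \<Longrightarrow> k \<noteq> vreg x" by (auto simp: vreg_def)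
lemma tmp_3 [simp]: "3 \<noteq> tmp i" "tmp i \<noteq> 3" by (auto simp: tmp_def)
lemma vreg_3 [simp]: "3 \<noteq> vreg i" "vreg i \<noteq> 3" by (auto simp: vreg_def)

text \<open>Temporaries form an evaluation stack: code at height \<open>n\<close> may overwrite only
  those from \<open>n\<close> on, so earlier operands survive, as do program variables and the word
  registers.\<close>

definition same :: "nat \<Rightarrow> regs \<Rightarrow> regs \<Rightarrow> bool" where
  "same n \<sigma> \<tau> \<longleftrightarrow> (\<forall>r. (\<forall>i\<ge>n. r \<noteq> tmp i) \<longrightarrow> \<tau> r = \<sigma> r)"

lemma same_refl [simp]: "same n \<sigma> \<sigma>" by (simp add: same_def)
lemma same_trans: "same n \<sigma> \<tau> \<Longrightarrow> same n \<tau> \<rho> \<Longrightarrow> same n \<sigma> \<rho>" by (simp add: same_def)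
lemma same_upd: "same n \<sigma> \<tau> \<Longrightarrow> n \<le> i \<Longrightarrow> same n \<sigma> (\<tau>(tmp i := v))" by (auto simp: same_def)
lemma same_le: "same m \<sigma> \<tau> \<Longrightarrow> n \<le> m \<Longrightarrow> same n \<sigma> \<tau>" by (auto simp: same_def)
lemma same_tmp: "same n \<sigma> \<tau> \<Longrightarrow> i < n \<Longrightarrow> \<tau> (tmp i) = \<sigma> (tmp i)" by (auto simp: same_def)
lemma same_vreg: "same n \<sigma> \<tau> \<Longrightarrow> \<tau> (vreg x) = \<sigma> (vreg x)" by (auto simp: same_def)
lemma same_io: "same n \<sigma> \<tau> \<Longrightarrow> k < 3 \<Longrightarrow> \<tau> k = \<sigma> k" by (auto simp: same_def)

subsection \<open>Arithmetic macros\<close>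

definition blen :: "int \<Rightarrow> nat" where "blen v = nat (size_int v)"

text \<open>Removes the real logarithm: an integer is below the ceiling iff it is below the
  logarithm, and over the integers \<open>2 ^ j < |v| + 1\<close> means
  \<open>2 ^ j \<le> |v|\<close>. The right-hand side is also the loop test of the compiled
  code.\<close>

lemma less_size_iff: "int j < size_int v \<longleftrightarrow> 2 ^ j \<le> \<bar>v\<bar>"
proof -
  have "int j < size_int v \<longleftrightarrow> real j < log 2 (real_of_int (\<bar>v\<bar> + 1))"
    by (simp add: size_int_def less_ceiling_iff)
  also have "\<dots> \<longleftrightarrow> 2 powr real j < real_of_int (\<bar>v\<bar> + 1)"
    by (subst less_log_iff) auto
  also have "\<dots> \<longleftrightarrow> real_of_int (2 ^ j) < real_of_int (\<bar>v\<bar> + 1)"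
    by (simp add: powr_realpow)
  also have "\<dots> \<longleftrightarrow> 2 ^ j \<le> \<bar>v\<bar>" by (simp only: of_int_less_iff) linarith
  finally show ?thesis .
qed

lemma size_int_nonneg: "0 \<le> size_int v"
proof -
  have "(0::real) \<le> log 2 (real_of_int (\<bar>v\<bar> + 1))" by simp
  then show ?thesis unfolding size_int_def by (simp add: ceiling_mono[of 0, simplified])
qed

lemma size_int_blen: "size_int v = int (blen v)"
  using size_int_nonneg by (simp add: blen_def)

lemma less_blen_iff: "j < blen v \<longleftrightarrow> 2 ^ j \<le> \<bar>v\<bar>"
  using less_size_iff[of j v] by (simp add: size_int_blen)

lemma blen_le: "\<bar>v\<bar> < 2 ^ B \<Longrightarrow> blen v \<le> B"
  using less_blen_iff[of B v] by auto

definition skip :: com where "skip = Asn (tmp 0) (0, [(tmp 0, 1)])"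

lemma runs_skip: "Q \<sigma> \<Longrightarrow> 1 \<le> N \<Longrightarrow> runs skip \<sigma> N Q"
  unfolding skip_def by (rule runs_Asn) (simp_all add: lval_def)

definition abs_code :: "nat \<Rightarrow> com" where
  "abs_code r = Cond (0, [(r, 1)]) (Asn r (0, [(r, -1)])) skip"

lemma runs_abs: "Q (\<sigma>(r := \<bar>\<sigma> r\<bar>)) \<Longrightarrow> 2 \<le> N \<Longrightarrow> runs (abs_code r) \<sigma> N Q"
  unfolding abs_code_def
  by (rule runs_mono[OF runs_Cond[of _ _ _ 1 _ _ 1]])
    (auto intro!: runs_Asn runs_skip simp: lval_def abs_if fun_upd_idem)

definition size_code :: "nat \<Rightarrow> com" where
  "size_code n = Seq (abs_code (tmp n)) (Seq (Asn (tmp (n+1)) (1, [])) (Seq (Asn (tmp (n+2)) (0, []))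
     (Seq (While (-1, [(tmp (n+1), 1), (tmp n, -1)])
        (Seq (Asn (tmp (n+1)) (0, [(tmp (n+1), 2)])) (Asn (tmp (n+2)) (1, [(tmp (n+2), 1)]))))
      (Asn (tmp n) (0, [(tmp (n+2), 1)])))))"

lemma runs_size:
  assumes "\<bar>\<sigma> (tmp n)\<bar> < 2 ^ B" "\<And>\<tau>. same n \<sigma> \<tau> \<Longrightarrow> \<tau> (tmp n) = size_int (\<sigma> (tmp n)) \<Longrightarrow> Q \<tau>"
  shows "runs (size_code n) \<sigma> (4 * B + 20) Q"
proof -
  define v where "v = \<sigma> (tmp n)"
  \<comment> \<open>\<open>k\<close> counts the doublings still missing to reach the bit
    length.\<close>
  define I where "I k \<tau> \<longleftrightarrow> (\<exists>j. \<tau> (tmp (n+1)) = 2 ^ j \<and> \<tau> (tmp (n+2)) = int j \<and> \<tau> (tmp n) = \<bar>v\<bar> \<and>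
     same n \<sigma> \<tau> \<and> j + k = blen v)" for k \<tau>
  define \<sigma>1 where "\<sigma>1 = \<sigma>(tmp n := \<bar>v\<bar>, tmp (n+1) := 1, tmp (n+2) := 0)"
  have I0: "I (blen v) \<sigma>1" unfolding I_def \<sigma>1_def
    by (rule exI[of _ 0]) (auto intro!: same_upd)
  have "runs (While (-1, [(tmp (n+1), 1), (tmp n, -1)])
        (Seq (Asn (tmp (n+1)) (0, [(tmp (n+1), 2)])) (Asn (tmp (n+2)) (1, [(tmp (n+2), 1)])))) \<sigma>1
     (Suc (blen v * Suc 3)) (I 0)"
  proof (rule runs_While[where I = I, OF _ _ I0])
    fix k \<tau> assume "I k \<tau>" and lt: "lval (- 1, [(tmp (n + 1), 1), (tmp n, - 1)]) \<tau> < 0"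
    then obtain j where j: "\<tau> (tmp (n+1)) = 2 ^ j" "\<tau> (tmp (n+2)) = int j" "\<tau> (tmp n) = \<bar>v\<bar>"
      "same n \<sigma> \<tau>" "j + k = blen v" unfolding I_def by blast
    from lt j have "2 ^ j \<le> \<bar>v\<bar>" by (simp add: lval_def)
    then have "j < blen v" by (simp add: less_blen_iff)
    then obtain k' where k': "k = Suc k'" using j by (cases k) auto
    have "I k' (\<tau>(tmp (n+1) := 2 ^ Suc j, tmp (n+2) := int (Suc j)))"
      unfolding I_def using j k' by (intro exI[of _ "Suc j"]) (auto intro!: same_upd)
    then have "runs (Seq (Asn (tmp (n+1)) (0, [(tmp (n+1), 2)])) (Asn (tmp (n+2)) (1, [(tmp (n+2), 1)]))) \<tau>
      (Suc (1 + 1)) (I k')"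
      using j by (intro runs_Seq runs_Asn) (simp_all add: lval_def add.commute)
    then show "\<exists>k'. k = Suc k' \<and> runs (Seq (Asn (tmp (n+1)) (0, [(tmp (n+1), 2)])) (Asn (tmp (n+2)) (1, [(tmp (n+2), 1)]))) \<tau> 3 (I k')"
      using k' by (simp add: numeral_3_eq_3)
  next
    fix k \<tau> assume "I k \<tau>" and lt: "\<not> lval (- 1, [(tmp (n + 1), 1), (tmp n, - 1)]) \<tau> < 0"
    then obtain j where j: "\<tau> (tmp (n+1)) = 2 ^ j" "\<tau> (tmp (n+2)) = int j" "\<tau> (tmp n) = \<bar>v\<bar>"
      "same n \<sigma> \<tau>" "j + k = blen v" unfolding I_def by blast
    from lt j have "\<not> 2 ^ j \<le> \<bar>v\<bar>" by (simp add: lval_def)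
    then have "k = 0" using j by (simp flip: less_blen_iff)
    then show "I 0 \<tau>" using \<open>I k \<tau>\<close> by simp
  qed
  moreover have "Q (\<tau>(tmp n := lval (0, [(tmp (n + 2), 1)]) \<tau>))" if I: "I 0 \<tau>" for \<tau>
    by (rule assms(2)) (use I in \<open>auto simp: I_def lval_def size_int_blen v_def intro!: same_upd\<close>)
  ultimately have W: "runs (Seq (While (-1, [(tmp (n+1), 1), (tmp n, -1)])
        (Seq (Asn (tmp (n+1)) (0, [(tmp (n+1), 2)])) (Asn (tmp (n+2)) (1, [(tmp (n+2), 1)]))))
      (Asn (tmp n) (0, [(tmp (n+2), 1)]))) \<sigma>1 (Suc (Suc (blen v * Suc 3) + 1)) Q"
    by (intro runs_Seq, elim runs_mono) (auto intro: runs_Asn)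
  have "runs (size_code n) \<sigma> (Suc (2 + Suc (1 + Suc (1 + Suc (Suc (blen v * Suc 3) + 1))))) Q"
    unfolding size_code_def
    by (intro runs_Seq[where ?c1.0 = "abs_code _"] runs_Seq[where ?c1.0 = "Asn _ _"] runs_abs runs_Asn)
      (use W in \<open>simp_all add: \<sigma>1_def v_def lval_def\<close>)
  then show ?thesis
    using blen_le[OF assms(1)] by (rule_tac runs_mono) (auto simp: v_def)
qed

text \<open>Offsets 0 to 4 hold the remainder, the divisor, the quotient, a multiple
  \<open>D\<close> of the divisor by a power of two, and that power \<open>P\<close>. The inner loop
  doubles until \<open>D\<close> is the largest such multiple not above the remainder; the outer
  loop then subtracts it.\<close>

definition divmod_code :: "nat \<Rightarrow> com" where
  "divmod_code n = Seq (Asn (tmp (n+2)) (0, []))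
     (While (-1, [(tmp (n+1), 1), (tmp n, -1)])
       (Seq (Asn (tmp (n+3)) (0, [(tmp (n+1), 1)])) (Seq (Asn (tmp (n+4)) (1, []))
        (Seq (While (-1, [(tmp (n+3), 2), (tmp n, -1)])
           (Seq (Asn (tmp (n+3)) (0, [(tmp (n+3), 2)])) (Asn (tmp (n+4)) (0, [(tmp (n+4), 2)]))))
         (Seq (Asn (tmp n) (0, [(tmp n, 1), (tmp (n+3), -1)]))
           (Asn (tmp (n+2)) (0, [(tmp (n+2), 1), (tmp (n+4), 1)])))))))"

lemma runs_divmod_inner:
  assumes b: "0 < b" and a: "a < 2 ^ B" and ba: "b \<le> a"
    and \<sigma>: "\<sigma> (tmp n) = a" "\<sigma> (tmp (n+3)) = b" "\<sigma> (tmp (n+4)) = 1"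
    and Q: "\<And>\<tau> D P. D = P * b \<Longrightarrow> D \<le> a \<Longrightarrow> a < 2 * D \<Longrightarrow> \<tau> = \<sigma>(tmp (n+3) := D, tmp (n+4) := P) \<Longrightarrow> Q \<tau>"
  shows "runs (While (-1, [(tmp (n+3), 2), (tmp n, -1)])
           (Seq (Asn (tmp (n+3)) (0, [(tmp (n+3), 2)])) (Asn (tmp (n+4)) (0, [(tmp (n+4), 2)])))) \<sigma>
     (Suc (B * Suc 3)) Q"
proof -
  define I where "I k \<tau> \<longleftrightarrow> (\<exists>j. j + k = B \<and> 2 ^ j * b \<le> a \<and> \<tau> = \<sigma>(tmp (n+3) := 2 ^ j * b, tmp (n+4) := 2 ^ j))"
    for k \<tau>
  have I0: "I B \<sigma>" unfolding I_def using \<sigma> ba by (intro exI[of _ 0]) (auto simp: fun_eq_iff)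
  show ?thesis
  proof (rule runs_While[where I = I, OF _ _ I0])
    fix k \<tau> assume "I k \<tau>" and lt: "lval (-1, [(tmp (n+3), 2), (tmp n, -1)]) \<tau> < 0"
    then obtain j where j: "j + k = B" "2 ^ j * b \<le> a" "\<tau> = \<sigma>(tmp (n+3) := 2 ^ j * b, tmp (n+4) := 2 ^ j)"
      unfolding I_def by blast
    from lt j \<sigma> have le: "2 ^ Suc j * b \<le> a" by (simp add: lval_def)
    have "(2::int) ^ Suc j * 1 \<le> 2 ^ Suc j * b" using b by (intro mult_left_mono) auto
    then have "(2::int) ^ Suc j < 2 ^ B" using le a by linarith
    then have "Suc j < B" by (simp only: power_strict_increasing_iff)
    then obtain k' where k': "k = Suc k'" using j by (cases k) auto
    have "I k' (\<tau>(tmp (n+3) := 2 ^ Suc j * b, tmp (n+4) := 2 ^ Suc j))"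
      unfolding I_def using j k' le by (intro exI[of _ "Suc j"]) (auto simp: fun_eq_iff)
    then have "runs (Seq (Asn (tmp (n+3)) (0, [(tmp (n+3), 2)])) (Asn (tmp (n+4)) (0, [(tmp (n+4), 2)]))) \<tau>
      (Suc (1 + 1)) (I k')"
      using j by (intro runs_Seq runs_Asn) (simp_all add: lval_def mult.assoc)
    then show "\<exists>k'. k = Suc k' \<and> runs (Seq (Asn (tmp (n+3)) (0, [(tmp (n+3), 2)])) (Asn (tmp (n+4)) (0, [(tmp (n+4), 2)]))) \<tau> 3 (I k')"
      using k' by (simp add: numeral_3_eq_3)
  next
    fix k \<tau> assume "I k \<tau>" and lt: "\<not> lval (-1, [(tmp (n+3), 2), (tmp n, -1)]) \<tau> < 0"
    then obtain j where j: "j + k = B" "2 ^ j * b \<le> a" "\<tau> = \<sigma>(tmp (n+3) := 2 ^ j * b, tmp (n+4) := 2 ^ j)"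
      unfolding I_def by blast
    show "Q \<tau>" by (rule Q[of "2 ^ j * b" "2 ^ j"]) (use lt j \<sigma> in \<open>auto simp: lval_def\<close>)
  qed
qed

text \<open>Quadratic, because each round more than halves the remainder: there are at most
  \<open>B\<close> rounds with at most \<open>B\<close> doublings each.\<close>

lemma runs_divmod:
  assumes b: "0 < b" and a: "0 \<le> a" "a < 2 ^ B"
    and \<sigma>: "\<sigma> (tmp n) = a" "\<sigma> (tmp (n+1)) = b"
    and Q: "\<And>\<tau>. \<tau> (tmp n) = a mod b \<Longrightarrow> \<tau> (tmp (n+2)) = a div b \<Longrightarrow>
      (\<forall>r. r \<noteq> tmp n \<longrightarrow> r \<noteq> tmp (n+2) \<longrightarrow> r \<noteq> tmp (n+3) \<longrightarrow> r \<noteq> tmp (n+4) \<longrightarrow> \<tau> r = \<sigma> r) \<Longrightarrow> Q \<tau>"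
  shows "runs (divmod_code n) \<sigma> (20 * (B + 1) ^ 2) Q"
proof -
  define fr where "fr \<tau> \<longleftrightarrow> (\<forall>r. r \<noteq> tmp n \<longrightarrow> r \<noteq> tmp (n+2) \<longrightarrow> r \<noteq> tmp (n+3) \<longrightarrow> r \<noteq> tmp (n+4) \<longrightarrow> \<tau> r = \<sigma> r)" for \<tau>
  define I where "I k \<tau> \<longleftrightarrow> fr \<tau> \<and> k \<le> B \<and> 0 \<le> \<tau> (tmp n) \<and> \<tau> (tmp n) < 2 ^ k \<and> \<tau> (tmp (n+2)) * b + \<tau> (tmp n) = a"
    for k \<tau>
  let ?inner = "While (-1, [(tmp (n+3), 2), (tmp n, -1)])
           (Seq (Asn (tmp (n+3)) (0, [(tmp (n+3), 2)])) (Asn (tmp (n+4)) (0, [(tmp (n+4), 2)])))"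
  let ?body = "Seq (Asn (tmp (n+3)) (0, [(tmp (n+1), 1)])) (Seq (Asn (tmp (n+4)) (1, []))
        (Seq ?inner
         (Seq (Asn (tmp n) (0, [(tmp n, 1), (tmp (n+3), -1)]))
           (Asn (tmp (n+2)) (0, [(tmp (n+2), 1), (tmp (n+4), 1)])))))"
  let ?N = "Suc (1 + Suc (1 + Suc (Suc (B * Suc 3) + Suc (1 + 1))))"
  have I0: "I B (\<sigma>(tmp (n+2) := 0))" using a \<sigma> by (auto simp: I_def fr_def)
  have "runs (While (-1, [(tmp (n+1), 1), (tmp n, -1)]) ?body) (\<sigma>(tmp (n+2) := 0)) (Suc (B * Suc ?N)) Q"
  proof (rule runs_While[where I = I, OF _ _ I0])
    fix k \<tau> assume I: "I k \<tau>" and lt: "lval (-1, [(tmp (n+1), 1), (tmp n, -1)]) \<tau> < 0"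
    define x where "x = \<tau> (tmp n)"
    have fr: "fr \<tau>" and k: "k \<le> B" and x: "0 \<le> x" "x < 2 ^ k" and qa: "\<tau> (tmp (n+2)) * b + x = a"
      using I by (auto simp: I_def x_def)
    have tb: "\<tau> (tmp (n+1)) = b" using fr \<sigma> by (auto simp: fr_def)
    from lt tb have bx: "b \<le> x" by (simp add: lval_def x_def)
    then obtain k' where k': "k = Suc k'" using x b by (cases k) auto
    have xB: "x < 2 ^ B" using x(2) power_increasing[OF k, of "2::int"] by linarith
    define \<tau>1 where "\<tau>1 = \<tau>(tmp (n+3) := b, tmp (n+4) := 1)"
    have "runs ?inner \<tau>1 (Suc (B * Suc 3)) (\<lambda>\<rho>. runs (Seq (Asn (tmp n) (0, [(tmp n, 1), (tmp (n+3), -1)]))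
           (Asn (tmp (n+2)) (0, [(tmp (n+2), 1), (tmp (n+4), 1)]))) \<rho> (Suc (1 + 1)) (I k'))"
    proof (rule runs_divmod_inner[OF b xB bx])
      fix \<rho> D P assume D: "D = P * b" "D \<le> x" "x < 2 * D" and \<rho>: "\<rho> = \<tau>1(tmp (n+3) := D, tmp (n+4) := P)"
      \<comment> \<open>From \<open>x < 2 * D\<close> follows \<open>2 * (x - D) < x\<close>, so the
        remainder loses a bit.\<close>
      have "2 * (x - D) < 2 * 2 ^ k'" using x(2) D k' by simp
      then have "I k' (\<rho>(tmp n := x - D, tmp (n+2) := \<tau> (tmp (n+2)) + P))"
        using fr k k' D qa unfolding I_def by (auto simp: fr_def \<rho> \<tau>1_def algebra_simps)
      then show "runs (Seq (Asn (tmp n) (0, [(tmp n, 1), (tmp (n+3), -1)]))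
           (Asn (tmp (n+2)) (0, [(tmp (n+2), 1), (tmp (n+4), 1)]))) \<rho> (Suc (1 + 1)) (I k')"
        by (intro runs_Seq runs_Asn) (simp_all add: lval_def \<rho> \<tau>1_def x_def)
    qed (auto simp: \<tau>1_def x_def)
    from runs_Seq[OF this] have "runs ?body \<tau> ?N (I k')"
      using tb by (intro runs_Seq[where ?c1.0 = "Asn _ _"] runs_Asn) (simp_all add: lval_def \<tau>1_def)
    then show "\<exists>k'. k = Suc k' \<and> runs ?body \<tau> ?N (I k')" using k' by blast
  next
    fix k \<tau> assume I: "I k \<tau>" and lt: "\<not> lval (-1, [(tmp (n+1), 1), (tmp n, -1)]) \<tau> < 0"
    have fr: "fr \<tau>" and k: "k \<le> B" and x: "0 \<le> \<tau> (tmp n)" and qa: "\<tau> (tmp (n+2)) * b + \<tau> (tmp n) = a"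
      using I by (auto simp: I_def)
    have tb: "\<tau> (tmp (n+1)) = b" using fr \<sigma> by (auto simp: fr_def)
    from lt tb have xb: "\<tau> (tmp n) < b" by (simp add: lval_def)
    have "a div b = \<tau> (tmp (n+2))" "a mod b = \<tau> (tmp n)"
      using qa x xb b by auto
    then show "Q \<tau>" using fr by (intro Q) (auto simp: fr_def)
  qed
  then have "runs (divmod_code n) \<sigma> (Suc (1 + Suc (B * Suc ?N))) Q"
    unfolding divmod_code_def by (intro runs_Seq runs_Asn) (simp_all add: lval_def)
  then show ?thesis
    by (rule runs_mono) (auto simp: power2_eq_square algebra_simps)
qed

definition neg_if_neg :: "nat \<Rightarrow> nat \<Rightarrow> com" where
  "neg_if_neg s r = Cond (0, [(s, 1)]) (Asn r (0, [(r, -1)])) skip"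

lemma runs_neg_if_neg: "Q (\<sigma>(r := if \<sigma> s < 0 then - \<sigma> r else \<sigma> r)) \<Longrightarrow> 2 \<le> N \<Longrightarrow> runs (neg_if_neg s r) \<sigma> N Q"
  unfolding neg_if_neg_def
  by (rule runs_mono[OF runs_Cond[of _ _ _ 1 _ _ 1]])
    (auto intro!: runs_Asn runs_skip simp: lval_def fun_upd_idem split: if_splits)

text \<open>Divides absolute values, with the signed operands saved at offsets 5 and 6, beyond those
  used by \<open>divmod_code\<close>; \<open>c\<close> then restores the sign. A zero divisor yields
  0 for both operations.\<close>

definition signed_code :: "com \<Rightarrow> nat \<Rightarrow> com" where
  "signed_code c n = Seq (Asn (tmp (n+5)) (0, [(tmp n, 1)])) (Seq (Asn (tmp (n+6)) (0, [(tmp (n+1), 1)]))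
     (Seq (abs_code (tmp n)) (Seq (abs_code (tmp (n+1)))
       (Cond (-1, [(tmp (n+1), 1)]) (Asn (tmp n) (0, [])) (Seq (divmod_code n) c)))))"

lemma runs_signed:
  assumes \<sigma>: "\<sigma> (tmp n) = a" "\<sigma> (tmp (n+1)) = b" and a: "\<bar>a\<bar> < 2 ^ B"
    and z: "\<And>\<tau>. b = 0 \<Longrightarrow> \<tau> (tmp n) = 0 \<Longrightarrow> same n \<sigma> \<tau> \<Longrightarrow> Q \<tau>"
    and c: "\<And>\<tau>. b \<noteq> 0 \<Longrightarrow> \<tau> (tmp n) = \<bar>a\<bar> mod \<bar>b\<bar> \<Longrightarrow> \<tau> (tmp (n+2)) = \<bar>a\<bar> div \<bar>b\<bar> \<Longrightarrow> \<tau> (tmp (n+5)) = a \<Longrightarrow>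
       \<tau> (tmp (n+6)) = b \<Longrightarrow> same n \<sigma> \<tau> \<Longrightarrow> runs c \<tau> 20 Q"
  shows "runs (signed_code c n) \<sigma> (20 * (B + 1) ^ 2 + 60) Q"
proof -
  define \<sigma>1 where "\<sigma>1 = \<sigma>(tmp (n+5) := a, tmp (n+6) := b, tmp n := \<bar>a\<bar>, tmp (n+1) := \<bar>b\<bar>)"
  have s1: "same n \<sigma> \<sigma>1" unfolding \<sigma>1_def by (intro same_upd) auto
  have "runs (Cond (-1, [(tmp (n+1), 1)]) (Asn (tmp n) (0, [])) (Seq (divmod_code n) c)) \<sigma>1
     (Suc (max 1 (Suc (20 * (B + 1) ^ 2 + 20)))) Q"
  proof (rule runs_Cond)
    assume "lval (-1, [(tmp (n+1), 1)]) \<sigma>1 < 0"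
    then have "b = 0" by (simp add: lval_def \<sigma>1_def)
    then show "runs (Asn (tmp n) (0, [])) \<sigma>1 1 Q"
      using s1 by (intro runs_Asn z) (auto simp: lval_def intro!: same_upd)
  next
    assume "\<not> lval (-1, [(tmp (n+1), 1)]) \<sigma>1 < 0"
    then have b: "b \<noteq> 0" by (auto simp: lval_def \<sigma>1_def)
    show "runs (Seq (divmod_code n) c) \<sigma>1 (Suc (20 * (B + 1) ^ 2 + 20)) Q"
    proof (rule runs_Seq, rule runs_divmod)
      show "0 < \<bar>b\<bar>" "0 \<le> \<bar>a\<bar>" "\<bar>a\<bar> < 2 ^ B" using b a by auto
      show "\<sigma>1 (tmp n) = \<bar>a\<bar>" "\<sigma>1 (tmp (n + 1)) = \<bar>b\<bar>" by (simp_all add: \<sigma>1_def)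
      fix \<tau> assume \<tau>: "\<tau> (tmp n) = \<bar>a\<bar> mod \<bar>b\<bar>" "\<tau> (tmp (n + 2)) = \<bar>a\<bar> div \<bar>b\<bar>"
        "\<forall>r. r \<noteq> tmp n \<longrightarrow> r \<noteq> tmp (n+2) \<longrightarrow> r \<noteq> tmp (n+3) \<longrightarrow> r \<noteq> tmp (n+4) \<longrightarrow> \<tau> r = \<sigma>1 r"
      have "same n \<sigma>1 \<tau>" using \<tau>(3) by (auto simp: same_def)
      then have "same n \<sigma> \<tau>" using s1 same_trans by blast
      then show "runs c \<tau> 20 Q" using b \<tau> by (intro c) (auto simp: \<sigma>1_def)
    qed
  qed
  then have "runs (signed_code c n) \<sigma> (Suc (1 + Suc (1 + Suc (2 + Suc (2 + Suc (max 1 (Suc (20 * (B + 1) ^ 2 + 20)))))))) Q"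
    unfolding signed_code_def using \<sigma>
    by (intro runs_Seq runs_Asn runs_abs) (simp_all add: \<sigma>1_def lval_def fun_upd_twist)
  then show ?thesis by (rule runs_mono) auto
qed

lemma sgn_cases_int: "sgn (a::int) = (if a < 0 then -1 else if a = 0 then 0 else 1)"
  by (simp add: sgn_if)

lemma tdiv_eq: "b \<noteq> 0 \<Longrightarrow> tdiv a b =
   (let q = \<bar>a\<bar> div \<bar>b\<bar>; q' = (if a < 0 then - q else q) in if b < 0 then - q' else q')"
  by (auto simp: tdiv_def sgn_cases_int Let_def)

text \<open>The remainder follows the sign of the dividend: the factor \<open>sgn b\<close> of the
  quotient meets \<open>b\<close> and leaves \<open>|b|\<close>, so only \<open>sgn a\<close>
  remains.\<close>

lemma tmod_eq: "b \<noteq> 0 \<Longrightarrow> tmod a b = (if a < 0 then - (\<bar>a\<bar> mod \<bar>b\<bar>) else \<bar>a\<bar> mod \<bar>b\<bar>)"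
proof -
  assume b: "b \<noteq> 0"
  have "tmod a b = sgn a * \<bar>a\<bar> - (b * sgn b) * (sgn a * (\<bar>a\<bar> div \<bar>b\<bar>))"
    using b sgn_mult_abs[of a] by (simp add: tmod_def tdiv_def algebra_simps)
  also have "\<dots> = sgn a * (\<bar>a\<bar> - \<bar>b\<bar> * (\<bar>a\<bar> div \<bar>b\<bar>))"
    by (simp add: abs_sgn[symmetric] algebra_simps)
  also have "\<dots> = sgn a * (\<bar>a\<bar> mod \<bar>b\<bar>)" by (simp add: minus_mult_div_eq_mod)
  finally show ?thesis by (auto simp: sgn_cases_int)
qed

definition div_code :: "nat \<Rightarrow> com" where
  "div_code n = signed_code (Seq (Asn (tmp n) (0, [(tmp (n+2), 1)]))
     (Seq (neg_if_neg (tmp (n+5)) (tmp n)) (neg_if_neg (tmp (n+6)) (tmp n)))) n"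

definition mod_code :: "nat \<Rightarrow> com" where
  "mod_code n = signed_code (neg_if_neg (tmp (n+5)) (tmp n)) n"

lemma runs_div:
  assumes \<sigma>: "\<sigma> (tmp n) = a" "\<sigma> (tmp (n+1)) = b" and a: "\<bar>a\<bar> < 2 ^ B"
    and Q: "\<And>\<tau>. \<tau> (tmp n) = tdiv a b \<Longrightarrow> same n \<sigma> \<tau> \<Longrightarrow> Q \<tau>"
  shows "runs (div_code n) \<sigma> (20 * (B + 1) ^ 2 + 60) Q"
  unfolding div_code_def
proof (rule runs_signed[OF \<sigma> a])
  fix \<tau> assume b: "b \<noteq> 0" and \<tau>: "\<tau> (tmp (n + 2)) = \<bar>a\<bar> div \<bar>b\<bar>" "\<tau> (tmp (n + 5)) = a"
    "\<tau> (tmp (n + 6)) = b" "same n \<sigma> \<tau>"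
  have "runs (Seq (Asn (tmp n) (0, [(tmp (n + 2), 1)]))
            (Seq (neg_if_neg (tmp (n + 5)) (tmp n)) (neg_if_neg (tmp (n + 6)) (tmp n)))) \<tau> (Suc (1 + Suc (2 + 2))) Q"
    using \<tau> b by (intro runs_Seq runs_Asn runs_neg_if_neg Q) (auto simp: lval_def tdiv_eq Let_def intro!: same_upd)
  then show "runs (Seq (Asn (tmp n) (0, [(tmp (n + 2), 1)]))
            (Seq (neg_if_neg (tmp (n + 5)) (tmp n)) (neg_if_neg (tmp (n + 6)) (tmp n)))) \<tau> 20 Q"
    by (rule runs_mono) auto
qed (auto intro!: Q simp: tdiv_def)

lemma runs_mod:
  assumes \<sigma>: "\<sigma> (tmp n) = a" "\<sigma> (tmp (n+1)) = b" and a: "\<bar>a\<bar> < 2 ^ B"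
    and Q: "\<And>\<tau>. \<tau> (tmp n) = tmod a b \<Longrightarrow> same n \<sigma> \<tau> \<Longrightarrow> Q \<tau>"
  shows "runs (mod_code n) \<sigma> (20 * (B + 1) ^ 2 + 60) Q"
  unfolding mod_code_def
proof (rule runs_signed[OF \<sigma> a])
  fix \<tau> assume b: "b \<noteq> 0" and \<tau>: "\<tau> (tmp n) = \<bar>a\<bar> mod \<bar>b\<bar>" "\<tau> (tmp (n + 5)) = a" "same n \<sigma> \<tau>"
  show "runs (neg_if_neg (tmp (n + 5)) (tmp n)) \<tau> 20 Q"
    using \<tau> b by (intro runs_neg_if_neg Q) (auto simp: tmod_eq intro!: same_upd)
qed (auto intro!: Q simp: tmod_def)

definition bool_code :: "lin \<Rightarrow> nat \<Rightarrow> com" where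
  "bool_code l n = Cond l (Asn (tmp n) (1, [])) (Asn (tmp n) (0, []))"

lemma runs_bool: "Q (\<sigma>(tmp n := of_bool (lval l \<sigma> < 0))) \<Longrightarrow> 2 \<le> N \<Longrightarrow> runs (bool_code l n) \<sigma> N Q"
  unfolding bool_code_def
  by (rule runs_mono[OF runs_Cond[of _ _ _ 1 _ _ 1]])
    (auto intro!: runs_Asn simp: lval_def[of "(_, [])"])

subsection \<open>Compiling expressions\<close>

text \<open>Booleans are 0 and 1. Over the integers every comparison is a sign test,
  \<open>a \<le> b\<close> being \<open>a - b - 1 < 0\<close>; equality takes two tests, and
  conjunction is \<open>1 - a - b < 0\<close>.\<close>

fun op_code :: "oper \<Rightarrow> nat \<Rightarrow> com" where
  "op_code ONeg n = Asn (tmp n) (0, [(tmp n, -1)])"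
| "op_code OAdd n = Asn (tmp n) (0, [(tmp n, 1), (tmp (n+1), 1)])"
| "op_code OSub n = Asn (tmp n) (0, [(tmp n, 1), (tmp (n+1), -1)])"
| "op_code ODiv n = div_code n"
| "op_code OMod n = mod_code n"
| "op_code OSize n = size_code n"
| "op_code OGe n = bool_code (-1, [(tmp (n+1), 1), (tmp n, -1)]) n"
| "op_code OLe n = bool_code (-1, [(tmp n, 1), (tmp (n+1), -1)]) n"
| "op_code OGt n = bool_code (0, [(tmp (n+1), 1), (tmp n, -1)]) n"
| "op_code OLt n = bool_code (0, [(tmp n, 1), (tmp (n+1), -1)]) n"
| "op_code OEq n = Cond (0, [(tmp n, 1), (tmp (n+1), -1)]) (Asn (tmp n) (0, []))
     (bool_code (-1, [(tmp n, 1), (tmp (n+1), -1)]) n)"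
| "op_code ONe n = Cond (0, [(tmp n, 1), (tmp (n+1), -1)]) (Asn (tmp n) (1, []))
     (bool_code (0, [(tmp (n+1), 1), (tmp n, -1)]) n)"
| "op_code ONot n = Asn (tmp n) (1, [(tmp n, -1)])"
| "op_code OAnd n = bool_code (1, [(tmp n, -1), (tmp (n+1), -1)]) n"
| "op_code OOr n = bool_code (0, [(tmp n, -1), (tmp (n+1), -1)]) n"

fun code_val :: "val \<Rightarrow> int" where
  "code_val (VInt i) = i"
| "code_val (VBool b) = of_bool b"

lemma args_int1_Some: "args_int1 vs = Some a \<longleftrightarrow> vs = [VInt a]"
  by (cases vs rule: args_int1.cases) auto
lemma args_int2_Some: "args_int2 vs = Some p \<longleftrightarrow> vs = [VInt (fst p), VInt (snd p)]"
  by (cases vs rule: args_int2.cases) auto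
lemma args_bool1_Some: "args_bool1 vs = Some a \<longleftrightarrow> vs = [VBool a]"
  by (cases vs rule: args_bool1.cases) auto
lemma args_bool2_Some: "args_bool2 vs = Some p \<longleftrightarrow> vs = [VBool (fst p), VBool (snd p)]"
  by (cases vs rule: args_bool2.cases) auto

lemmas args_Some = args_int1_Some args_int2_Some args_bool1_Some args_bool2_Some

lemma op_sem_length: "op_sem f vs = Some v \<Longrightarrow> length vs = 1 \<or> length vs = 2"
  by (cases f) (auto simp: op_sem_def args_Some)

text \<open>Division dominates, so its cost serves for every operator.\<close>

definition op_cost :: "nat \<Rightarrow> nat" where "op_cost B = 20 * (B + 1) ^ 2 + 60"

lemma runs_op:
  assumes sem: "op_sem f vs = Some v" and a: "\<sigma> (tmp n) = code_val (vs ! 0)"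
    and b: "length vs = 2 \<Longrightarrow> \<sigma> (tmp (n+1)) = code_val (vs ! 1)"
    and B: "\<forall>w\<in>set vs. \<bar>code_val w\<bar> < 2 ^ B"
    and Q: "\<And>\<tau>. \<tau> (tmp n) = code_val v \<Longrightarrow> same n \<sigma> \<tau> \<Longrightarrow> Q \<tau>"
  shows "runs (op_code f n) \<sigma> (op_cost B) Q"
proof -
  have le: "20 \<le> op_cost B" by (simp add: op_cost_def)
  have Qu: "w = code_val v \<Longrightarrow> Q (\<sigma>(tmp n := w))" for w
    by (rule Q) (auto intro!: same_upd)
  have "runs (op_code f n) \<sigma> 20 Q" if "f \<notin> {ODiv, OMod, OSize}"
  proof (cases "f \<in> {OEq, ONe}")
    case True
    then obtain x y where vs: "vs = [VInt x, VInt y]" using sem by (auto simp: op_sem_def args_Some)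
    then have xy: "\<sigma> (tmp n) = x" "\<sigma> (tmp (Suc n)) = y" using a b by auto
    from True consider "f = OEq" | "f = ONe" by blast
    then show ?thesis
    proof cases
      case 1
      then have "v = VBool (x = y)" using sem vs by (simp add: op_sem_def)
      then show ?thesis unfolding 1 op_code.simps
        using xy by (intro runs_mono[OF runs_Cond[of _ _ _ 2 _ _ 2]] runs_bool runs_Asn) (auto simp: lval_def intro!: Qu)
    next
      case 2
      then have "v = VBool (x \<noteq> y)" using sem vs by (simp add: op_sem_def)
      then show ?thesis unfolding 2 op_code.simps
        using xy by (intro runs_mono[OF runs_Cond[of _ _ _ 2 _ _ 2]] runs_bool runs_Asn) (auto simp: lval_def intro!: Qu)
    qed
  next
    case False
    with that sem a b show ?thesis
      by (cases f) (auto simp: op_sem_def args_Some lval_def intro!: runs_Asn runs_bool Qu)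
  qed
  then have ?thesis if "f \<notin> {ODiv, OMod, OSize}" using that le runs_mono by blast
  moreover have ?thesis if f: "f = ODiv \<or> f = OMod"
  proof -
    obtain x y where vs: "vs = [VInt x, VInt y]" using sem f by (auto simp: op_sem_def args_Some)
    then have xy: "\<sigma> (tmp n) = x" "\<sigma> (tmp (n+1)) = y" "\<bar>x\<bar> < 2 ^ B" using a b B by auto
    from f show ?thesis
    proof
      assume f: "f = ODiv"
      then have "v = VInt (tdiv x y)" using sem vs by (simp add: op_sem_def)
      then show ?thesis using f runs_div[OF xy, of Q] Q by (simp add: op_cost_def)
    next
      assume f: "f = OMod"
      then have "v = VInt (tmod x y)" using sem vs by (simp add: op_sem_def)
      then show ?thesis using f runs_mod[OF xy, of Q] Q by (simp add: op_cost_def)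
    qed
  qed
  moreover have ?thesis if f: "f = OSize"
  proof -
    obtain x where vs: "vs = [VInt x]" using sem f by (auto simp: op_sem_def args_Some)
    then have x: "\<sigma> (tmp n) = x" "\<bar>x\<bar> < 2 ^ B" using a B by auto
    have v: "v = VInt (size_int x)" using sem vs f by (simp add: op_sem_def)
    have "runs (size_code n) \<sigma> (4 * B + 20) Q"
      using x v by (intro runs_size Q) auto
    then show ?thesis unfolding f op_code.simps
      by (rule runs_mono) (auto simp: op_cost_def power2_eq_square)
  qed
  ultimately show ?thesis by blast
qed

section \<open>Growth of values under operators and expressions\<close>

lemma tdiv_abs_le: "\<bar>tdiv a b\<bar> \<le> \<bar>a\<bar>"
proof (cases "b = 0")
  case False
  have "\<bar>a\<bar> div \<bar>b\<bar> \<le> \<bar>a\<bar>" using False zdiv_mono2[of "\<bar>a\<bar>" 1 "\<bar>b\<bar>"] by simp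
  moreover have "0 \<le> \<bar>a\<bar> div \<bar>b\<bar>" using False by (simp add: pos_imp_zdiv_nonneg_iff)
  ultimately show ?thesis using False by (auto simp: tdiv_eq Let_def)
qed (simp add: tdiv_def)

lemma tmod_abs_le: "\<bar>tmod a b\<bar> \<le> \<bar>a\<bar>"
proof (cases "b = 0")
  case False
  have "\<bar>a\<bar> mod \<bar>b\<bar> \<le> \<bar>a\<bar>" by (intro zmod_le_nonneg_dividend) auto
  moreover have "0 \<le> \<bar>a\<bar> mod \<bar>b\<bar>" using False by simp
  ultimately show ?thesis using False by (auto simp: tmod_eq)
qed (simp add: tmod_def)

text \<open>This is where the lack of multiplication matters: sums and differences add one bit,
  quotients and remainders do not exceed the dividend, and \<open>size\<close> is at most the bit
  length.\<close>

lemma op_sem_bound: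
  assumes sem: "op_sem f vs = Some v" and B: "\<forall>w\<in>set vs. \<bar>code_val w\<bar> < 2 ^ B"
  shows "\<bar>code_val v\<bar> < 2 ^ Suc B"
proof -
  have one: "(1::int) < 2 ^ Suc B" using one_less_power[of "2::int" "Suc B"] by simp
  have p: "(0::int) < 2 ^ B" by simp
  have sz: "\<bar>size_int x\<bar> < 2 * 2 ^ B" if "\<bar>x\<bar> < 2 ^ B" for x
  proof -
    have "\<bar>size_int x\<bar> \<le> int B" using blen_le[OF that] by (simp add: size_int_blen)
    moreover have "int B < 2 ^ B" by (metis less_exp of_nat_less_iff of_nat_numeral of_nat_power)
    ultimately show ?thesis by linarith
  qed
  have dv: "\<bar>tdiv x y\<bar> < 2 * 2 ^ B" "\<bar>tmod x y\<bar> < 2 * 2 ^ B" if "\<bar>x\<bar> < 2 ^ B" for x y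
    using tdiv_abs_le[of x y] tmod_abs_le[of x y] that p by linarith+
  show ?thesis using sem B one sz dv
    by (cases f) (auto simp: op_sem_def args_Some)
qed

fun comp_expr :: "expr \<Rightarrow> nat \<Rightarrow> com" where
  "comp_expr (Var x) n = Asn (tmp n) (0, [(vreg x, 1)])"
| "comp_expr (Num k) n = Asn (tmp n) (int k, [])"
| "comp_expr ETrue n = Asn (tmp n) (1, [])"
| "comp_expr EFalse n = Asn (tmp n) (0, [])"
| "comp_expr (Paren e) n = comp_expr e n"
| "comp_expr (Op f [a]) n = Seq (comp_expr a n) (op_code f n)"
| "comp_expr (Op f [a, b]) n = Seq (comp_expr a n) (Seq (comp_expr b (n+1)) (op_code f n))"
| "comp_expr (Op f es) n = skip"

text \<open>Not the syntactic size but a bound on the bits that evaluation may add: a numeral counts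
  as \<open>k\<close> because \<open>k < 2 ^ k\<close>, an operator adds one bit to what its
  operands may reach, and \<open>true\<close> needs one bit even at width 0.\<close>

primrec expr_size :: "expr \<Rightarrow> nat" where
  "expr_size (Var x) = 0"
| "expr_size (Num k) = k"
| "expr_size ETrue = 1"
| "expr_size EFalse = 1"
| "expr_size (Op f es) = Suc (sum_list (map expr_size es))"
| "expr_size (Paren e) = expr_size e"

definition bounded :: "nat \<Rightarrow> store \<Rightarrow> bool" where
  "bounded B \<Sigma> \<longleftrightarrow> (\<forall>x v. \<Sigma> x = Some v \<longrightarrow> \<bar>code_val v\<bar> < 2 ^ B)"

lemma bounded_mono: "bounded B \<Sigma> \<Longrightarrow> B \<le> B' \<Longrightarrow> bounded B' \<Sigma>"
  unfolding bounded_def by (meson less_le_trans one_le_numeral power_increasing)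

lemma bounded_upd: "bounded B \<Sigma> \<Longrightarrow> \<bar>code_val v\<bar> < 2 ^ B \<Longrightarrow> bounded B (\<Sigma>(x \<mapsto> v))"
  unfolding bounded_def by auto

lemma eval_bound: "eval \<Sigma> e v \<Longrightarrow> bounded B \<Sigma> \<Longrightarrow> \<bar>code_val v\<bar> < 2 ^ (B + expr_size e)"
proof (induction rule: eval.induct)
  case (ENum \<Sigma> n)
  have "int n < 2 ^ n" by (metis less_exp of_nat_less_iff of_nat_numeral of_nat_power)
  also have "\<dots> \<le> 2 ^ (B + n)" by (intro power_increasing) auto
  finally show ?case by simp
next
  case (EOp \<Sigma> es vs f v)
  have "\<bar>code_val w\<bar> < 2 ^ (B + sum_list (map expr_size es))" if w: "w \<in> set vs" for w
  proof -
    obtain i where i: "i < length vs" "w = vs ! i" using w by (auto simp: in_set_conv_nth)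
    define e where "e = es ! i"
    have e: "e \<in> set es" "\<bar>code_val w\<bar> < 2 ^ (B + expr_size e)"
      using EOp.IH EOp.prems i by (auto simp: list_all2_conv_all_nth e_def)
    have "expr_size e \<le> sum_list (map expr_size es)" using e(1) by (intro member_le_sum_list) auto
    then have "(2::int) ^ (B + expr_size e) \<le> 2 ^ (B + sum_list (map expr_size es))"
      by (intro power_increasing) auto
    then show ?thesis using e(2) by linarith
  qed
  then have "\<bar>code_val v\<bar> < 2 ^ Suc (B + sum_list (map expr_size es))"
    using op_sem_bound[OF EOp.hyps] by blast
  then show ?case by simp
next
  case (ETrue \<Sigma>)
  have "(0::int) < 2 ^ B" by simp
  then have "(1::int) < 2 * 2 ^ B" by linarith
  then show ?case by simp
qed (auto simp: bounded_def)

definition rel :: "store \<Rightarrow> regs \<Rightarrow> bool" where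
  "rel \<Sigma> \<sigma> \<longleftrightarrow> (\<forall>x v. \<Sigma> x = Some v \<longrightarrow> \<sigma> (vreg x) = code_val v)"

lemma rel_same: "rel \<Sigma> \<sigma> \<Longrightarrow> same n \<sigma> \<tau> \<Longrightarrow> rel \<Sigma> \<tau>"
  by (simp add: rel_def same_vreg)

text \<open>The cost depends on the width of the store only, uniformly in the store and the stack
  height, and is demanded only where the expression has a value.\<close>

definition expr_cost :: "(nat \<Rightarrow> nat) \<Rightarrow> expr \<Rightarrow> bool" where
  "expr_cost p e \<longleftrightarrow> (\<forall>\<Sigma> v \<sigma> B n. eval \<Sigma> e v \<longrightarrow> rel \<Sigma> \<sigma> \<longrightarrow> bounded B \<Sigma> \<longrightarrow>
     runs (comp_expr e n) \<sigma> (p B) (\<lambda>\<tau>. \<tau> (tmp n) = code_val v \<and> same n \<sigma> \<tau>))"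

inductive_cases eval_VarE: "eval \<Sigma> (Var x) v"
inductive_cases eval_NumE: "eval \<Sigma> (Num k) v"
inductive_cases eval_TrueE: "eval \<Sigma> ETrue v"
inductive_cases eval_FalseE: "eval \<Sigma> EFalse v"
inductive_cases eval_OpE: "eval \<Sigma> (Op f es) v"
inductive_cases eval_ParenE: "eval \<Sigma> (Paren e) v"

lemma poly_bd_op_cost: "poly_bd (\<lambda>B. op_cost (B + k))"
  unfolding op_cost_def by (intro poly_bd_intros)

text \<open>Induction along \<open>comp_expr\<close> separates operators by arity; with other than
  one or two arguments there is never a value. An application costs as much as its operands plus one
  operator on values widened by their \<open>expr_size\<close>.\<close>

lemma ex_expr_cost:
  fixes n :: nat
  shows "\<exists>p. poly_bd p \<and> expr_cost p e"
proof (induction e n rule: comp_expr.induct)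
  case (1 x)
  have "expr_cost (\<lambda>B. 1) (Var x)"
    unfolding expr_cost_def
    by (auto elim!: eval_VarE intro!: runs_Asn same_upd simp: lval_def rel_def)
  then show ?case using poly_bd_const by blast
next
  case (2 k)
  have "expr_cost (\<lambda>B. 1) (Num k)"
    unfolding expr_cost_def
    by (auto elim!: eval_NumE intro!: runs_Asn same_upd simp: lval_def)
  then show ?case using poly_bd_const by blast
next
  case 3
  have "expr_cost (\<lambda>B. 1) ETrue"
    unfolding expr_cost_def
    by (auto elim!: eval_TrueE intro!: runs_Asn same_upd simp: lval_def)
  then show ?case using poly_bd_const by blast
next
  case 4
  have "expr_cost (\<lambda>B. 1) EFalse"
    unfolding expr_cost_def
    by (auto elim!: eval_FalseE intro!: runs_Asn same_upd simp: lval_def)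
  then show ?case using poly_bd_const by blast
next
  case (5 e)
  then show ?case unfolding expr_cost_def by (auto elim!: eval_ParenE)
next
  case (6 f a)
  then obtain p where p: "poly_bd p" "expr_cost p a" by blast
  have "expr_cost (\<lambda>B. Suc (p B + op_cost (B + expr_size a))) (Op f [a])"
    unfolding expr_cost_def
  proof (intro allI impI)
    fix \<Sigma> v \<sigma> B n assume ev: "eval \<Sigma> (Op f [a]) v" and r: "rel \<Sigma> \<sigma>" and B: "bounded B \<Sigma>"
    from ev obtain w where w: "eval \<Sigma> a w" and sem: "op_sem f [w] = Some v"
      by (auto elim!: eval_OpE simp: list_all2_Cons1)
    have "runs (comp_expr a n) \<sigma> (p B) (\<lambda>\<tau>. \<tau> (tmp n) = code_val w \<and> same n \<sigma> \<tau>)"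
      using p(2) w r B unfolding expr_cost_def by blast
    then have "runs (comp_expr a n) \<sigma> (p B) (\<lambda>\<tau>. runs (op_code f n) \<tau> (op_cost (B + expr_size a))
       (\<lambda>\<tau>. \<tau> (tmp n) = code_val v \<and> same n \<sigma> \<tau>))"
    proof (rule runs_mono[OF _ order_refl])
      fix \<tau> assume \<tau>: "\<tau> (tmp n) = code_val w \<and> same n \<sigma> \<tau>"
      then show "runs (op_code f n) \<tau> (op_cost (B + expr_size a)) (\<lambda>\<tau>. \<tau> (tmp n) = code_val v \<and> same n \<sigma> \<tau>)"
        using eval_bound[OF w B] same_trans by (intro runs_op[OF sem]) auto
    qed
    from runs_Seq[OF this] show "runs (comp_expr (Op f [a]) n) \<sigma> (Suc (p B + op_cost (B + expr_size a)))
       (\<lambda>\<tau>. \<tau> (tmp n) = code_val v \<and> same n \<sigma> \<tau>)" by simp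
  qed
  moreover have "poly_bd (\<lambda>B. p B + op_cost (B + expr_size a) + 1)"
    by (intro poly_bd_add poly_bd_const p poly_bd_op_cost)
  ultimately show ?case by auto
next
  case (7 f a b)
  then obtain p q where p: "poly_bd p" "expr_cost p a" and q: "poly_bd q" "expr_cost q b" by blast
  let ?k = "expr_size a + expr_size b"
  let ?N = "\<lambda>B. Suc (p B + Suc (q B + op_cost (B + ?k)))"
  have "expr_cost ?N (Op f [a, b])"
    unfolding expr_cost_def
  proof (intro allI impI)
    fix \<Sigma> v \<sigma> B n assume ev: "eval \<Sigma> (Op f [a, b]) v" and r: "rel \<Sigma> \<sigma>" and B: "bounded B \<Sigma>"
    from ev obtain w u where w: "eval \<Sigma> a w" and u: "eval \<Sigma> b u" and sem: "op_sem f [w, u] = Some v"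
      by (auto elim!: eval_OpE simp: list_all2_Cons1)
    let ?Q = "\<lambda>\<tau>. \<tau> (tmp n) = code_val v \<and> same n \<sigma> \<tau>"
    have wb: "\<bar>code_val w\<bar> < 2 ^ (B + ?k)" "\<bar>code_val u\<bar> < 2 ^ (B + ?k)"
    proof -
      have "(2::int) ^ (B + expr_size a) \<le> 2 ^ (B + ?k)" "(2::int) ^ (B + expr_size b) \<le> 2 ^ (B + ?k)"
        by (intro power_increasing; simp)+
      then show "\<bar>code_val w\<bar> < 2 ^ (B + ?k)" "\<bar>code_val u\<bar> < 2 ^ (B + ?k)"
        using eval_bound[OF w B] eval_bound[OF u B] by linarith+
    qed
    have "runs (comp_expr a n) \<sigma> (p B) (\<lambda>\<tau>. \<tau> (tmp n) = code_val w \<and> same n \<sigma> \<tau>)"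
      using p(2) w r B unfolding expr_cost_def by blast
    then have "runs (comp_expr a n) \<sigma> (p B) (\<lambda>\<tau>. runs (Seq (comp_expr b (n+1)) (op_code f n)) \<tau>
        (Suc (q B + op_cost (B + ?k))) ?Q)"
    proof (rule runs_mono[OF _ order_refl])
      fix \<tau> assume \<tau>: "\<tau> (tmp n) = code_val w \<and> same n \<sigma> \<tau>"
      have "runs (comp_expr b (n+1)) \<tau> (q B) (\<lambda>\<rho>. \<rho> (tmp (n+1)) = code_val u \<and> same (n+1) \<tau> \<rho>)"
        using q(2) u rel_same[OF r] \<tau> B unfolding expr_cost_def by blast
      then have "runs (comp_expr b (n+1)) \<tau> (q B) (\<lambda>\<rho>. runs (op_code f n) \<rho> (op_cost (B + ?k)) ?Q)"
      proof (rule runs_mono[OF _ order_refl])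
        fix \<rho> assume \<rho>: "\<rho> (tmp (n+1)) = code_val u \<and> same (n+1) \<tau> \<rho>"
        have 1: "\<rho> (tmp n) = code_val w" using same_tmp[of "n+1" \<tau> \<rho> n] \<tau> \<rho> by simp
        have "same n \<tau> \<rho>" using same_le[of "n+1" \<tau> \<rho> n] \<rho> by simp
        then have 2: "same n \<sigma> \<rho>" using \<tau> same_trans by blast
        show "runs (op_code f n) \<rho> (op_cost (B + ?k)) ?Q"
          using \<rho> wb 1 by (intro runs_op[OF sem]) (auto intro: same_trans[OF 2])
      qed
      then show "runs (Seq (comp_expr b (n+1)) (op_code f n)) \<tau> (Suc (q B + op_cost (B + ?k))) ?Q"
        by (rule runs_Seq)
    qed
    from runs_Seq[OF this] show "runs (comp_expr (Op f [a, b]) n) \<sigma> (?N B) ?Q" by simp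
  qed
  moreover have "poly_bd (\<lambda>B. p B + (q B + op_cost (B + ?k) + 1) + 1)"
    by (intro poly_bd_add poly_bd_const p q poly_bd_op_cost)
  ultimately show ?case by auto
next
  case ("8_1" f)
  have "expr_cost (\<lambda>B. 1) (Op f [])"
    unfolding expr_cost_def by (auto elim!: eval_OpE dest!: op_sem_length)
  then show ?case using poly_bd_const by blast
next
  case ("8_2" f v vb vc vd)
  have "expr_cost (\<lambda>B. 1) (Op f (v # vb # vc # vd))"
    unfolding expr_cost_def by (auto elim!: eval_OpE dest!: op_sem_length list_all2_lengthD)
  then show ?case using poly_bd_const by blast
qed

subsection \<open>Compiling statements\<close>

text \<open>A loop does not compute \<open>size\<close>: with \<open>|v|\<close>,
  \<open>2 ^ j\<close> and \<open>j\<close> in three temporaries it runs while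
  \<open>2 ^ j \<le> |v|\<close>, which means \<open>j < size v\<close>. The body is compiled at
  height \<open>n + 3\<close> to protect them, and \<open>x\<close> receives \<open>j\<close> before
  every pass, as in \<open>LStep\<close>.\<close>

fun comp_stmt :: "stmt \<Rightarrow> nat \<Rightarrow> com" and comp_stmts :: "stmt list \<Rightarrow> nat \<Rightarrow> com" where
  "comp_stmt (Decl t x) n = Asn (vreg x) (0, [])"
| "comp_stmt (Assign x e) n = Seq (comp_expr e n) (Asn (vreg x) (0, [(tmp n, 1)]))"
| "comp_stmt (Block ss) n = comp_stmts ss n"
| "comp_stmt (If e s1 s2) n =
     Seq (comp_expr e n) (Cond (0, [(tmp n, -1)]) (comp_stmt s1 n) (comp_stmt s2 n))"
| "comp_stmt (For x e s) n =
     Seq (comp_expr e n) (Seq (abs_code (tmp n)) (Seq (Asn (tmp (n+1)) (1, [])) (Seq (Asn (tmp (n+2)) (0, []))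
       (While (-1, [(tmp (n+1), 1), (tmp n, -1)])
         (Seq (Asn (vreg x) (0, [(tmp (n+2), 1)])) (Seq (comp_stmt s (n+3))
            (Seq (Asn (tmp (n+1)) (0, [(tmp (n+1), 2)])) (Asn (tmp (n+2)) (1, [(tmp (n+2), 1)])))))))))"
| "comp_stmts [] n = skip"
| "comp_stmts (s # ss) n = Seq (comp_stmt s n) (comp_stmts ss n)"

primrec exprs :: "stmt \<Rightarrow> expr set" where
  "exprs (Decl t x) = {}"
| "exprs (Assign x e) = {e}"
| "exprs (Block ss) = \<Union> (set (map exprs ss))"
| "exprs (If e s1 s2) = insert e (exprs s1 \<union> exprs s2)"
| "exprs (For x e s) = insert e (exprs s)"

lemma finite_exprs: "finite (exprs s)"
  by (induction s) auto

text \<open>\<open>exec\<close> instrumented: expressions are evaluated only in stores of \<open>B\<close>-bit values, in \<open>N\<close> steps.\<close>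

inductive bexec :: "nat \<Rightarrow> store \<Rightarrow> stmt \<Rightarrow> nat \<Rightarrow> store \<Rightarrow> bool"
  and bexecs :: "nat \<Rightarrow> store \<Rightarrow> stmt list \<Rightarrow> nat \<Rightarrow> store \<Rightarrow> bool"
  and bloop :: "nat \<Rightarrow> vname \<Rightarrow> stmt \<Rightarrow> int \<Rightarrow> int \<Rightarrow> store \<Rightarrow> nat \<Rightarrow> store \<Rightarrow> bool"
  for B :: nat where
  BDeclI: "bexec B \<Sigma> (Decl t x) 1 (\<Sigma>(x \<mapsto> VInt 0))"
| BDeclB: "bexec B \<Sigma> (Decl t x) 1 (\<Sigma>(x \<mapsto> VBool False))"
| BAssign: "bounded B \<Sigma> \<Longrightarrow> eval \<Sigma> e v \<Longrightarrow> bexec B \<Sigma> (Assign x e) 1 (\<Sigma>(x \<mapsto> v))"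
| BBlock: "bexecs B \<Sigma> ss N \<Sigma>' \<Longrightarrow> bexec B \<Sigma> (Block ss) N \<Sigma>'"
| BIfT: "bounded B \<Sigma> \<Longrightarrow> eval \<Sigma> e (VBool True) \<Longrightarrow> bexec B \<Sigma> s1 N \<Sigma>' \<Longrightarrow> bexec B \<Sigma> (If e s1 s2) (Suc N) \<Sigma>'"
| BIfF: "bounded B \<Sigma> \<Longrightarrow> eval \<Sigma> e (VBool False) \<Longrightarrow> bexec B \<Sigma> s2 N \<Sigma>' \<Longrightarrow> bexec B \<Sigma> (If e s1 s2) (Suc N) \<Sigma>'"
| BFor: "bounded B \<Sigma> \<Longrightarrow> eval \<Sigma> e (VInt v) \<Longrightarrow> bloop B x s 0 (size_int v) \<Sigma> N \<Sigma>'
    \<Longrightarrow> bexec B \<Sigma> (For x e s) (Suc N) \<Sigma>'"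
| BNil: "bexecs B \<Sigma> [] 1 \<Sigma>"
| BCons: "bexec B \<Sigma> s N1 \<Sigma>1 \<Longrightarrow> bexecs B \<Sigma>1 ss N2 \<Sigma>' \<Longrightarrow> bexecs B \<Sigma> (s # ss) (Suc (N1 + N2)) \<Sigma>'"
| BStop: "i \<le> j \<Longrightarrow> bloop B x s j i \<Sigma> 1 \<Sigma>"
| BStep: "j < i \<Longrightarrow> bexec B (\<Sigma>(x \<mapsto> VInt j)) s N1 \<Sigma>1 \<Longrightarrow> bloop B x s (j + 1) i \<Sigma>1 N2 \<Sigma>'
    \<Longrightarrow> bloop B x s j i \<Sigma> (Suc (N1 + N2)) \<Sigma>'"

text \<open>Weaker than \<open>same\<close>, as statements change program variables; what must
  survive are the temporaries of enclosing loops and the three word registers.\<close>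

definition keeps :: "nat \<Rightarrow> regs \<Rightarrow> regs \<Rightarrow> bool" where
  "keeps n \<sigma> \<tau> \<longleftrightarrow> (\<forall>i<n. \<tau> (tmp i) = \<sigma> (tmp i)) \<and> (\<forall>k<3. \<tau> k = \<sigma> k)"

lemma keeps_trans: "keeps n \<sigma> \<tau> \<Longrightarrow> keeps n \<tau> \<rho> \<Longrightarrow> keeps n \<sigma> \<rho>" by (simp add: keeps_def)
lemma keeps_same: "same n \<sigma> \<tau> \<Longrightarrow> keeps n \<sigma> \<tau>" by (simp add: keeps_def same_tmp same_io)
lemma keeps_le: "keeps m \<sigma> \<tau> \<Longrightarrow> n \<le> m \<Longrightarrow> keeps n \<sigma> \<tau>" by (simp add: keeps_def)
lemma keeps_refl [simp]: "keeps n \<sigma> \<sigma>" by (simp add: keeps_def)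
lemma keeps_upd: "keeps n \<sigma> \<tau> \<Longrightarrow> keeps n \<sigma> (\<tau>(vreg x := v))" by (simp add: keeps_def)
lemma keeps_upd_tmp: "keeps n \<sigma> \<tau> \<Longrightarrow> n \<le> i \<Longrightarrow> keeps n \<sigma> (\<tau>(tmp i := v))" by (auto simp: keeps_def)
lemma rel_upd: "rel \<Sigma> \<sigma> \<Longrightarrow> w = code_val v \<Longrightarrow> rel (\<Sigma>(x \<mapsto> v)) (\<sigma>(vreg x := w))" by (auto simp: rel_def)
lemma rel_upd_tmp: "rel \<Sigma> \<sigma> \<Longrightarrow> rel \<Sigma> (\<sigma>(tmp i := w))" by (auto simp: rel_def)

text \<open>Each unit of \<open>N\<close> pays for at most one expression evaluation, costing
  \<open>p B\<close>, and for up to 20 further register steps. The third part starts in the middle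
  of a loop, with the three temporaries describing iteration \<open>j\<close>.\<close>

lemma runs_stmt:
  assumes p: "\<And>e. e \<in> Es \<Longrightarrow> expr_cost p e"
  shows "bexec B \<Sigma> s N \<Sigma>' \<Longrightarrow> exprs s \<subseteq> Es \<Longrightarrow> rel \<Sigma> \<sigma> \<Longrightarrow>
      runs (comp_stmt s n) \<sigma> (N * (p B + 20)) (\<lambda>\<tau>. rel \<Sigma>' \<tau> \<and> keeps n \<sigma> \<tau>)"
    and "bexecs B \<Sigma> ss N \<Sigma>' \<Longrightarrow> (\<Union>s\<in>set ss. exprs s) \<subseteq> Es \<Longrightarrow> rel \<Sigma> \<sigma> \<Longrightarrow>
      runs (comp_stmts ss n) \<sigma> (N * (p B + 20)) (\<lambda>\<tau>. rel \<Sigma>' \<tau> \<and> keeps n \<sigma> \<tau>)"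
    and "bloop B x s j i \<Sigma> N \<Sigma>' \<Longrightarrow> exprs s \<subseteq> Es \<Longrightarrow> rel \<Sigma> \<sigma> \<Longrightarrow> 0 \<le> j \<Longrightarrow> i = size_int a \<Longrightarrow>
      \<sigma> (tmp n) = \<bar>a\<bar> \<Longrightarrow> \<sigma> (tmp (n+1)) = 2 ^ nat j \<Longrightarrow> \<sigma> (tmp (n+2)) = j \<Longrightarrow>
      runs (While (-1, [(tmp (n+1), 1), (tmp n, -1)])
         (Seq (Asn (vreg x) (0, [(tmp (n+2), 1)])) (Seq (comp_stmt s (n+3))
            (Seq (Asn (tmp (n+1)) (0, [(tmp (n+1), 2)])) (Asn (tmp (n+2)) (1, [(tmp (n+2), 1)])))))) \<sigma>
        (N * (p B + 20)) (\<lambda>\<tau>. rel \<Sigma>' \<tau> \<and> keeps n \<sigma> \<tau>)"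
proof (induction arbitrary: \<sigma> n and \<sigma> n and \<sigma> n a rule: bexec_bexecs_bloop.inducts)
  case (BDeclI \<Sigma> t x)
  then show ?case by (auto intro!: runs_Asn rel_upd keeps_upd simp: lval_def simp del: fun_upd_apply)
next
  case (BDeclB \<Sigma> t x)
  then show ?case by (auto intro!: runs_Asn rel_upd keeps_upd simp: lval_def simp del: fun_upd_apply)
next
  case (BAssign \<Sigma> e v x)
  then have "runs (comp_expr e n) \<sigma> (p B) (\<lambda>\<tau>. \<tau> (tmp n) = code_val v \<and> same n \<sigma> \<tau>)"
    using p[of e] unfolding expr_cost_def by auto
  then have "runs (comp_expr e n) \<sigma> (p B) (\<lambda>\<tau>. runs (Asn (vreg x) (0, [(tmp n, 1)])) \<tau> 1
     (\<lambda>\<tau>. rel (\<Sigma>(x \<mapsto> v)) \<tau> \<and> keeps n \<sigma> \<tau>))"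
    by (rule runs_mono)
      (use BAssign.prems in \<open>auto intro!: runs_Asn rel_upd keeps_upd simp: lval_def keeps_same rel_same\<close>)
  from runs_Seq[OF this] show ?case by (auto elim: runs_mono simp del: fun_upd_apply)
next
  case (BBlock \<Sigma> ss N \<Sigma>')
  then show ?case by auto
next
  case (BIfT \<Sigma> e s1 N \<Sigma>' s2)
  then have "runs (comp_expr e n) \<sigma> (p B) (\<lambda>\<tau>. \<tau> (tmp n) = 1 \<and> same n \<sigma> \<tau>)"
    using p[of e] unfolding expr_cost_def by fastforce
  then have "runs (comp_expr e n) \<sigma> (p B) (\<lambda>\<tau>. runs (Cond (0, [(tmp n, -1)]) (comp_stmt s1 n) (comp_stmt s2 n)) \<tau>
     (Suc (max (N * (p B + 20)) 0)) (\<lambda>\<tau>. rel \<Sigma>' \<tau> \<and> keeps n \<sigma> \<tau>))"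
  proof (rule runs_mono[OF _ order_refl])
    fix \<tau> assume \<tau>: "\<tau> (tmp n) = 1 \<and> same n \<sigma> \<tau>"
    have "runs (comp_stmt s1 n) \<tau> (N * (p B + 20)) (\<lambda>\<rho>. rel \<Sigma>' \<rho> \<and> keeps n \<tau> \<rho>)"
      using BIfT.IH BIfT.prems \<tau> rel_same by auto
    then have "runs (comp_stmt s1 n) \<tau> (N * (p B + 20)) (\<lambda>\<rho>. rel \<Sigma>' \<rho> \<and> keeps n \<sigma> \<rho>)"
      by (rule runs_mono) (use \<tau> keeps_same keeps_trans in blast)+
    then show "runs (Cond (0, [(tmp n, -1)]) (comp_stmt s1 n) (comp_stmt s2 n)) \<tau>
       (Suc (max (N * (p B + 20)) 0)) (\<lambda>\<tau>. rel \<Sigma>' \<tau> \<and> keeps n \<sigma> \<tau>)"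
      using \<tau> by (intro runs_Cond) (auto simp: lval_def)
  qed
  from runs_Seq[OF this] show ?case by (auto elim: runs_mono)
next
  case (BIfF \<Sigma> e s2 N \<Sigma>' s1)
  then have "runs (comp_expr e n) \<sigma> (p B) (\<lambda>\<tau>. \<tau> (tmp n) = 0 \<and> same n \<sigma> \<tau>)"
    using p[of e] unfolding expr_cost_def by fastforce
  then have "runs (comp_expr e n) \<sigma> (p B) (\<lambda>\<tau>. runs (Cond (0, [(tmp n, -1)]) (comp_stmt s1 n) (comp_stmt s2 n)) \<tau>
     (Suc (max 0 (N * (p B + 20)))) (\<lambda>\<tau>. rel \<Sigma>' \<tau> \<and> keeps n \<sigma> \<tau>))"
  proof (rule runs_mono[OF _ order_refl])
    fix \<tau> assume \<tau>: "\<tau> (tmp n) = 0 \<and> same n \<sigma> \<tau>"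
    have "runs (comp_stmt s2 n) \<tau> (N * (p B + 20)) (\<lambda>\<rho>. rel \<Sigma>' \<rho> \<and> keeps n \<tau> \<rho>)"
      using BIfF.IH BIfF.prems \<tau> rel_same by auto
    then have "runs (comp_stmt s2 n) \<tau> (N * (p B + 20)) (\<lambda>\<rho>. rel \<Sigma>' \<rho> \<and> keeps n \<sigma> \<rho>)"
      by (rule runs_mono) (use \<tau> keeps_same keeps_trans in blast)+
    then show "runs (Cond (0, [(tmp n, -1)]) (comp_stmt s1 n) (comp_stmt s2 n)) \<tau>
       (Suc (max 0 (N * (p B + 20)))) (\<lambda>\<tau>. rel \<Sigma>' \<tau> \<and> keeps n \<sigma> \<tau>)"
      using \<tau> by (intro runs_Cond) (auto simp: lval_def)
  qed
  from runs_Seq[OF this] show ?case by (auto elim: runs_mono)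
next
  case (BFor \<Sigma> e v x s N \<Sigma>')
  let ?W = "While (-1, [(tmp (n+1), 1), (tmp n, -1)])
         (Seq (Asn (vreg x) (0, [(tmp (n+2), 1)])) (Seq (comp_stmt s (n+3))
            (Seq (Asn (tmp (n+1)) (0, [(tmp (n+1), 2)])) (Asn (tmp (n+2)) (1, [(tmp (n+2), 1)])))))"
  from BFor have "runs (comp_expr e n) \<sigma> (p B) (\<lambda>\<tau>. \<tau> (tmp n) = v \<and> same n \<sigma> \<tau>)"
    using p[of e] unfolding expr_cost_def by fastforce
  then have "runs (comp_expr e n) \<sigma> (p B) (\<lambda>\<tau>.
    runs (Seq (abs_code (tmp n)) (Seq (Asn (tmp (n+1)) (1, [])) (Seq (Asn (tmp (n+2)) (0, [])) ?W))) \<tau>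
      (Suc (2 + Suc (1 + Suc (1 + N * (p B + 20))))) (\<lambda>\<tau>. rel \<Sigma>' \<tau> \<and> keeps n \<sigma> \<tau>))"
  proof (rule runs_mono[OF _ order_refl])
    fix \<tau> assume \<tau>: "\<tau> (tmp n) = v \<and> same n \<sigma> \<tau>"
    define \<tau>1 where "\<tau>1 = \<tau>(tmp n := \<bar>v\<bar>, tmp (n+1) := 1, tmp (n+2) := 0)"
    have r1: "rel \<Sigma> \<tau>1" unfolding \<tau>1_def using BFor.prems \<tau> rel_same by (blast intro: rel_upd_tmp)
    have k1: "keeps n \<sigma> \<tau>1" unfolding \<tau>1_def using \<tau> by (intro keeps_upd_tmp keeps_same) auto
    have "runs ?W \<tau>1 (N * (p B + 20)) (\<lambda>\<tau>. rel \<Sigma>' \<tau> \<and> keeps n \<tau>1 \<tau>)"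
      by (intro BFor.IH(3)[where a = v]; (rule r1 | use BFor.prems in \<open>simp add: \<tau>1_def\<close>))
    then have "runs ?W \<tau>1 (N * (p B + 20)) (\<lambda>\<tau>. rel \<Sigma>' \<tau> \<and> keeps n \<sigma> \<tau>)"
      by (rule runs_mono) (use k1 keeps_trans in blast)+
    then show "runs (Seq (abs_code (tmp n)) (Seq (Asn (tmp (n+1)) (1, [])) (Seq (Asn (tmp (n+2)) (0, [])) ?W))) \<tau>
      (Suc (2 + Suc (1 + Suc (1 + N * (p B + 20))))) (\<lambda>\<tau>. rel \<Sigma>' \<tau> \<and> keeps n \<sigma> \<tau>)"
      using \<tau> by (intro runs_Seq runs_abs runs_Asn) (simp_all add: \<tau>1_def lval_def)
  qed
  from runs_Seq[OF this] show ?case by (auto elim: runs_mono)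
next
  case (BNil \<Sigma>)
  then show ?case by (auto intro!: runs_skip)
next
  case (BCons \<Sigma> s N1 \<Sigma>1 ss N2 \<Sigma>')
  have "runs (comp_stmt s n) \<sigma> (N1 * (p B + 20)) (\<lambda>\<tau>. rel \<Sigma>1 \<tau> \<and> keeps n \<sigma> \<tau>)"
    using BCons.IH(2) BCons.prems by auto
  then have "runs (comp_stmt s n) \<sigma> (N1 * (p B + 20)) (\<lambda>\<tau>. runs (comp_stmts ss n) \<tau> (N2 * (p B + 20))
     (\<lambda>\<tau>. rel \<Sigma>' \<tau> \<and> keeps n \<sigma> \<tau>))"
  proof (rule runs_mono[OF _ order_refl])
    fix \<tau> assume \<tau>: "rel \<Sigma>1 \<tau> \<and> keeps n \<sigma> \<tau>"
    then have "runs (comp_stmts ss n) \<tau> (N2 * (p B + 20)) (\<lambda>\<rho>. rel \<Sigma>' \<rho> \<and> keeps n \<tau> \<rho>)"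
      using BCons.IH(4) BCons.prems by auto
    then show "runs (comp_stmts ss n) \<tau> (N2 * (p B + 20)) (\<lambda>\<rho>. rel \<Sigma>' \<rho> \<and> keeps n \<sigma> \<rho>)"
      by (rule runs_mono) (use \<tau> keeps_trans in blast)+
  qed
  from runs_Seq[OF this] show ?case by (auto elim!: runs_mono simp: distrib_right)
next
  case (BStop i j x s \<Sigma>)
  \<comment> \<open>The counted loop of the semantics and the doubling test of the code stop at the
    same \<open>j\<close>.\<close>
  have "\<not> 2 ^ nat j \<le> \<bar>a\<bar>" using less_size_iff[of "nat j" a] BStop by simp
  then show ?case using BStop.prems
    by (intro runs_mono[OF runs_WhileF]) (auto simp: lval_def)
next
  case (BStep j i \<Sigma> x s N1 \<Sigma>1 N2 \<Sigma>')
  let ?l = "(-1, [(tmp (n+1), 1), (tmp n, -1)])"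
  let ?inc = "Seq (Asn (tmp (n+1)) (0, [(tmp (n+1), 2)])) (Asn (tmp (n+2)) (1, [(tmp (n+2), 1)]))"
  let ?W = "While ?l (Seq (Asn (vreg x) (0, [(tmp (n+2), 1)])) (Seq (comp_stmt s (n+3)) ?inc))"
  let ?Q = "\<lambda>\<tau>. rel \<Sigma>' \<tau> \<and> keeps n \<sigma> \<tau>"
  have le: "2 ^ nat j \<le> \<bar>a\<bar>" using less_size_iff[of "nat j" a] BStep.hyps BStep.prems by simp
  then have c: "lval ?l \<sigma> < 0" using BStep.prems by (simp add: lval_def)
  define \<sigma>1 where "\<sigma>1 = \<sigma>(vreg x := j)"
  have "rel (\<Sigma>(x \<mapsto> VInt j)) \<sigma>1" unfolding \<sigma>1_def using BStep.prems by (intro rel_upd) auto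
  then have "runs (comp_stmt s (n+3)) \<sigma>1 (N1 * (p B + 20)) (\<lambda>\<tau>. rel \<Sigma>1 \<tau> \<and> keeps (n+3) \<sigma>1 \<tau>)"
    using BStep.IH(2)[of \<sigma>1 "n + 3"] BStep.prems(1) by (simp del: fun_upd_apply)
  then have "runs (comp_stmt s (n+3)) \<sigma>1 (N1 * (p B + 20)) (\<lambda>\<tau>. runs ?inc \<tau> (Suc (1 + 1)) (\<lambda>\<tau>. runs ?W \<tau> (N2 * (p B + 20)) ?Q))"
  proof (rule runs_mono[OF _ order_refl])
    fix \<tau> assume \<tau>: "rel \<Sigma>1 \<tau> \<and> keeps (n+3) \<sigma>1 \<tau>"
    then have t: "\<tau> (tmp n) = \<bar>a\<bar>" "\<tau> (tmp (Suc n)) = 2 ^ nat j" "\<tau> (tmp (Suc (Suc n))) = j"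
      using BStep.prems by (auto simp: keeps_def \<sigma>1_def)
    define \<tau>1 where "\<tau>1 = \<tau>(tmp (n+1) := 2 ^ nat (j + 1), tmp (n+2) := j + 1)"
    have r1: "rel \<Sigma>1 \<tau>1" unfolding \<tau>1_def using \<tau> by (intro rel_upd_tmp) auto
    have "keeps n \<sigma> \<sigma>1" unfolding \<sigma>1_def by (intro keeps_upd) simp
    then have "keeps n \<sigma> \<tau>" using \<tau> keeps_le[of "n+3" \<sigma>1 \<tau> n] keeps_trans by auto
    then have k1: "keeps n \<sigma> \<tau>1" unfolding \<tau>1_def by (intro keeps_upd_tmp) auto
    have "runs ?W \<tau>1 (N2 * (p B + 20)) (\<lambda>\<tau>. rel \<Sigma>' \<tau> \<and> keeps n \<tau>1 \<tau>)"
      by (intro BStep.IH(4)[where a = a]; (rule r1 | use BStep.prems t in \<open>simp add: \<tau>1_def\<close>))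
    then have "runs ?W \<tau>1 (N2 * (p B + 20)) ?Q"
      by (rule runs_mono) (use k1 keeps_trans in blast)+
    then show "runs ?inc \<tau> (Suc (1 + 1)) (\<lambda>\<tau>. runs ?W \<tau> (N2 * (p B + 20)) ?Q)"
      using t BStep.prems(3)
      by (intro runs_Seq runs_Asn) (simp_all add: \<tau>1_def lval_def nat_add_distrib add.commute)
  qed
  from runs_Seq[OF this] have "runs (Seq (comp_stmt s (n+3)) ?inc) \<sigma>1 (Suc (N1 * (p B + 20) + Suc (1 + 1)))
     (\<lambda>\<tau>. runs ?W \<tau> (N2 * (p B + 20)) ?Q)" .
  then have "runs (Seq (Asn (vreg x) (0, [(tmp (n+2), 1)])) (Seq (comp_stmt s (n+3)) ?inc)) \<sigma>
     (Suc (1 + Suc (N1 * (p B + 20) + Suc (1 + 1)))) (\<lambda>\<tau>. runs ?W \<tau> (N2 * (p B + 20)) ?Q)"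
    using BStep.prems by (intro runs_Seq[where ?c1.0 = "Asn (vreg x) _"] runs_Asn) (simp_all add: \<sigma>1_def lval_def)
  from runs_WhileT[OF c this] show ?case by (auto elim!: runs_mono simp: distrib_right)
qed

subsection \<open>Typing bounds the cost\<close>

text \<open>Restricting the store makes this an instance of \<open>bounded\<close>, so that
  \<open>eval_bound\<close> applies to \<open>iint\<close> expressions with \<open>b\<close> in
  place of the overall width.\<close>

definition iints_bounded :: "tyenv \<Rightarrow> nat \<Rightarrow> store \<Rightarrow> bool" where
  "iints_bounded \<Gamma> b \<Sigma> \<longleftrightarrow> bounded b (\<Sigma> |` {x. \<Gamma> x = Some TIInt})"

lemma ty_sup_iint: "ty_sup t1 t2 = TIInt \<longleftrightarrow> t1 = TIInt \<and> t2 = TIInt"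
  by (simp add: ty_sup_def)

lemma op_ty_iint: "op_ty f ts = Some TIInt \<Longrightarrow> set ts \<subseteq> {TIInt}"
  by (cases f) (auto simp: op_ty_def arith_ty_def cmp_ty_def bool2_ty_def ty_sup_iint
      split: list.splits if_splits)

text \<open>An operator yields \<open>iint\<close> only from \<open>iint\<close> arguments, so an
  \<open>iint\<close> expression reads only \<open>iint\<close> variables. This makes loop bounds
  depend on \<open>b\<close> rather than on the width of the whole store.\<close>

lemma eval_restrict_iints:
  "has_ty \<Gamma> l e t \<Longrightarrow> t = TIInt \<Longrightarrow> eval \<Sigma> e v \<Longrightarrow> eval (\<Sigma> |` {x. \<Gamma> x = Some TIInt}) e v"
proof (induction arbitrary: v rule: has_ty.induct)
  case (TVar \<Gamma> x t l)
  then show ?case by (auto elim!: eval_VarE intro!: eval.EVar)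
next
  case (TOp \<Gamma> l es ts f t)
  from TOp.prems(2) obtain vs where vs: "list_all2 (eval \<Sigma>) es vs" "op_sem f vs = Some v"
    by (auto elim: eval_OpE)
  have ts: "set ts \<subseteq> {TIInt}" using op_ty_iint TOp by blast
  have "list_all2 (eval (\<Sigma> |` {x. \<Gamma> x = Some TIInt})) es vs"
    unfolding list_all2_conv_all_nth
  proof (intro conjI allI impI)
    show "length es = length vs" using vs(1) by (rule list_all2_lengthD)
    fix i assume i: "i < length es"
    then have "ts ! i \<in> set ts" using TOp.IH by (simp add: list_all2_conv_all_nth)
    then have "ts ! i = TIInt" using ts by auto
    moreover have "eval \<Sigma> (es ! i) (vs ! i)" using vs(1) i by (simp add: list_all2_conv_all_nth)
    ultimately show "eval (\<Sigma> |` {x. \<Gamma> x = Some TIInt}) (es ! i) (vs ! i)"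
      using TOp.IH i by (auto simp: list_all2_conv_all_nth)
  qed
  then show ?case using vs(2) by (rule eval.EOp)
qed (auto elim!: eval_NumE eval_ParenE intro: eval.intros)

lemma iint_expr_bound:
  assumes "has_ty \<Gamma> l e TIInt" "eval \<Sigma> e v" "iints_bounded \<Gamma> b \<Sigma>"
  shows "\<bar>code_val v\<bar> < 2 ^ (b + expr_size e)"
  using eval_bound[OF eval_restrict_iints[OF assms(1) refl assms(2)]] assms(3)
  by (simp add: iints_bounded_def)

inductive_cases has_ty_OpE: "has_ty \<Gamma> l (Op f es) t"

lemma has_ty_size_arg: "has_ty \<Gamma> l (Op OSize [e]) t \<Longrightarrow> has_ty \<Gamma> l e TIInt"
  by (auto elim!: has_ty_OpE simp: op_ty_def list_all2_Cons1 split: if_splits list.splits)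

inductive_cases exec_DeclE: "exec \<Sigma> (Decl t x) \<Sigma>'"
inductive_cases exec_AssignE: "exec \<Sigma> (Assign x e) \<Sigma>'"
inductive_cases exec_BlockE: "exec \<Sigma> (Block ss) \<Sigma>'"
inductive_cases exec_IfE: "exec \<Sigma> (If e s1 s2) \<Sigma>'"
inductive_cases exec_ForE: "exec \<Sigma> (For x e s) \<Sigma>'"
inductive_cases execs_NilE: "execs \<Sigma> [] \<Sigma>'"
inductive_cases execs_ConsE: "execs \<Sigma> (s # ss) \<Sigma>'"
inductive_cases loopE: "loop x s j i \<Sigma> \<Sigma>'"

lemma exec_For_cases:
  assumes "exec \<Sigma> (For x e s) \<Sigma>'"
  obtains v where "eval \<Sigma> e (VInt v)" "loop x s 0 (size_int v) \<Sigma> \<Sigma>'"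
  using assms
  by (auto elim!: exec_ForE eval_OpE simp: list_all2_Cons1 op_sem_def args_Some)

text \<open>Inside loops growth and cost depend only on the bit length \<open>b\<close> of the \<open>iint\<close> variables, and growth
  is additive; this is what survives iteration.\<close>

definition loop_bd :: "tyenv \<Rightarrow> (nat \<Rightarrow> store \<Rightarrow> nat \<Rightarrow> store \<Rightarrow> bool) \<Rightarrow> (store \<Rightarrow> store \<Rightarrow> bool) \<Rightarrow> bool" where
  "loop_bd \<Gamma> bex ex \<longleftrightarrow> (\<exists>g. mono g \<and> poly_bd g \<and> (\<forall>\<Sigma> \<Sigma>' b B B2. ex \<Sigma> \<Sigma>' \<longrightarrow> iints_bounded \<Gamma> b \<Sigma> \<longrightarrow>
     bounded B \<Sigma> \<longrightarrow> B + g b \<le> B2 \<longrightarrow> (\<exists>N \<le> g b. bex B2 \<Sigma> N \<Sigma>') \<and> bounded (B + g b) \<Sigma>' \<and>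
     (\<forall>x. \<Gamma> x = Some TIInt \<longrightarrow> \<Sigma>' x = \<Sigma> x)))"

text \<open>Outside loops \<open>iint\<close> variables may be assigned, so only the overall width
  \<open>B\<close> is tracked, and growth may be any polynomial in it. As in \<open>loop_bd\<close>,
  leaving \<open>B2\<close> free lets all parts of a statement be measured at one common
  width.\<close>

definition top_bd :: "(nat \<Rightarrow> store \<Rightarrow> nat \<Rightarrow> store \<Rightarrow> bool) \<Rightarrow> (store \<Rightarrow> store \<Rightarrow> bool) \<Rightarrow> bool" where
  "top_bd bex ex \<longleftrightarrow> (\<exists>g. mono g \<and> poly_bd g \<and> (\<forall>\<Sigma> \<Sigma>' B B2. ex \<Sigma> \<Sigma>' \<longrightarrow>
     bounded B \<Sigma> \<longrightarrow> g B \<le> B2 \<longrightarrow> (\<exists>N \<le> g B. bex B2 \<Sigma> N \<Sigma>') \<and> bounded (g B) \<Sigma>'))"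

lemma loop_bdE:
  assumes "loop_bd \<Gamma> bex ex"
  obtains g where "mono g" "poly_bd g" "\<And>\<Sigma> \<Sigma>' b B B2. ex \<Sigma> \<Sigma>' \<Longrightarrow> iints_bounded \<Gamma> b \<Sigma> \<Longrightarrow>
     bounded B \<Sigma> \<Longrightarrow> B + g b \<le> B2 \<Longrightarrow> (\<exists>N \<le> g b. bex B2 \<Sigma> N \<Sigma>') \<and> bounded (B + g b) \<Sigma>' \<and>
     (\<forall>x. \<Gamma> x = Some TIInt \<longrightarrow> \<Sigma>' x = \<Sigma> x)"
  using assms unfolding loop_bd_def by blast

lemma top_bdE:
  assumes "top_bd bex ex"
  obtains g where "mono g" "poly_bd g" "\<And>\<Sigma> \<Sigma>' B B2. ex \<Sigma> \<Sigma>' \<Longrightarrow> bounded B \<Sigma> \<Longrightarrow> g B \<le> B2 \<Longrightarrow>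
     (\<exists>N \<le> g B. bex B2 \<Sigma> N \<Sigma>') \<and> bounded (g B) \<Sigma>'"
  using assms unfolding top_bd_def by blast

section \<open>Growth and cost inside loops\<close>

lemma iints_bounded_cong:
  assumes "iints_bounded \<Gamma> b \<Sigma>" "\<And>x. \<Gamma>' x = Some TIInt \<Longrightarrow> \<Gamma> x = Some TIInt \<and> \<Sigma>' x = \<Sigma> x"
  shows "iints_bounded \<Gamma>' b \<Sigma>'"
  using assms unfolding iints_bounded_def bounded_def
  by (auto simp: restrict_map_def split: if_splits)

lemma bounded_iints: "bounded b \<Sigma> \<Longrightarrow> iints_bounded \<Gamma> b \<Sigma>"
  unfolding iints_bounded_def bounded_def by (auto simp: restrict_map_def split: if_splits)

text \<open>No \<open>iint\<close> variable can be declared in a loop, so the set of variables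
  measured by \<open>b\<close> does not grow along a sequence.\<close>

lemma stmt_ty_loop_iints: "stmt_ty \<Gamma> l s \<Gamma>' \<Longrightarrow> l \<Longrightarrow> \<Gamma>' x = Some TIInt \<Longrightarrow> \<Gamma> x = Some TIInt"
  by (erule stmt_ty.cases) (auto split: if_splits)

text \<open>The \<open>iint\<close> variables stay as they are and the loop variable stays below
  \<open>b\<close>, so the same \<open>G\<close> serves for every iteration and the increments
  merely add up: \<open>b\<close> bits for the loop variable and \<open>G\<close> for the body,
  \<open>d\<close> times.\<close>

lemma loop_bexec:
  assumes g: "\<And>\<Sigma> \<Sigma>' B B2. exec \<Sigma> s \<Sigma>' \<Longrightarrow> iints_bounded (\<Gamma>(x \<mapsto> TIInt)) b \<Sigma> \<Longrightarrow>
     bounded B \<Sigma> \<Longrightarrow> B + G \<le> B2 \<Longrightarrow> (\<exists>N \<le> G. bexec B2 \<Sigma> s N \<Sigma>') \<and> bounded (B + G) \<Sigma>' \<and>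
     (\<forall>y. (\<Gamma>(x \<mapsto> TIInt)) y = Some TIInt \<longrightarrow> \<Sigma>' y = \<Sigma> y)"
    and x: "\<Gamma> x = None" and i: "i \<le> int b"
  shows "loop x s j i \<Sigma> \<Sigma>' \<Longrightarrow> 0 \<le> j \<Longrightarrow> d = nat (i - j) \<Longrightarrow> iints_bounded \<Gamma> b \<Sigma> \<Longrightarrow> bounded B \<Sigma> \<Longrightarrow>
     B + d * (b + G) \<le> B2 \<Longrightarrow>
     (\<exists>N \<le> d * Suc G + 1. bloop B2 x s j i \<Sigma> N \<Sigma>') \<and> bounded (B + d * (b + G)) \<Sigma>' \<and>
     (\<forall>y. \<Gamma> y = Some TIInt \<longrightarrow> \<Sigma>' y = \<Sigma> y)"
proof (induction d arbitrary: j \<Sigma> B)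
  case 0
  then have "i \<le> j" by simp
  then have "\<Sigma>' = \<Sigma>" using 0(1) by (auto elim: loopE)
  then show ?case using 0 \<open>i \<le> j\<close> BStop[of i j B2 x s \<Sigma>] by auto
next
  case (Suc d)
  then have ji: "j < i" by simp
  with Suc.prems(1) obtain \<Sigma>1 where e: "exec (\<Sigma>(x \<mapsto> VInt j)) s \<Sigma>1" and l: "loop x s (j + 1) i \<Sigma>1 \<Sigma>'"
    by (auto elim: loopE)
  \<comment> \<open>A loop variable is less than the iteration count, hence below
    \<open>2 ^ b\<close>; it joins the \<open>iint\<close> variables without raising
    \<open>b\<close>.\<close>
  have "\<bar>j\<bar> < int b" using ji i Suc.prems(2) by simp
  also have "int b < 2 ^ b" by (metis less_exp of_nat_less_iff of_nat_numeral of_nat_power)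
  finally have jb: "\<bar>j\<bar> < 2 ^ b" .
  have ib: "iints_bounded (\<Gamma>(x \<mapsto> TIInt)) b (\<Sigma>(x \<mapsto> VInt j))"
    using Suc.prems(4) jb unfolding iints_bounded_def bounded_def
    by (auto simp: restrict_map_def split: if_splits)
  have "(2::int) ^ b \<le> 2 ^ (B + b)" by (intro power_increasing) auto
  then have bb: "bounded (B + b) (\<Sigma>(x \<mapsto> VInt j))"
    using jb bounded_mono[OF Suc.prems(5), of "B + b"] by (intro bounded_upd) (simp, simp only: code_val.simps)
  have le1: "B + b + G \<le> B2" using Suc.prems(6) by simp
  obtain N1 where N1: "N1 \<le> G" "bexec B2 (\<Sigma>(x \<mapsto> VInt j)) s N1 \<Sigma>1" and b1: "bounded (B + b + G) \<Sigma>1"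
    and p1: "\<And>y. (\<Gamma>(x \<mapsto> TIInt)) y = Some TIInt \<Longrightarrow> \<Sigma>1 y = (\<Sigma>(x \<mapsto> VInt j)) y"
    using g[OF e ib bb le1] by blast
  have p1': "\<Sigma>1 y = \<Sigma> y" if "\<Gamma> y = Some TIInt" for y using p1[of y] that x by auto
  have ib1: "iints_bounded \<Gamma> b \<Sigma>1" by (rule iints_bounded_cong[OF Suc.prems(4)]) (simp add: p1')
  have d: "d = nat (i - (j + 1))" using Suc.prems(3) by simp
  have "B + b + G + d * (b + G) \<le> B2" using Suc.prems(6) by simp
  from Suc.IH[OF l _ d ib1 b1 this] Suc.prems(2) obtain N2 where
    N2: "N2 \<le> d * Suc G + 1" "bloop B2 x s (j + 1) i \<Sigma>1 N2 \<Sigma>'"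
    and b2: "bounded (B + b + G + d * (b + G)) \<Sigma>'" and p2: "\<And>y. \<Gamma> y = Some TIInt \<Longrightarrow> \<Sigma>' y = \<Sigma>1 y"
    by auto
  have "bloop B2 x s j i \<Sigma> (Suc (N1 + N2)) \<Sigma>'" using BStep[OF ji N1(2) N2(2)] .
  moreover have "Suc (N1 + N2) \<le> Suc d * Suc G + 1" using N1(1) N2(1) by simp
  moreover have "B + b + G + d * (b + G) = B + Suc d * (b + G)" by simp
  ultimately show ?case using b2 p1' p2 by metis
qed

text \<open>The indicator \<open>l\<close> is arbitrary, as the body is always typed as inside a
  loop; so the bound serves loops at top level as well. The bound expression is \<open>iint\<close>
  and adds at most \<open>k\<close> bits to \<open>b\<close>, which limits the iterations to
  \<open>b + k\<close>.\<close>

lemma for_bexec: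
  assumes lb: "loop_bd (\<Gamma>(x \<mapsto> TIInt)) (\<lambda>B \<Sigma>. bexec B \<Sigma> s) (\<lambda>\<Sigma>. exec \<Sigma> s)"
    and ty: "has_ty \<Gamma> l (Op OSize [e]) TIInt" and x: "x \<notin> dom \<Gamma>"
  shows "loop_bd \<Gamma> (\<lambda>B \<Sigma>. bexec B \<Sigma> (For x e s)) (\<lambda>\<Sigma>. exec \<Sigma> (For x e s))"
proof -
  from lb obtain g where mg: "mono g" and pg: "poly_bd g"
    and g: "\<And>\<Sigma> \<Sigma>' b B B2. exec \<Sigma> s \<Sigma>' \<Longrightarrow> iints_bounded (\<Gamma>(x \<mapsto> TIInt)) b \<Sigma> \<Longrightarrow>
     bounded B \<Sigma> \<Longrightarrow> B + g b \<le> B2 \<Longrightarrow> (\<exists>N \<le> g b. bexec B2 \<Sigma> s N \<Sigma>') \<and> bounded (B + g b) \<Sigma>' \<and>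
     (\<forall>y. (\<Gamma>(x \<mapsto> TIInt)) y = Some TIInt \<longrightarrow> \<Sigma>' y = \<Sigma> y)"
    unfolding loop_bd_def by blast
  define k where "k = expr_size e"
  \<comment> \<open>At most \<open>b + k\<close> iterations, each adding \<open>b + k\<close> bits
    for the loop variable and \<open>g (b + k)\<close> for the body; the same expression covers the
    number of steps, with 2 for the final test and the loop itself.\<close>
  define h where "h b = (b + k) * ((b + k) + g (b + k) + 1) + 2" for b
  have mh: "mono h" unfolding h_def
    by (intro monoI add_mono mult_le_mono monoD[OF mg]) auto
  have ph: "poly_bd h" unfolding h_def
    by (intro poly_bd_intros poly_bd_comp[OF pg])
  have "(\<exists>N \<le> h b. bexec B2 \<Sigma> (For x e s) N \<Sigma>') \<and> bounded (B + h b) \<Sigma>' \<and>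
     (\<forall>y. \<Gamma> y = Some TIInt \<longrightarrow> \<Sigma>' y = \<Sigma> y)"
    if ex: "exec \<Sigma> (For x e s) \<Sigma>'" and ib: "iints_bounded \<Gamma> b \<Sigma>" and B: "bounded B \<Sigma>" and B2: "B + h b \<le> B2"
    for \<Sigma> \<Sigma>' b B B2
  proof -
    from ex obtain v where v: "eval \<Sigma> e (VInt v)" and lp: "loop x s 0 (size_int v) \<Sigma> \<Sigma>'"
      by (rule exec_For_cases)
    have "\<bar>v\<bar> < 2 ^ (b + k)"
      using iint_expr_bound[OF has_ty_size_arg[OF ty] v ib] by (simp add: k_def)
    then have sz: "blen v \<le> b + k" by (rule blen_le)
    define d where "d = blen v"
    have ib': "iints_bounded \<Gamma> (b + k) \<Sigma>"
      using ib bounded_mono unfolding iints_bounded_def by (meson le_add1)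
    let ?G = "g (b + k)"
    have dle: "d * (b + k + ?G) \<le> h b" "d * Suc ?G + 1 < h b"
    proof -
      have "d * (b + k + ?G) \<le> (b + k) * (b + k + ?G)" "d * Suc ?G \<le> (b + k) * Suc ?G"
        using sz unfolding d_def by (intro mult_le_mono1; simp)+
      then show "d * (b + k + ?G) \<le> h b" "d * Suc ?G + 1 < h b"
        unfolding h_def by (simp_all add: algebra_simps)
    qed
    have "(\<exists>N \<le> d * Suc ?G + 1. bloop B2 x s 0 (size_int v) \<Sigma> N \<Sigma>') \<and> bounded (B + d * (b + k + ?G)) \<Sigma>' \<and>
      (\<forall>y. \<Gamma> y = Some TIInt \<longrightarrow> \<Sigma>' y = \<Sigma> y)"
    proof (rule loop_bexec[where \<Gamma> = \<Gamma> and b = "b + k" and G = ?G, OF g _ _ lp _ _ ib' B])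
      show "\<Gamma> x = None" using x by blast
      show "size_int v \<le> int (b + k)" using sz by (simp only: size_int_blen of_nat_le_iff)
      show "d = nat (size_int v - 0)" by (simp add: d_def size_int_blen)
      show "B + d * (b + k + ?G) \<le> B2" using dle B2 by simp
    qed auto
    then obtain N where N: "N \<le> d * Suc ?G + 1" "bloop B2 x s 0 (size_int v) \<Sigma> N \<Sigma>'"
      and b': "bounded (B + d * (b + k + ?G)) \<Sigma>'" and pr: "\<forall>y. \<Gamma> y = Some TIInt \<longrightarrow> \<Sigma>' y = \<Sigma> y" by blast
    have "bexec B2 \<Sigma> (For x e s) (Suc N) \<Sigma>'"
      using bounded_mono[OF B] B2 v N(2) by (intro BFor) auto
    moreover have "Suc N \<le> h b" using N(1) dle(2) by simp
    moreover have "bounded (B + h b) \<Sigma>'" using bounded_mono[OF b'] dle(1) by simp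
    ultimately show ?thesis using pr by blast
  qed
  then show ?thesis unfolding loop_bd_def using mh ph by blast
qed

lemma stmt_loop_bd:
  "stmt_ty \<Gamma> l s \<Gamma>' \<Longrightarrow> l \<Longrightarrow> loop_bd \<Gamma> (\<lambda>B \<Sigma>. bexec B \<Sigma> s) (\<lambda>\<Sigma>. exec \<Sigma> s)"
  "stmts_ty \<Gamma> l ss \<Gamma>' \<Longrightarrow> l \<Longrightarrow> loop_bd \<Gamma> (\<lambda>B \<Sigma>. bexecs B \<Sigma> ss) (\<lambda>\<Sigma>. execs \<Sigma> ss)"
proof (induction rule: stmt_ty_stmts_ty.inducts)
  case (TDecl x \<Gamma> l t)
  show ?case unfolding loop_bd_def
  proof (intro exI[of _ "\<lambda>b. 1"] conjI allI impI)
    fix \<Sigma> \<Sigma>' b B B2 assume ex: "exec \<Sigma> (Decl t x) \<Sigma>'" and B: "bounded B \<Sigma>"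
    show "\<exists>N\<le>1. bexec B2 \<Sigma> (Decl t x) N \<Sigma>'"
      using ex by (auto elim!: exec_DeclE intro: BDeclI[of B2 \<Sigma> t x, simplified] BDeclB[of B2 \<Sigma> _ x, simplified])
    show "bounded (B + 1) \<Sigma>'"
      using ex bounded_mono[OF B, of "B + 1"] by (auto elim!: exec_DeclE intro!: bounded_upd)
    fix y assume "\<Gamma> y = Some TIInt"
    then have "y \<noteq> x" using TDecl by auto
    then show "\<Sigma>' y = \<Sigma> y" using ex by (auto elim!: exec_DeclE)
  qed (auto simp: mono_def poly_bd_const)
next
  case (TAssign \<Gamma> x tx l e t)
  show ?case unfolding loop_bd_def
  proof (intro exI[of _ "\<lambda>b. expr_size e + 1"] conjI allI impI)
    fix \<Sigma> \<Sigma>' b B B2 assume ex: "exec \<Sigma> (Assign x e) \<Sigma>'" and B: "bounded B \<Sigma>" and B2: "B + (expr_size e + 1) \<le> B2"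
    from ex obtain v where v: "eval \<Sigma> e v" and \<Sigma>': "\<Sigma>' = \<Sigma>(x \<mapsto> v)" by (auto elim: exec_AssignE)
    have "bounded B2 \<Sigma>" using bounded_mono[OF B] B2 by simp
    then show "\<exists>N\<le>expr_size e + 1. bexec B2 \<Sigma> (Assign x e) N \<Sigma>'"
      using BAssign[of B2 \<Sigma> e v x] v \<Sigma>' by (intro exI[of _ 1]) auto
    have "(2::int) ^ (B + expr_size e) \<le> 2 ^ (B + (expr_size e + 1))" by (intro power_increasing) auto
    then show "bounded (B + (expr_size e + 1)) \<Sigma>'"
      unfolding \<Sigma>' using eval_bound[OF v B] by (intro bounded_upd bounded_mono[OF B]) linarith+
    fix y assume "\<Gamma> y = Some TIInt"
    then show "\<Sigma>' y = \<Sigma> y" using \<Sigma>' TAssign by auto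
  qed (auto simp: mono_def poly_bd_const)
next
  case (TBlock \<Gamma> l ss \<Gamma>')
  then have lb: "loop_bd \<Gamma> (\<lambda>B \<Sigma>. bexecs B \<Sigma> ss) (\<lambda>\<Sigma>. execs \<Sigma> ss)" by simp
  from lb obtain g where g: "mono g" "poly_bd g" and G: "\<forall>\<Sigma> \<Sigma>' b B B2. execs \<Sigma> ss \<Sigma>' \<longrightarrow> iints_bounded \<Gamma> b \<Sigma> \<longrightarrow>
     bounded B \<Sigma> \<longrightarrow> B + g b \<le> B2 \<longrightarrow> (\<exists>N \<le> g b. bexecs B2 \<Sigma> ss N \<Sigma>') \<and> bounded (B + g b) \<Sigma>' \<and>
     (\<forall>x. \<Gamma> x = Some TIInt \<longrightarrow> \<Sigma>' x = \<Sigma> x)" unfolding loop_bd_def by (elim exE conjE)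
  show ?case unfolding loop_bd_def
    by (rule exI[of _ g]) (use g G in \<open>blast elim: exec_BlockE intro: BBlock\<close>)
next
  case (TIf \<Gamma> l e s1 \<Gamma>1 s2 \<Gamma>2)
  then have lb: "loop_bd \<Gamma> (\<lambda>B \<Sigma>. bexec B \<Sigma> s1) (\<lambda>\<Sigma>. exec \<Sigma> s1)"
    "loop_bd \<Gamma> (\<lambda>B \<Sigma>. bexec B \<Sigma> s2) (\<lambda>\<Sigma>. exec \<Sigma> s2)" by simp_all
  from lb(1) obtain g1 where g1: "mono g1" "poly_bd g1" and G1: "\<And>\<Sigma> \<Sigma>' b B B2. exec \<Sigma> s1 \<Sigma>' \<Longrightarrow> iints_bounded \<Gamma> b \<Sigma> \<Longrightarrow>
     bounded B \<Sigma> \<Longrightarrow> B + g1 b \<le> B2 \<Longrightarrow> (\<exists>N \<le> g1 b. bexec B2 \<Sigma> s1 N \<Sigma>') \<and> bounded (B + g1 b) \<Sigma>' \<and>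
     (\<forall>x. \<Gamma> x = Some TIInt \<longrightarrow> \<Sigma>' x = \<Sigma> x)" by (rule loop_bdE) blast
  from lb(2) obtain g2 where g2: "mono g2" "poly_bd g2" and G2: "\<And>\<Sigma> \<Sigma>' b B B2. exec \<Sigma> s2 \<Sigma>' \<Longrightarrow> iints_bounded \<Gamma> b \<Sigma> \<Longrightarrow>
     bounded B \<Sigma> \<Longrightarrow> B + g2 b \<le> B2 \<Longrightarrow> (\<exists>N \<le> g2 b. bexec B2 \<Sigma> s2 N \<Sigma>') \<and> bounded (B + g2 b) \<Sigma>' \<and>
     (\<forall>x. \<Gamma> x = Some TIInt \<longrightarrow> \<Sigma>' x = \<Sigma> x)" by (rule loop_bdE) blast
  let ?g = "\<lambda>b. g1 b + g2 b + 1"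
  have "mono ?g" using g1 g2 by (intro monoI add_mono) (auto dest: monoD)
  moreover have "poly_bd ?g" by (intro poly_bd_intros g1 g2)
  moreover have "(\<exists>N \<le> ?g b. bexec B2 \<Sigma> (If e s1 s2) N \<Sigma>') \<and> bounded (B + ?g b) \<Sigma>' \<and>
     (\<forall>x. \<Gamma> x = Some TIInt \<longrightarrow> \<Sigma>' x = \<Sigma> x)"
    if ex: "exec \<Sigma> (If e s1 s2) \<Sigma>'" and ib: "iints_bounded \<Gamma> b \<Sigma>" and B: "bounded B \<Sigma>" and B2: "B + ?g b \<le> B2"
    for \<Sigma> \<Sigma>' b B B2
  proof -
    have bd: "bounded B2 \<Sigma>" using bounded_mono[OF B] B2 by simp
    from ex consider "eval \<Sigma> e (VBool True)" "exec \<Sigma> s1 \<Sigma>'" | "eval \<Sigma> e (VBool False)" "exec \<Sigma> s2 \<Sigma>'"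
      by (auto elim: exec_IfE)
    then show ?thesis
    proof cases
      case 1
      have "B + g1 b \<le> B2" using B2 by simp
      from G1[OF 1(2) ib B this] obtain N where N: "N \<le> g1 b" "bexec B2 \<Sigma> s1 N \<Sigma>'"
        and r: "bounded (B + g1 b) \<Sigma>'" "\<forall>x. \<Gamma> x = Some TIInt \<longrightarrow> \<Sigma>' x = \<Sigma> x" by blast
      have "bexec B2 \<Sigma> (If e s1 s2) (Suc N) \<Sigma>'" using bd 1(1) N(2) by (rule BIfT)
      moreover have "Suc N \<le> ?g b" using N by simp
      ultimately show ?thesis using r bounded_mono[OF r(1), of "B + ?g b"] by auto
    next
      case 2
      have "B + g2 b \<le> B2" using B2 by simp
      from G2[OF 2(2) ib B this] obtain N where N: "N \<le> g2 b" "bexec B2 \<Sigma> s2 N \<Sigma>'"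
        and r: "bounded (B + g2 b) \<Sigma>'" "\<forall>x. \<Gamma> x = Some TIInt \<longrightarrow> \<Sigma>' x = \<Sigma> x" by blast
      have "bexec B2 \<Sigma> (If e s1 s2) (Suc N) \<Sigma>'" using bd 2(1) N(2) by (rule BIfF)
      moreover have "Suc N \<le> ?g b" using N by simp
      ultimately show ?thesis using r bounded_mono[OF r(1), of "B + ?g b"] by auto
    qed
  qed
  ultimately show ?case unfolding loop_bd_def by blast
next
  case (TFor \<Gamma> l e x s \<Gamma>')
  then show ?case by (intro for_bexec) (simp_all del: fun_upd_apply)
next
  case (TNil \<Gamma> l)
  show ?case unfolding loop_bd_def
    by (rule exI[of _ "\<lambda>b. 1"])
      (auto elim!: execs_NilE simp: mono_def poly_bd_const
        intro: BNil[simplified] elim: bounded_mono)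
next
  case (TCons \<Gamma> l s \<Gamma>1 ss \<Gamma>')
  then have lb: "loop_bd \<Gamma> (\<lambda>B \<Sigma>. bexec B \<Sigma> s) (\<lambda>\<Sigma>. exec \<Sigma> s)"
    "loop_bd \<Gamma>1 (\<lambda>B \<Sigma>. bexecs B \<Sigma> ss) (\<lambda>\<Sigma>. execs \<Sigma> ss)" by simp_all
  from lb(1) obtain g1 where g1: "mono g1" "poly_bd g1" and G1: "\<And>\<Sigma> \<Sigma>' b B B2. exec \<Sigma> s \<Sigma>' \<Longrightarrow> iints_bounded \<Gamma> b \<Sigma> \<Longrightarrow>
     bounded B \<Sigma> \<Longrightarrow> B + g1 b \<le> B2 \<Longrightarrow> (\<exists>N \<le> g1 b. bexec B2 \<Sigma> s N \<Sigma>') \<and> bounded (B + g1 b) \<Sigma>' \<and>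
     (\<forall>x. \<Gamma> x = Some TIInt \<longrightarrow> \<Sigma>' x = \<Sigma> x)" by (rule loop_bdE) blast
  from lb(2) obtain g2 where g2: "mono g2" "poly_bd g2" and G2: "\<And>\<Sigma> \<Sigma>' b B B2. execs \<Sigma> ss \<Sigma>' \<Longrightarrow> iints_bounded \<Gamma>1 b \<Sigma> \<Longrightarrow>
     bounded B \<Sigma> \<Longrightarrow> B + g2 b \<le> B2 \<Longrightarrow> (\<exists>N \<le> g2 b. bexecs B2 \<Sigma> ss N \<Sigma>') \<and> bounded (B + g2 b) \<Sigma>' \<and>
     (\<forall>x. \<Gamma>1 x = Some TIInt \<longrightarrow> \<Sigma>' x = \<Sigma> x)" by (rule loop_bdE) blast
  \<comment> \<open>A sum, not a composition: the first statement leaves the \<open>iint\<close>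
    variables alone, so the rest is measured by the same \<open>b\<close>.\<close>
  let ?g = "\<lambda>b. g1 b + g2 b + 1"
  have "mono ?g" using g1 g2 by (intro monoI add_mono) (auto dest: monoD)
  moreover have "poly_bd ?g" by (intro poly_bd_intros g1 g2)
  moreover have "(\<exists>N \<le> ?g b. bexecs B2 \<Sigma> (s # ss) N \<Sigma>') \<and> bounded (B + ?g b) \<Sigma>' \<and>
     (\<forall>x. \<Gamma> x = Some TIInt \<longrightarrow> \<Sigma>' x = \<Sigma> x)"
    if ex: "execs \<Sigma> (s # ss) \<Sigma>'" and ib: "iints_bounded \<Gamma> b \<Sigma>" and B: "bounded B \<Sigma>" and B2: "B + ?g b \<le> B2"
    for \<Sigma> \<Sigma>' b B B2
  proof -
    from ex obtain \<Sigma>1 where e1: "exec \<Sigma> s \<Sigma>1" and e2: "execs \<Sigma>1 ss \<Sigma>'" by (rule execs_ConsE)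
    have "B + g1 b \<le> B2" using B2 by simp
    from G1[OF e1 ib B this] obtain N1 where N1: "N1 \<le> g1 b" "bexec B2 \<Sigma> s N1 \<Sigma>1"
      and b1: "bounded (B + g1 b) \<Sigma>1" and p1: "\<And>x. \<Gamma> x = Some TIInt \<Longrightarrow> \<Sigma>1 x = \<Sigma> x" by blast
    have ib1: "iints_bounded \<Gamma>1 b \<Sigma>1"
      using stmt_ty_loop_iints[OF TCons(1) TCons.prems] p1 by (intro iints_bounded_cong[OF ib]) auto
    have "B + g1 b + g2 b \<le> B2" using B2 by simp
    from G2[OF e2 ib1 b1 this] obtain N2 where N2: "N2 \<le> g2 b" "bexecs B2 \<Sigma>1 ss N2 \<Sigma>'"
      and b2: "bounded (B + g1 b + g2 b) \<Sigma>'" and p2: "\<And>x. \<Gamma>1 x = Some TIInt \<Longrightarrow> \<Sigma>' x = \<Sigma>1 x" by blast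
    have "bexecs B2 \<Sigma> (s # ss) (Suc (N1 + N2)) \<Sigma>'" using N1(2) N2(2) by (rule BCons)
    moreover have "Suc (N1 + N2) \<le> ?g b" using N1 N2 by simp
    moreover have "bounded (B + ?g b) \<Sigma>'" using bounded_mono[OF b2] by simp
    moreover have "\<Sigma>' x = \<Sigma> x" if "\<Gamma> x = Some TIInt" for x
    proof -
      have "\<Gamma>1 x = Some TIInt" using TCons(1) that by (cases rule: stmt_ty.cases) auto
      then show ?thesis using p1 p2 that by simp
    qed
    ultimately show ?thesis by blast
  qed
  ultimately show ?case unfolding loop_bd_def by blast
qed

section \<open>Growth and cost outside loops\<close>

lemma loop_bd_top_bd: "loop_bd \<Gamma> bex ex \<Longrightarrow> top_bd bex ex"
proof -
  assume "loop_bd \<Gamma> bex ex"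
  then obtain g where g: "mono g" "poly_bd g" and G: "\<And>\<Sigma> \<Sigma>' b B B2. ex \<Sigma> \<Sigma>' \<Longrightarrow> iints_bounded \<Gamma> b \<Sigma> \<Longrightarrow>
     bounded B \<Sigma> \<Longrightarrow> B + g b \<le> B2 \<Longrightarrow> (\<exists>N \<le> g b. bex B2 \<Sigma> N \<Sigma>') \<and> bounded (B + g b) \<Sigma>' \<and> (\<forall>x. \<Gamma> x = Some TIInt \<longrightarrow> \<Sigma>' x = \<Sigma> x)"
    by (rule loop_bdE) blast
  have "mono (\<lambda>B. B + g B)" using g(1) by (intro monoI add_mono) (auto dest: monoD)
  moreover have "poly_bd (\<lambda>B. B + g B)" by (intro poly_bd_intros g)
  moreover have "\<forall>\<Sigma> \<Sigma>' B B2. ex \<Sigma> \<Sigma>' \<longrightarrow> bounded B \<Sigma> \<longrightarrow> B + g B \<le> B2 \<longrightarrow>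
    (\<exists>N \<le> B + g B. bex B2 \<Sigma> N \<Sigma>') \<and> bounded (B + g B) \<Sigma>'"
  proof (intro allI impI)
    fix \<Sigma> \<Sigma>' B B2 assume "ex \<Sigma> \<Sigma>'" "bounded B \<Sigma>" "B + g B \<le> B2"
    \<comment> \<open>The overall width also bounds the \<open>iint\<close> variables, so
      \<open>b\<close> may be taken as \<open>B\<close>.\<close>
    then show "(\<exists>N \<le> B + g B. bex B2 \<Sigma> N \<Sigma>') \<and> bounded (B + g B) \<Sigma>'"
      using G[of \<Sigma> \<Sigma>' B B B2] bounded_iints[of B \<Sigma>] by (meson trans_le_add2)
  qed
  ultimately show ?thesis unfolding top_bd_def by blast
qed

lemma stmt_top_bd:
  "stmt_ty \<Gamma> l s \<Gamma>' \<Longrightarrow> \<not> l \<Longrightarrow> top_bd (\<lambda>B \<Sigma>. bexec B \<Sigma> s) (\<lambda>\<Sigma>. exec \<Sigma> s)"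
  "stmts_ty \<Gamma> l ss \<Gamma>' \<Longrightarrow> \<not> l \<Longrightarrow> top_bd (\<lambda>B \<Sigma>. bexecs B \<Sigma> ss) (\<lambda>\<Sigma>. execs \<Sigma> ss)"
proof (induction rule: stmt_ty_stmts_ty.inducts)
  case (TDecl x \<Gamma> l t)
  show ?case unfolding top_bd_def
  proof (intro exI[of _ "\<lambda>b. b + 1"] conjI allI impI)
    fix \<Sigma> \<Sigma>' B B2 assume ex: "exec \<Sigma> (Decl t x) \<Sigma>'" and B: "bounded B \<Sigma>"
    show "\<exists>N\<le>B + 1. bexec B2 \<Sigma> (Decl t x) N \<Sigma>'"
      using ex by (auto elim!: exec_DeclE intro!: exI[of _ 1] BDeclI[of B2 \<Sigma> t x, simplified] BDeclB[of B2 \<Sigma> _ x, simplified])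
    show "bounded (B + 1) \<Sigma>'"
      using ex bounded_mono[OF B, of "B + 1"] by (auto elim!: exec_DeclE intro!: bounded_upd)
  qed ((intro monoI, simp) | (intro poly_bd_intros))+
next
  case (TAssign \<Gamma> x tx l e t)
  show ?case unfolding top_bd_def
  proof (intro exI[of _ "\<lambda>b. b + (expr_size e + 1)"] conjI allI impI)
    fix \<Sigma> \<Sigma>' B B2 assume ex: "exec \<Sigma> (Assign x e) \<Sigma>'" and B: "bounded B \<Sigma>" and B2: "B + (expr_size e + 1) \<le> B2"
    from ex obtain v where v: "eval \<Sigma> e v" and \<Sigma>': "\<Sigma>' = \<Sigma>(x \<mapsto> v)" by (auto elim: exec_AssignE)
    have "bounded B2 \<Sigma>" using bounded_mono[OF B] B2 by simp
    then show "\<exists>N\<le>B + (expr_size e + 1). bexec B2 \<Sigma> (Assign x e) N \<Sigma>'"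
      using BAssign[of B2 \<Sigma> e v x] v \<Sigma>' by (intro exI[of _ 1]) auto
    have "(2::int) ^ (B + expr_size e) \<le> 2 ^ (B + (expr_size e + 1))" by (intro power_increasing) auto
    then show "bounded (B + (expr_size e + 1)) \<Sigma>'"
      unfolding \<Sigma>' using eval_bound[OF v B] by (intro bounded_upd bounded_mono[OF B]) linarith+
  qed ((intro monoI, simp) | (intro poly_bd_intros))+
next
  case (TBlock \<Gamma> l ss \<Gamma>')
  then have lb: "top_bd (\<lambda>B \<Sigma>. bexecs B \<Sigma> ss) (\<lambda>\<Sigma>. execs \<Sigma> ss)" by simp
  from lb obtain g where g: "mono g" "poly_bd g" and G: "\<forall>\<Sigma> \<Sigma>' B B2. execs \<Sigma> ss \<Sigma>' \<longrightarrow>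
     bounded B \<Sigma> \<longrightarrow> g B \<le> B2 \<longrightarrow> (\<exists>N \<le> g B. bexecs B2 \<Sigma> ss N \<Sigma>') \<and> bounded (g B) \<Sigma>'"
    unfolding top_bd_def by (elim exE conjE)
  show ?case unfolding top_bd_def
    by (rule exI[of _ g]) (use g G in \<open>blast elim: exec_BlockE intro: BBlock\<close>)
next
  case (TIf \<Gamma> l e s1 \<Gamma>1 s2 \<Gamma>2)
  then have lb: "top_bd (\<lambda>B \<Sigma>. bexec B \<Sigma> s1) (\<lambda>\<Sigma>. exec \<Sigma> s1)"
    "top_bd (\<lambda>B \<Sigma>. bexec B \<Sigma> s2) (\<lambda>\<Sigma>. exec \<Sigma> s2)" by simp_all
  from lb(1) obtain g1 where g1: "mono g1" "poly_bd g1" and G1: "\<And>\<Sigma> \<Sigma>' B B2. exec \<Sigma> s1 \<Sigma>' \<Longrightarrow>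
     bounded B \<Sigma> \<Longrightarrow> g1 B \<le> B2 \<Longrightarrow> (\<exists>N \<le> g1 B. bexec B2 \<Sigma> s1 N \<Sigma>') \<and> bounded (g1 B) \<Sigma>'"
    by (rule top_bdE) blast
  from lb(2) obtain g2 where g2: "mono g2" "poly_bd g2" and G2: "\<And>\<Sigma> \<Sigma>' B B2. exec \<Sigma> s2 \<Sigma>' \<Longrightarrow>
     bounded B \<Sigma> \<Longrightarrow> g2 B \<le> B2 \<Longrightarrow> (\<exists>N \<le> g2 B. bexec B2 \<Sigma> s2 N \<Sigma>') \<and> bounded (g2 B) \<Sigma>'"
    by (rule top_bdE) blast
  let ?g = "\<lambda>B. B + g1 B + g2 B + 1"
  have "mono ?g" using g1 g2 by (intro monoI add_mono) (auto dest: monoD)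
  moreover have "poly_bd ?g" by (intro poly_bd_intros g1 g2)
  moreover have "(\<exists>N \<le> ?g B. bexec B2 \<Sigma> (If e s1 s2) N \<Sigma>') \<and> bounded (?g B) \<Sigma>'"
    if ex: "exec \<Sigma> (If e s1 s2) \<Sigma>'" and B: "bounded B \<Sigma>" and B2: "?g B \<le> B2"
    for \<Sigma> \<Sigma>' B B2
  proof -
    have bd: "bounded B2 \<Sigma>" using bounded_mono[OF B] B2 by simp
    from ex consider "eval \<Sigma> e (VBool True)" "exec \<Sigma> s1 \<Sigma>'" | "eval \<Sigma> e (VBool False)" "exec \<Sigma> s2 \<Sigma>'"
      by (auto elim: exec_IfE)
    then show ?thesis
    proof cases
      case 1
      have "g1 B \<le> B2" using B2 by simp
      from G1[OF 1(2) B this] obtain N where N: "N \<le> g1 B" "bexec B2 \<Sigma> s1 N \<Sigma>'"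
        and r: "bounded (g1 B) \<Sigma>'" by blast
      have "bexec B2 \<Sigma> (If e s1 s2) (Suc N) \<Sigma>'" using bd 1(1) N(2) by (rule BIfT)
      moreover have "Suc N \<le> ?g B" using N by simp
      ultimately show ?thesis using bounded_mono[OF r(1), of "?g B"] by auto
    next
      case 2
      have "g2 B \<le> B2" using B2 by simp
      from G2[OF 2(2) B this] obtain N where N: "N \<le> g2 B" "bexec B2 \<Sigma> s2 N \<Sigma>'"
        and r: "bounded (g2 B) \<Sigma>'" by blast
      have "bexec B2 \<Sigma> (If e s1 s2) (Suc N) \<Sigma>'" using bd 2(1) N(2) by (rule BIfF)
      moreover have "Suc N \<le> ?g B" using N by simp
      ultimately show ?thesis using bounded_mono[OF r(1), of "?g B"] by auto
    qed
  qed
  ultimately show ?case unfolding top_bd_def by blast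
next
  case (TFor \<Gamma> l e x s \<Gamma>')
  \<comment> \<open>The body is typed with the indicator set, so the analysis of loops applies and
    is then weakened to the overall width.\<close>
  then show ?case using for_bexec[OF stmt_loop_bd(1)] loop_bd_top_bd by blast
next
  case (TNil \<Gamma> l)
  show ?case unfolding top_bd_def
  proof (intro exI[of _ "\<lambda>b. b + 1"] conjI allI impI)
    fix \<Sigma> \<Sigma>' B B2 assume "execs \<Sigma> [] \<Sigma>'" and B: "bounded B \<Sigma>"
    then have \<Sigma>': "\<Sigma>' = \<Sigma>" by (auto elim: execs_NilE)
    show "\<exists>N\<le>B + 1. bexecs B2 \<Sigma> [] N \<Sigma>'" unfolding \<Sigma>' using BNil by (intro exI[of _ 1]) simp
    show "bounded (B + 1) \<Sigma>'" unfolding \<Sigma>' using B by (rule bounded_mono) simp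
  qed ((intro monoI, simp) | (intro poly_bd_intros))+
next
  case (TCons \<Gamma> l s \<Gamma>1 ss \<Gamma>')
  then have lb: "top_bd (\<lambda>B \<Sigma>. bexec B \<Sigma> s) (\<lambda>\<Sigma>. exec \<Sigma> s)"
    "top_bd (\<lambda>B \<Sigma>. bexecs B \<Sigma> ss) (\<lambda>\<Sigma>. execs \<Sigma> ss)" by simp_all
  from lb(1) obtain g1 where g1: "mono g1" "poly_bd g1" and G1: "\<And>\<Sigma> \<Sigma>' B B2. exec \<Sigma> s \<Sigma>' \<Longrightarrow>
     bounded B \<Sigma> \<Longrightarrow> g1 B \<le> B2 \<Longrightarrow> (\<exists>N \<le> g1 B. bexec B2 \<Sigma> s N \<Sigma>') \<and> bounded (g1 B) \<Sigma>'"
    by (rule top_bdE) blast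
  from lb(2) obtain g2 where g2: "mono g2" "poly_bd g2" and G2: "\<And>\<Sigma> \<Sigma>' B B2. execs \<Sigma> ss \<Sigma>' \<Longrightarrow>
     bounded B \<Sigma> \<Longrightarrow> g2 B \<le> B2 \<Longrightarrow> (\<exists>N \<le> g2 B. bexecs B2 \<Sigma> ss N \<Sigma>') \<and> bounded (g2 B) \<Sigma>'"
    by (rule top_bdE) blast
  \<comment> \<open>The first statement may enlarge \<open>iint\<close> variables, so the bounds
    compose. This happens once per statement of the program text, which keeps the result
    polynomial.\<close>
  let ?g = "\<lambda>B. g1 B + g2 (g1 B) + 1"
  have "mono ?g" using g1 g2 by (intro monoI add_mono) (auto dest: monoD)
  moreover have "poly_bd ?g" by (intro poly_bd_intros poly_bd_comp[OF g2(2)] g1)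
  moreover have "(\<exists>N \<le> ?g B. bexecs B2 \<Sigma> (s # ss) N \<Sigma>') \<and> bounded (?g B) \<Sigma>'"
    if ex: "execs \<Sigma> (s # ss) \<Sigma>'" and B: "bounded B \<Sigma>" and B2: "?g B \<le> B2"
    for \<Sigma> \<Sigma>' B B2
  proof -
    from ex obtain \<Sigma>1 where e1: "exec \<Sigma> s \<Sigma>1" and e2: "execs \<Sigma>1 ss \<Sigma>'" by (rule execs_ConsE)
    have "g1 B \<le> B2" using B2 by simp
    from G1[OF e1 B this] obtain N1 where N1: "N1 \<le> g1 B" "bexec B2 \<Sigma> s N1 \<Sigma>1"
      and b1: "bounded (g1 B) \<Sigma>1" by blast
    have "g2 (g1 B) \<le> B2" using B2 by simp
    from G2[OF e2 b1 this] obtain N2 where N2: "N2 \<le> g2 (g1 B)" "bexecs B2 \<Sigma>1 ss N2 \<Sigma>'"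
      and b2: "bounded (g2 (g1 B)) \<Sigma>'" by blast
    have "bexecs B2 \<Sigma> (s # ss) (Suc (N1 + N2)) \<Sigma>'" using N1(2) N2(2) by (rule BCons)
    moreover have "Suc (N1 + N2) \<le> ?g B" using N1 N2 by simp
    moreover have "bounded (?g B) \<Sigma>'" using bounded_mono[OF b2] by simp
    ultimately show ?thesis by blast
  qed
  ultimately show ?case unfolding top_bd_def by blast
qed

subsection \<open>Decoding the input and encoding the output\<close>

text \<open>Temporaries from 10 on are work space here, so that those below 10 can hold the state of
  decoding and encoding across calls.\<close>

definition half_code :: "nat \<Rightarrow> nat \<Rightarrow> com" where
  "half_code r d = Seq (Asn (tmp 10) (0, [(r, 1)])) (Seq (Asn (tmp 11) (2, [])) (Seq (divmod_code 10)
     (Seq (Asn r (0, [(tmp 12, 1)])) (Asn (tmp d) (0, [(tmp 10, 1)])))))"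

lemma runs_half:
  assumes "0 \<le> \<sigma> r" "\<sigma> r < 2 ^ B" "d < 10" "r \<noteq> tmp d" "\<And>i. 10 \<le> i \<Longrightarrow> r \<noteq> tmp i"
    and Q: "\<And>\<tau>. \<tau> r = \<sigma> r div 2 \<Longrightarrow> \<tau> (tmp d) = \<sigma> r mod 2 \<Longrightarrow>
      (\<forall>r'. r' \<noteq> r \<longrightarrow> r' \<noteq> tmp d \<longrightarrow> (\<forall>i\<ge>10. r' \<noteq> tmp i) \<longrightarrow> \<tau> r' = \<sigma> r') \<Longrightarrow> Q \<tau>"
  shows "runs (half_code r d) \<sigma> (20 * (B + 1) ^ 2 + 10) Q"
proof -
  define \<sigma>1 where "\<sigma>1 = \<sigma>(tmp 10 := \<sigma> r, tmp 11 := 2)"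
  have "runs (divmod_code 10) \<sigma>1 (20 * (B + 1) ^ 2) (\<lambda>\<tau>.
     runs (Seq (Asn r (0, [(tmp 12, 1)])) (Asn (tmp d) (0, [(tmp 10, 1)]))) \<tau> (Suc (1 + 1)) Q)"
  proof (rule runs_divmod[where a = "\<sigma> r" and b = 2])
    fix \<tau> assume \<tau>: "\<tau> (tmp 10) = \<sigma> r mod 2" "\<tau> (tmp (10 + 2)) = \<sigma> r div 2"
      "\<forall>r'. r' \<noteq> tmp 10 \<longrightarrow> r' \<noteq> tmp (10 + 2) \<longrightarrow> r' \<noteq> tmp (10 + 3) \<longrightarrow> r' \<noteq> tmp (10 + 4) \<longrightarrow> \<tau> r' = \<sigma>1 r'"
    have "Q (\<tau>(r := \<sigma> r div 2, tmp d := \<sigma> r mod 2))"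
      using assms(3,4) \<tau>(3) by (intro Q) (auto simp: \<sigma>1_def)
    then show "runs (Seq (Asn r (0, [(tmp 12, 1)])) (Asn (tmp d) (0, [(tmp 10, 1)]))) \<tau> (Suc (1 + 1)) Q"
      using \<tau>(1,2) assms(5)[of 10] by (intro runs_Seq runs_Asn) (simp_all add: lval_def)
  qed (use assms in \<open>auto simp: \<sigma>1_def\<close>)
  from runs_Seq[OF this]
  have "runs (half_code r d) \<sigma> (Suc (1 + Suc (1 + Suc (20 * (B + 1) ^ 2 + Suc (1 + 1))))) Q"
    unfolding half_code_def using assms(5)[of 10]
    by (intro runs_Seq[where ?c1.0 = "Asn _ _"] runs_Asn) (simp_all add: \<sigma>1_def lval_def)
  then show ?thesis by (rule runs_mono) auto
qed

text \<open>Halving the three planes pops the first symbol off the word; its bits are left in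
  temporaries 0, 1 and 2.\<close>

definition read_code :: com where
  "read_code = Seq (half_code 0 0) (Seq (half_code 1 1) (half_code 2 2))"

definition read_cost :: "nat \<Rightarrow> nat" where "read_cost B = 3 * (20 * (B + 1) ^ 2 + 10) + 2"

lemma plane_half: "plane k (a # w) div 2 = plane k w" "plane k (a # w) mod 2 = of_bool (bit a k)"
  by simp_all

lemma less_3_cases: "(\<forall>k<3. P k) \<longleftrightarrow> P 0 \<and> P 1 \<and> P (2::nat)"
  by (auto simp: numeral_3_eq_3 numeral_2_eq_2 less_Suc_eq)

lemma runs_read:
  assumes \<sigma>: "\<forall>k<3. \<sigma> k = plane k (a # w)" and B: "length w < B"
    and Q: "\<And>\<tau>. (\<forall>k<3. \<tau> k = plane k w) \<Longrightarrow> (\<forall>k<3. \<tau> (tmp k) = of_bool (bit a k)) \<Longrightarrow>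
      (\<forall>r\<ge>3. (\<forall>i. i < 3 \<or> 10 \<le> i \<longrightarrow> r \<noteq> tmp i) \<longrightarrow> \<tau> r = \<sigma> r) \<Longrightarrow> Q \<tau>"
  shows "runs read_code \<sigma> (read_cost B) Q"
proof -
  have bnd: "0 \<le> plane k (a # w)" "plane k (a # w) < 2 ^ B" for k
  proof -
    have "(2::int) ^ length (a # w) \<le> 2 ^ B" using B by (intro power_increasing) auto
    then show "plane k (a # w) < 2 ^ B" using plane_bounds(2)[of k "a # w"] by linarith
  qed (rule plane_bounds)
  let ?N = "20 * (B + 1) ^ 2 + 10"
  have tn: "tmp i \<noteq> 0" "tmp i \<noteq> 1" "tmp i \<noteq> 2" "tmp i \<noteq> Suc 0"
    "0 \<noteq> tmp i" "1 \<noteq> tmp i" "2 \<noteq> tmp i" "Suc 0 \<noteq> tmp i" for i by (auto simp: tmp_def)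
  have "runs read_code \<sigma> (Suc (?N + Suc (?N + ?N))) Q"
    unfolding read_code_def
  proof (rule runs_Seq, rule runs_half)
    fix \<tau>0 assume 0: "\<tau>0 0 = \<sigma> 0 div 2" "\<tau>0 (tmp 0) = \<sigma> 0 mod 2"
      "\<forall>r'. r' \<noteq> 0 \<longrightarrow> r' \<noteq> tmp 0 \<longrightarrow> (\<forall>i\<ge>10. r' \<noteq> tmp i) \<longrightarrow> \<tau>0 r' = \<sigma> r'"
    have 01: "\<tau>0 1 = \<sigma> 1" "\<tau>0 2 = \<sigma> 2" using 0(3) tn by auto
    show "runs (Seq (half_code 1 1) (half_code 2 2)) \<tau>0 (Suc (?N + ?N)) Q"
    proof (rule runs_Seq, rule runs_half)
      fix \<tau>1 assume 1: "\<tau>1 1 = \<tau>0 1 div 2" "\<tau>1 (tmp 1) = \<tau>0 1 mod 2"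
        "\<forall>r'. r' \<noteq> 1 \<longrightarrow> r' \<noteq> tmp 1 \<longrightarrow> (\<forall>i\<ge>10. r' \<noteq> tmp i) \<longrightarrow> \<tau>1 r' = \<tau>0 r'"
      have 12: "\<tau>1 0 = \<tau>0 0" "\<tau>1 2 = \<tau>0 2" "\<tau>1 (tmp 0) = \<tau>0 (tmp 0)" using 1(3) tn by auto
      show "runs (half_code 2 2) \<tau>1 ?N Q"
      proof (rule runs_half)
        fix \<tau> assume 2: "\<tau> 2 = \<tau>1 2 div 2" "\<tau> (tmp 2) = \<tau>1 2 mod 2"
          "\<forall>r'. r' \<noteq> 2 \<longrightarrow> r' \<noteq> tmp 2 \<longrightarrow> (\<forall>i\<ge>10. r' \<noteq> tmp i) \<longrightarrow> \<tau> r' = \<tau>1 r'"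
        have 22: "\<tau> 0 = \<tau>1 0" "\<tau> 1 = \<tau>1 1" "\<tau> (tmp 0) = \<tau>1 (tmp 0)" "\<tau> (tmp 1) = \<tau>1 (tmp 1)"
          using 2(3) tn by auto
        have s: "\<sigma> 0 = plane 0 (a # w)" "\<sigma> 1 = plane 1 (a # w)" "\<sigma> 2 = plane 2 (a # w)" using \<sigma> by auto
        show "Q \<tau>"
        proof (rule Q)
          show "\<forall>k<3. \<tau> k = plane k w" unfolding less_3_cases 22 2 12 1 01 0 s plane_half by simp
          show "\<forall>k<3. \<tau> (tmp k) = of_bool (bit a k)" unfolding less_3_cases 22 2 12 1 01 0 s plane_half by simp
          show "\<forall>r\<ge>3. (\<forall>i. i < 3 \<or> 10 \<le> i \<longrightarrow> r \<noteq> tmp i) \<longrightarrow> \<tau> r = \<sigma> r" using 0(3) 1(3) 2(3) by simp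
        qed
      qed (use bnd \<sigma> 12 01 tn in auto)
    qed (use bnd \<sigma> 01 tn in auto)
  qed (use bnd \<sigma> tn in auto)
  then show ?thesis by (rule runs_mono) (auto simp: read_cost_def)
qed

text \<open>The symbols 1 and 2 stand for the digits 0 and 1, so bit 1 of a symbol is its digit. The
  fold is Horner's rule, the most significant digit coming first.\<close>

definition bits_val :: "int \<Rightarrow> nat list \<Rightarrow> int" where
  "bits_val = foldl (\<lambda>v a. 2 * v + of_bool (bit a 1))"

lemma bits_val_bin: "bits_val 0 (bin n) = int n"
proof (induction n rule: bin.induct)
  case (1 n)
  show ?case
  proof (cases "n = 0")
    case True
    then show ?thesis by (simp add: bin.simps[of 0] bits_val_def)
  next
    case False
    have "of_bool (bit (n mod 2 + 1) 1) = int (n mod 2)"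
      by (cases "even n") (auto simp: bit_iff_odd mod2_eq_if)
    moreover have "bits_val 0 (bin (n div 2)) = int (n div 2)" using 1 False by blast
    ultimately have "bits_val 0 (bin n) = 2 * int (n div 2) + int (n mod 2)"
      using False by (subst bin.simps) (simp add: bits_val_def)
    also have "\<dots> = int n" by (metis mult_div_mod_eq of_nat_add of_nat_mult of_nat_numeral)
    finally show ?thesis .
  qed
qed

text \<open>Works with one symbol of lookahead, kept in temporaries 0, 1 and 2. Its bit 2 tells the
  separator 5 from the digit symbols 1 and 2.\<close>

definition dec_loop :: com where
  "dec_loop = While (-1, [(tmp 2, 1)]) (Seq (Asn (tmp 4) (0, [(tmp 4, 2), (tmp 1, 1)])) read_code)"

lemma runs_dec_loop:
  assumes "set bs \<subseteq> {1, 2}" "bs @ 5 # w = a # u" "length u \<le> B"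
    "\<forall>k<3. \<sigma> k = plane k u" "\<forall>k<3. \<sigma> (tmp k) = of_bool (bit a k)"
    and Q: "\<And>\<tau>. (\<forall>k<3. \<tau> k = plane k w) \<Longrightarrow> \<tau> (tmp 4) = bits_val (\<sigma> (tmp 4)) bs \<Longrightarrow>
      (\<forall>r\<ge>3. (\<forall>i. i \<noteq> 3 \<longrightarrow> r \<noteq> tmp i) \<longrightarrow> \<tau> r = \<sigma> r) \<Longrightarrow> Q \<tau>"
  shows "runs dec_loop \<sigma> (length bs * (read_cost B + 3) + 1) Q"
  using assms
proof (induction bs arbitrary: a u \<sigma>)
  case Nil
  then have [simp]: "a = 5" "u = w" by auto
  have "bit (5::nat) 2" by (simp add: bit_iff_odd)
  then have "\<sigma> (tmp 2) = 1" using Nil.prems(5) by simp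
  moreover have "Q \<sigma>" using Nil.prems(4) by (intro Nil.prems(6)) (auto simp: bits_val_def)
  ultimately show ?case unfolding dec_loop_def
    by (intro runs_mono[OF runs_WhileF[of _ _ Q]]) (auto simp: lval_def)
next
  case (Cons b bs)
  then have [simp]: "a = b" and u: "u = bs @ 5 # w" by auto
  have b: "b = 1 \<or> b = 2" using Cons.prems(1) by auto
  have "\<not> bit b 2" using b by (auto simp: bit_iff_odd)
  then have t2: "\<sigma> (tmp 2) = 0" using Cons.prems(5) by simp
  have t1: "\<sigma> (tmp 1) = of_bool (bit b 1)" using Cons.prems(5) by simp
  obtain a' u' where u': "u = a' # u'" using u by (cases "bs @ 5 # w") auto
  define \<sigma>1 where "\<sigma>1 = \<sigma>(tmp 4 := 2 * \<sigma> (tmp 4) + of_bool (bit b 1))"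
  have "runs read_code \<sigma>1 (read_cost B) (\<lambda>\<tau>. runs dec_loop \<tau> (length bs * (read_cost B + 3) + 1) Q)"
  proof (rule runs_read[where a = a' and w = u'])
    show "\<forall>k<3. \<sigma>1 k = plane k (a' # u')" using Cons.prems(4) u' by (simp add: \<sigma>1_def)
    show "length u' < B" using Cons.prems(3) u' by simp
    fix \<tau> assume \<tau>: "\<forall>k<3. \<tau> k = plane k u'" "\<forall>k<3. \<tau> (tmp k) = of_bool (bit a' k)"
      "\<forall>r\<ge>3. (\<forall>i. i < 3 \<or> 10 \<le> i \<longrightarrow> r \<noteq> tmp i) \<longrightarrow> \<tau> r = \<sigma>1 r"
    have t: "3 \<le> tmp i" for i by (simp add: tmp_def)
    have t4: "\<tau> (tmp 4) = 2 * \<sigma> (tmp 4) + of_bool (bit b 1)"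
      using \<tau>(3) t by (simp add: \<sigma>1_def)
    show "runs dec_loop \<tau> (length bs * (read_cost B + 3) + 1) Q"
    proof (rule Cons.IH)
      show "set bs \<subseteq> {1, 2}" using Cons.prems(1) by simp
      show "bs @ 5 # w = a' # u'" using u u' by simp
      show "length u' \<le> B" using Cons.prems(3) u' by simp
      fix \<rho> assume \<rho>: "\<forall>k<3. \<rho> k = plane k w" "\<rho> (tmp 4) = bits_val (\<tau> (tmp 4)) bs"
        "\<forall>r\<ge>3. (\<forall>i. i \<noteq> 3 \<longrightarrow> r \<noteq> tmp i) \<longrightarrow> \<rho> r = \<tau> r"
      show "Q \<rho>"
      proof (rule Cons.prems(6))
        show "\<rho> (tmp 4) = bits_val (\<sigma> (tmp 4)) (b # bs)" using \<rho>(2) t4 by (simp add: bits_val_def)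
        show "\<forall>r\<ge>3. (\<forall>i. i \<noteq> 3 \<longrightarrow> r \<noteq> tmp i) \<longrightarrow> \<rho> r = \<sigma> r"
          using \<rho>(3) \<tau>(3) by (auto simp: \<sigma>1_def)
      qed (rule \<rho>(1))
    qed (use \<tau> in auto)
  qed
  then have "runs (Seq (Asn (tmp 4) (0, [(tmp 4, 2), (tmp 1, 1)])) read_code) \<sigma> (Suc (1 + read_cost B))
     (\<lambda>\<tau>. runs dec_loop \<tau> (length bs * (read_cost B + 3) + 1) Q)"
    using t1 by (intro runs_Seq runs_Asn) (simp_all add: lval_def \<sigma>1_def)
  from runs_WhileT[OF _ this[unfolded dec_loop_def]] t2
  have "runs dec_loop \<sigma> (Suc (Suc (1 + read_cost B) + (length bs * (read_cost B + 3) + 1))) Q"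
    unfolding dec_loop_def by (simp add: lval_def)
  then show ?case by (rule runs_mono) auto
qed

text \<open>Bit 2 also tells the sign symbols apart, being set in 4 for minus and clear in 3 for
  plus. Its negation is a number whose sign \<open>neg_if_neg\<close> can test.\<close>

definition dec_int :: "vname \<Rightarrow> com" where
  "dec_int x = Seq read_code (Seq (Asn (tmp 3) (0, [(tmp 2, -1)])) (Seq (Asn (tmp 4) (0, []))
     (Seq read_code (Seq dec_loop (Seq (neg_if_neg (tmp 3) (tmp 4)) (Asn (vreg x) (0, [(tmp 4, 1)])))))))"

definition dec_cost :: "nat \<Rightarrow> nat" where "dec_cost B = (B + 3) * (read_cost B + 3) + 20"

lemma runs_dec_int:
  assumes \<sigma>: "\<forall>k<3. \<sigma> k = plane k (enc_int v @ 5 # w)" and B: "length (enc_int v @ 5 # w) \<le> B"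
    and Q: "\<And>\<tau>. (\<forall>k<3. \<tau> k = plane k w) \<Longrightarrow> \<tau> (vreg x) = v \<Longrightarrow> (\<forall>y. y \<noteq> x \<longrightarrow> \<tau> (vreg y) = \<sigma> (vreg y)) \<Longrightarrow> Q \<tau>"
  shows "runs (dec_int x) \<sigma> (dec_cost B) Q"
proof -
  define s :: nat where "s = (if v < 0 then 4 else 3)"
  define bs where "bs = bin (nat \<bar>v\<bar>)"
  have enc: "enc_int v @ 5 # w = s # (bs @ 5 # w)" by (simp add: enc_int_def s_def bs_def)
  obtain a u where au: "bs @ 5 # w = a # u" by (cases bs) auto
  have "Suc (length (bs @ 5 # w)) \<le> B" "length (bs @ 5 # w) = Suc (length u)"
    using B unfolding enc au by simp_all
  then have len: "length (bs @ 5 # w) < B" "length u < B" "length bs < B" by simp_all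
  have s2: "bit s 2 = (v < 0)" by (simp add: s_def bit_iff_odd)
  let ?dl = "length bs * (read_cost B + 3) + 1"
  let ?fin = "Seq (neg_if_neg (tmp 3) (tmp 4)) (Asn (vreg x) (0, [(tmp 4, 1)]))"
  let ?r1 = "Seq (Asn (tmp 3) (0, [(tmp 2, -1)])) (Seq (Asn (tmp 4) (0, [])) (Seq read_code (Seq dec_loop ?fin)))"
  have "runs (dec_int x) \<sigma> (Suc (read_cost B + Suc (1 + Suc (1 + Suc (read_cost B + Suc (?dl + Suc (2 + 1))))))) Q"
    unfolding dec_int_def
  proof (rule runs_Seq, rule runs_read[where a = s and w = "bs @ 5 # w"])
    show "\<forall>k<3. \<sigma> k = plane k (s # bs @ 5 # w)" using \<sigma> enc by simp
    fix \<tau> assume \<tau>: "\<forall>k<3. \<tau> k = plane k (bs @ 5 # w)" "\<forall>k<3. \<tau> (tmp k) = of_bool (bit s k)"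
      "\<forall>r\<ge>3. (\<forall>i. i < 3 \<or> 10 \<le> i \<longrightarrow> r \<noteq> tmp i) \<longrightarrow> \<tau> r = \<sigma> r"
    have vr: "3 \<le> vreg y" for y by (simp add: vreg_def)
    have \<tau>v: "\<tau> (vreg y) = \<sigma> (vreg y)" for y using \<tau>(3) vr by simp
    define \<tau>1 where "\<tau>1 = \<tau>(tmp 3 := - of_bool (v < 0), tmp 4 := 0)"
    have "runs read_code \<tau>1 (read_cost B) (\<lambda>\<tau>. runs (Seq dec_loop ?fin) \<tau> (Suc (?dl + Suc (2 + 1))) Q)"
    proof (rule runs_read[where a = a and w = u])
      show "\<forall>k<3. \<tau>1 k = plane k (a # u)" using \<tau>(1) au by (simp add: \<tau>1_def)
      show "length u < B" by (rule len)
      fix \<rho> assume \<rho>: "\<forall>k<3. \<rho> k = plane k u" "\<forall>k<3. \<rho> (tmp k) = of_bool (bit a k)"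
        "\<forall>r\<ge>3. (\<forall>i. i < 3 \<or> 10 \<le> i \<longrightarrow> r \<noteq> tmp i) \<longrightarrow> \<rho> r = \<tau>1 r"
      have t: "3 \<le> tmp i" for i by (simp add: tmp_def)
      have \<rho>34: "\<rho> (tmp 3) = - of_bool (v < 0)" "\<rho> (tmp 4) = 0"
        using \<rho>(3) t by (simp_all add: \<tau>1_def)
      have \<rho>v: "\<rho> (vreg y) = \<sigma> (vreg y)" for y using \<rho>(3) vr \<tau>v by (simp add: \<tau>1_def)
      show "runs (Seq dec_loop ?fin) \<rho> (Suc (?dl + Suc (2 + 1))) Q"
      proof (rule runs_Seq, rule runs_dec_loop[OF _ au _ \<rho>(1,2)])
        show "set bs \<subseteq> {1, 2}" unfolding bs_def by (rule set_bin)
        show "length u \<le> B" using len by simp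
        fix \<pi> assume \<pi>: "\<forall>k<3. \<pi> k = plane k w" "\<pi> (tmp 4) = bits_val (\<rho> (tmp 4)) bs"
          "\<forall>r\<ge>3. (\<forall>i. i \<noteq> 3 \<longrightarrow> r \<noteq> tmp i) \<longrightarrow> \<pi> r = \<rho> r"
        have p4: "\<pi> (tmp 4) = \<bar>v\<bar>" using \<pi>(2) \<rho>34 by (simp add: bs_def bits_val_bin)
        have p3: "\<pi> (tmp 3) = - of_bool (v < 0)" using \<pi>(3) \<rho>34 t by simp
        have pv: "\<pi> (vreg y) = \<sigma> (vreg y)" for y using \<pi>(3) vr \<rho>v by simp
        have "Q (\<pi>(tmp 4 := v, vreg x := v))"
          using \<pi>(1) pv by (intro Q) auto
        then show "runs ?fin \<pi> (Suc (2 + 1)) Q"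
          using p3 p4 by (intro runs_Seq runs_neg_if_neg runs_Asn) (simp_all add: lval_def)
      qed
    qed
    from runs_Seq[OF this]
    show "runs ?r1 \<tau> (Suc (1 + Suc (1 + Suc (read_cost B + Suc (?dl + Suc (2 + 1)))))) Q"
      using \<tau>(2) s2 by (intro runs_Seq[where ?c1.0 = "Asn _ _"] runs_Asn) (simp_all add: \<tau>1_def lval_def)
  qed (use len in auto)
  moreover have "?dl \<le> B * (read_cost B + 3) + 1" using len(3) by simp
  ultimately show ?thesis by (elim runs_mono) (auto simp: dec_cost_def algebra_simps)
qed

primrec dec_all :: "vname list \<Rightarrow> com" where
  "dec_all [] = skip"
| "dec_all (x # xs) = Seq (dec_int x) (dec_all xs)"

lemma enc_input_Cons: "enc_input (v # vs) = enc_int v @ 5 # enc_input vs"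
  by (simp add: enc_input_def)

lemma runs_dec_all:
  assumes "length vs = length xs" "\<forall>k<3. \<sigma> k = plane k (enc_input vs)" "length (enc_input vs) \<le> B" "rel \<Sigma> \<sigma>"
  shows "runs (dec_all xs) \<sigma> (length xs * (dec_cost B + 1) + 1)
     (\<lambda>\<tau>. (\<forall>k<3. \<tau> k = 0) \<and> rel (\<Sigma>(xs [\<mapsto>] map VInt vs)) \<tau>)"
  using assms
proof (induction xs arbitrary: vs \<sigma> \<Sigma>)
  case Nil
  then show ?case by (auto intro!: runs_skip simp: enc_input_def)
next
  case (Cons x xs)
  then obtain v vs' where vs: "vs = v # vs'" and len: "length vs' = length xs" by (cases vs) auto
  have "runs (dec_int x) \<sigma> (dec_cost B) (\<lambda>\<tau>. runs (dec_all xs) \<tau> (length xs * (dec_cost B + 1) + 1)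
     (\<lambda>\<tau>. (\<forall>k<3. \<tau> k = 0) \<and> rel (\<Sigma>((x # xs) [\<mapsto>] map VInt vs)) \<tau>))"
  proof (rule runs_dec_int)
    show "\<forall>k<3. \<sigma> k = plane k (enc_int v @ 5 # enc_input vs')"
      using Cons.prems(2) vs enc_input_Cons by simp
    show "length (enc_int v @ 5 # enc_input vs') \<le> B" using Cons.prems(3) vs enc_input_Cons by simp
    fix \<tau> assume \<tau>: "\<forall>k<3. \<tau> k = plane k (enc_input vs')" "\<tau> (vreg x) = v" "\<forall>y. y \<noteq> x \<longrightarrow> \<tau> (vreg y) = \<sigma> (vreg y)"
    have "rel (\<Sigma>(x \<mapsto> VInt v)) \<tau>" using Cons.prems(4) \<tau>(2,3) unfolding rel_def by auto
    from Cons.IH[OF len \<tau>(1) _ this]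
    show "runs (dec_all xs) \<tau> (length xs * (dec_cost B + 1) + 1)
     (\<lambda>\<tau>. (\<forall>k<3. \<tau> k = 0) \<and> rel (\<Sigma>((x # xs) [\<mapsto>] map VInt vs)) \<tau>)"
      using Cons.prems(3) vs by (simp add: enc_input_Cons del: fun_upd_apply)
  qed
  from runs_Seq[OF this] show ?case by (auto elim!: runs_mono)
qed

text \<open>Prepends digit symbols, least significant digit first, so that the most significant one
  ends up in front. Doubling the planes makes room; digit \<open>d\<close> becomes the symbol
  \<open>d + 1\<close>, whose bits are \<open>1 - d\<close>, \<open>d\<close> and 0.\<close>

definition enc_loop :: com where
  "enc_loop = While (0, [(tmp 5, -1)]) (Seq (half_code (tmp 5) 6) (Seq (Asn 0 (1, [(0, 2), (tmp 6, -1)]))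
     (Seq (Asn 1 (0, [(1, 2), (tmp 6, 1)])) (Asn 2 (0, [(2, 2)])))))"

lemma runs_enc_loop:
  assumes "\<forall>k<3. \<sigma> k = plane k u" "\<sigma> (tmp 5) = int n" "n < 2 ^ B"
    and "\<And>\<tau>. (\<forall>k<3. \<tau> k = plane k (bin n @ u)) \<Longrightarrow> \<tau> (tmp 0) = \<sigma> (tmp 0) \<Longrightarrow> Q \<tau>"
  shows "runs enc_loop \<sigma> (length (bin n) * (20 * (B + 1) ^ 2 + 20) + 1) Q"
  using assms
proof (induction n arbitrary: u \<sigma> rule: bin.induct)
  case (1 n)
  show ?case
  proof (cases "n = 0")
    case True
    have "Q \<sigma>" using 1(2) True by (intro 1(5)) (auto simp: bin.simps[of 0])
    then show ?thesis unfolding enc_loop_def using 1(3) True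
      by (intro runs_mono[OF runs_WhileF[of _ _ Q]]) (auto simp: lval_def)
  next
    case False
    have bin: "bin n = bin (n div 2) @ [n mod 2 + 1]" using False by (subst bin.simps) simp
    let ?N = "20 * (B + 1) ^ 2 + 10"
    let ?M = "length (bin (n div 2)) * (20 * (B + 1) ^ 2 + 20) + 1"
    have "runs (Seq (half_code (tmp 5) 6) (Seq (Asn 0 (1, [(0, 2), (tmp 6, -1)]))
     (Seq (Asn 1 (0, [(1, 2), (tmp 6, 1)])) (Asn 2 (0, [(2, 2)]))))) \<sigma> (Suc (?N + Suc (1 + Suc (1 + 1))))
      (\<lambda>\<tau>. runs enc_loop \<tau> ?M Q)"
    proof (rule runs_Seq, rule runs_half)
      have "int n < 2 ^ B" using 1(4) by (metis of_nat_less_iff of_nat_numeral of_nat_power)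
      then show "0 \<le> \<sigma> (tmp 5)" "\<sigma> (tmp 5) < 2 ^ B" using 1(3) by auto
      fix \<tau> assume \<tau>: "\<tau> (tmp 5) = \<sigma> (tmp 5) div 2" "\<tau> (tmp 6) = \<sigma> (tmp 5) mod 2"
        "\<forall>r'. r' \<noteq> tmp 5 \<longrightarrow> r' \<noteq> tmp 6 \<longrightarrow> (\<forall>i\<ge>10. r' \<noteq> tmp i) \<longrightarrow> \<tau> r' = \<sigma> r'"
      have t6: "\<tau> (tmp 6) = int (n mod 2)" using \<tau>(2) 1(3) by (simp add: zmod_int)
      have t5: "\<tau> (tmp 5) = int (n div 2)" using \<tau>(1) 1(3) by (simp add: zdiv_int)
      have tk: "\<forall>k<3. \<tau> k = plane k u" using \<tau>(3) 1(2) by simp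
      have t0: "\<tau> (tmp 0) = \<sigma> (tmp 0)" using \<tau>(3) by simp
      define \<rho> where "\<rho> = \<tau>(0 := 2 * \<tau> 0 + 1 - int (n mod 2), 1 := 2 * \<tau> 1 + int (n mod 2), 2 := 2 * \<tau> 2)"
      have tn: "tmp i \<noteq> 0" "tmp i \<noteq> 1" "tmp i \<noteq> 2" "tmp i \<noteq> Suc 0" for i by (auto simp: tmp_def)
      have "runs enc_loop \<rho> ?M Q"
      proof (rule 1(1)[OF False])
        have "bit (n mod 2 + 1) 0 = (n mod 2 = 0)" "bit (n mod 2 + 1) 1 = (n mod 2 = 1)" "\<not> bit (n mod 2 + 1) 2"
          by (cases "even n"; auto simp: bit_iff_odd mod2_eq_if)+
        then show "\<forall>k<3. \<rho> k = plane k ((n mod 2 + 1) # u)"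
          using tk unfolding less_3_cases by (cases "even n") (auto simp: \<rho>_def mod2_eq_if)
        show "\<rho> (tmp 5) = int (n div 2)" using t5 tn by (simp add: \<rho>_def)
        show "n div 2 < 2 ^ B" using 1(4) by simp
        fix \<pi> assume "\<forall>k<3. \<pi> k = plane k (bin (n div 2) @ (n mod 2 + 1) # u)" "\<pi> (tmp 0) = \<rho> (tmp 0)"
        then show "Q \<pi>" using t0 tn by (intro 1(5)) (simp_all add: bin \<rho>_def)
      qed
      then show "runs (Seq (Asn 0 (1, [(0, 2), (tmp 6, -1)]))
        (Seq (Asn 1 (0, [(1, 2), (tmp 6, 1)])) (Asn 2 (0, [(2, 2)])))) \<tau> (Suc (1 + Suc (1 + 1)))
        (\<lambda>\<tau>. runs enc_loop \<tau> ?M Q)"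
        using t6 tn by (intro runs_Seq runs_Asn) (simp_all add: \<rho>_def lval_def algebra_simps)
    qed auto
    from runs_WhileT[OF _ this[unfolded enc_loop_def]] False 1(3)
    have "runs enc_loop \<sigma> (Suc (Suc (?N + Suc (1 + Suc (1 + 1))) + ?M)) Q"
      unfolding enc_loop_def by (simp add: lval_def)
    then show ?thesis by (rule runs_mono) (auto simp: bin)
  qed
qed

definition enc_code :: com where
  "enc_code = Seq (Asn (tmp 5) (0, [(tmp 0, 1)])) (Seq (abs_code (tmp 5)) (Seq enc_loop
     (Cond (0, [(tmp 0, 1)])
       (Seq (Asn 0 (0, [(0, 2)])) (Seq (Asn 1 (0, [(1, 2)])) (Asn 2 (1, [(2, 2)]))))
       (Seq (Asn 0 (1, [(0, 2)])) (Seq (Asn 1 (1, [(1, 2)])) (Asn 2 (0, [(2, 2)])))))))"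

lemma length_bin_le: "n < 2 ^ B \<Longrightarrow> length (bin n) \<le> B"
proof (induction n arbitrary: B rule: bin.induct)
  case (1 n)
  show ?case
  proof (cases "n = 0")
    case True
    then show ?thesis by (simp add: bin.simps[of 0])
  next
    case False
    then obtain B' where B': "B = Suc B'" using 1(2) by (cases B) auto
    then have "n div 2 < 2 ^ B'" using 1(2) by auto
    then have "length (bin (n div 2)) \<le> B'" using 1(1) False by blast
    then show ?thesis using False B' by (subst bin.simps) simp
  qed
qed

lemma less_length_bin: "n < 2 ^ length (bin n)"
proof (induction n rule: bin.induct)
  case (1 n)
  show ?case
  proof (cases "n = 0")
    case False
    then have "n div 2 < 2 ^ length (bin (n div 2))" using 1 by blast
    then have "n < 2 * 2 ^ length (bin (n div 2))" by linarith
    moreover have "bin n = bin (n div 2) @ [n mod 2 + 1]" using False by (subst bin.simps) simp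
    ultimately show ?thesis by simp
  qed simp
qed

text \<open>The planes start at 0, the empty word: decoding has consumed the input and the compiled
  program leaves them alone. Since symbols are pushed in front, the sign comes last.\<close>

lemma runs_enc:
  assumes \<sigma>: "\<forall>k<3. \<sigma> k = 0" and B: "\<bar>\<sigma> (tmp 0)\<bar> < 2 ^ B"
  shows "runs enc_code \<sigma> (B * (20 * (B + 1) ^ 2 + 20) + 20) (\<lambda>\<tau>. \<forall>k<3. \<tau> k = plane k (enc_int (\<sigma> (tmp 0))))"
proof -
  define v where "v = \<sigma> (tmp 0)"
  define n where "n = nat \<bar>v\<bar>"
  define \<sigma>1 where "\<sigma>1 = \<sigma>(tmp 5 := \<bar>v\<bar>)"
  have "int n < int (2 ^ B)" using B by (simp add: n_def v_def)
  then have nB: "n < 2 ^ B" by (simp only: of_nat_less_iff)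
  let ?Q = "\<lambda>\<tau>. \<forall>k<3. \<tau> k = plane k (enc_int v)"
  let ?c1 = "Seq (Asn 0 (0, [(0, 2)])) (Seq (Asn 1 (0, [(1, 2)])) (Asn 2 (1, [(2, 2)])))"
  let ?c2 = "Seq (Asn 0 (1, [(0, 2)])) (Seq (Asn 1 (1, [(1, 2)])) (Asn 2 (0, [(2, 2)])))"
  let ?N = "Suc (1 + Suc (1 + 1))"
  let ?M = "length (bin n) * (20 * (B + 1) ^ 2 + 20) + 1"
  have "runs (Seq enc_loop (Cond (0, [(tmp 0, 1)]) ?c1 ?c2)) \<sigma>1 (Suc (?M + Suc (max ?N ?N))) ?Q"
  proof (rule runs_Seq, rule runs_enc_loop[where u = "[]", OF _ _ nB])
    fix \<tau> assume \<tau>: "\<forall>k<3. \<tau> k = plane k (bin n @ [])" "\<tau> (tmp 0) = \<sigma>1 (tmp 0)"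
    have t0: "\<tau> (tmp 0) = v" using \<tau>(2) by (simp add: \<sigma>1_def v_def)
    have b: "bit (4::nat) 2" "\<not> bit (4::nat) 1" "\<not> bit (4::nat) 0" "\<not> bit (3::nat) 2" "bit (3::nat) 1" "bit (3::nat) 0"
      by (simp_all add: bit_iff_odd)
    show "runs (Cond (0, [(tmp 0, 1)]) ?c1 ?c2) \<tau> (Suc (max ?N ?N)) ?Q"
    proof (rule runs_Cond)
      assume "lval (0, [(tmp 0, 1)]) \<tau> < 0"
      then have "v < 0" using t0 by (simp add: lval_def)
      then show "runs ?c1 \<tau> ?N ?Q" using \<tau>(1) b unfolding less_3_cases
        by (intro runs_Seq runs_Asn) (simp_all add: lval_def enc_int_def n_def)
    next
      assume "\<not> lval (0, [(tmp 0, 1)]) \<tau> < 0"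
      then have "\<not> v < 0" using t0 by (simp add: lval_def)
      then show "runs ?c2 \<tau> ?N ?Q" using \<tau>(1) b unfolding less_3_cases
        by (intro runs_Seq runs_Asn) (simp_all add: lval_def enc_int_def n_def)
    qed
  qed (use \<sigma> in \<open>simp_all add: \<sigma>1_def n_def\<close>)
  then have "runs enc_code \<sigma> (Suc (1 + Suc (2 + Suc (?M + Suc (max ?N ?N))))) ?Q"
    unfolding enc_code_def
    by (intro runs_Seq[where ?c1.0 = "Asn _ _"] runs_Seq[where ?c1.0 = "abs_code _"] runs_Asn runs_abs)
      (simp_all add: \<sigma>1_def v_def lval_def)
  moreover have "?M \<le> B * (20 * (B + 1) ^ 2 + 20) + 1"
    by (intro add_mono mult_le_mono1 length_bin_le[OF nB]) simp
  moreover have "max ?N ?N = 5" by simp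
  ultimately show ?thesis unfolding v_def by (elim runs_mono) linarith+
qed

subsection \<open>Well-typed programs run in polynomial time\<close>

lemma three_notin_op_code: "3 \<notin> com_regs (op_code f n)"
  by (cases f) (auto simp: div_code_def mod_code_def signed_code_def divmod_code_def neg_if_neg_def
      abs_code_def skip_def size_code_def bool_code_def)

lemma three_notin_comp_expr: "3 \<notin> com_regs (comp_expr e n)"
  by (induction e n rule: comp_expr.induct) (auto simp: three_notin_op_code skip_def)

lemma three_notin_comp_stmt: "3 \<notin> com_regs (comp_stmt s n)" "3 \<notin> com_regs (comp_stmts ss n)"
  by (induction s n and ss n rule: comp_stmt_comp_stmts.induct)
    (auto simp: three_notin_comp_expr skip_def abs_code_def)

lemma three_notin_read_code: "3 \<notin> com_regs read_code"
  by (auto simp: read_code_def half_code_def divmod_code_def)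

lemma three_notin_dec_all: "3 \<notin> com_regs (dec_all xs)"
  by (induction xs)
    (auto simp: dec_int_def three_notin_read_code dec_loop_def neg_if_neg_def skip_def)

lemma three_notin_enc_code: "3 \<notin> com_regs enc_code"
  by (auto simp: enc_code_def enc_loop_def abs_code_def skip_def half_code_def divmod_code_def)

lemma bounded_upds:
  "bounded B \<Sigma> \<Longrightarrow> \<forall>v\<in>set vs. \<bar>v\<bar> < 2 ^ B \<Longrightarrow> bounded B (\<Sigma>(xs [\<mapsto>] map VInt vs))"
proof (induction xs arbitrary: vs \<Sigma>)
  case (Cons x xs)
  note IH = Cons.IH and prems = Cons.prems
  show ?case
  proof (cases vs)
    case (Cons v vs')
    have "bounded B (\<Sigma>(x \<mapsto> VInt v))" using prems Cons by (intro bounded_upd) auto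
    then show ?thesis using IH prems(2) Cons by (simp del: fun_upd_apply)
  qed (use prems in simp)
qed simp

lemma abs_less_input_size: "v \<in> set vs \<Longrightarrow> \<bar>v\<bar> < 2 ^ input_size vs"
proof -
  assume v: "v \<in> set vs"
  have "nat \<bar>v\<bar> < 2 ^ bit_length v" unfolding bit_length_def by (rule less_length_bin)
  then have "int (nat \<bar>v\<bar>) < int (2 ^ bit_length v)" by (simp only: of_nat_less_iff)
  then have "\<bar>v\<bar> < 2 ^ bit_length v" by simp
  also have "bit_length v \<le> input_size vs"
    unfolding input_size_def using v by (intro member_le_sum_list) auto
  then have "(2::int) ^ bit_length v \<le> 2 ^ input_size vs" by (intro power_increasing) auto
  finally show ?thesis .
qed

text \<open>One polynomial for all expressions of a program: costs are upper bounds, so the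
  individual ones may be added.\<close>

lemma ex_expr_cost_finite: "finite A \<Longrightarrow> \<exists>p. poly_bd p \<and> (\<forall>e\<in>A. expr_cost p e)"
proof (induction rule: finite_induct)
  case (insert e A)
  then obtain p q where p: "poly_bd p" "\<forall>e\<in>A. expr_cost p e" and q: "poly_bd q" "expr_cost q e"
    using ex_expr_cost[of e] by blast
  have mono: "expr_cost p' e'" if "expr_cost q' e'" "\<And>n. q' n \<le> p' n" for p' q' e'
    unfolding expr_cost_def
  proof (intro allI impI)
    fix \<Sigma> v \<sigma> B n assume "eval \<Sigma> e' v" "rel \<Sigma> \<sigma>" "bounded B \<Sigma>"
    then have "runs (comp_expr e' n) \<sigma> (q' B) (\<lambda>\<tau>. \<tau> (tmp n) = code_val v \<and> same n \<sigma> \<tau>)"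
      using that(1) unfolding expr_cost_def by blast
    then show "runs (comp_expr e' n) \<sigma> (p' B) (\<lambda>\<tau>. \<tau> (tmp n) = code_val v \<and> same n \<sigma> \<tau>)"
      using that(2) by (rule runs_mono)
  qed
  have "expr_cost (\<lambda>n. p n + q n) e" using mono[OF q(2)] by simp
  moreover have "expr_cost (\<lambda>n. p n + q n) e'" if "e' \<in> A" for e' using mono[of p e'] p(2) that by simp
  ultimately show ?case using poly_bd_add[OF p(1) q(1)] by blast
qed (auto intro: poly_bd_const)

text \<open>\<open>g x\<close> bounds both the counted steps of the body and the width of the stores
  in which it evaluates expressions, so substituting it into the expression costs bounds the
  compiled body and return expression; decoding and encoding add their own polynomials.\<close>

lemma in_FPC_imp_in_FP:
  assumes "in_FPC m f"
  shows "in_FP m f"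
proof -
  from assms obtain P where wt: "well_typed P" and lenP: "length (params P) = m"
    and out: "\<And>vs. length vs = m \<Longrightarrow> prog_out P vs (f vs)"
    unfolding in_FPC_def by blast
  define ps where "ps = params P"
  define bd where "bd = body P"
  define re where "re = ret P"
  have "top_bd (\<lambda>B \<Sigma>. bexecs B \<Sigma> bd) (\<lambda>\<Sigma>. execs \<Sigma> bd)"
    using wt stmt_top_bd(2) unfolding well_typed_def bd_def by blast
  then obtain g where g: "mono g" "poly_bd g" and G: "\<And>\<Sigma> \<Sigma>' B B2. execs \<Sigma> bd \<Sigma>' \<Longrightarrow> bounded B \<Sigma> \<Longrightarrow> g B \<le> B2 \<Longrightarrow>
     (\<exists>N \<le> g B. bexecs B2 \<Sigma> bd N \<Sigma>') \<and> bounded (g B) \<Sigma>'" by (rule top_bdE) blast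
  obtain p where p: "poly_bd p" "\<And>e. e \<in> (\<Union>s\<in>set bd. exprs s) \<Longrightarrow> expr_cost p e"
    using ex_expr_cost_finite[of "\<Union>s\<in>set bd. exprs s"] finite_exprs by auto
  obtain q where q: "poly_bd q" "expr_cost q re" using ex_expr_cost by blast
  define C where "C = Seq (dec_all ps) (Seq (comp_stmts bd 0) (Seq (comp_expr re 0) enc_code))"
  define ec where "ec B = B * (20 * (B + 1) ^ 2 + 20) + 20" for B :: nat
  define T where "T x = Suc ((m * (dec_cost (x + 2 * m) + 1) + 1) +
     Suc (g x * (p (g x) + 20) + Suc (q (g x) + ec (g x + expr_size re))))" for x
  \<comment> \<open>Sums in place of \<open>Suc\<close>, the form in which the closure rules for
    \<open>poly_bd\<close> apply.\<close>
  have T_eq: "T = (\<lambda>x. (m * (dec_cost (x + 2 * m) + 1) + 1) +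
     (g x * (p (g x) + 20) + (q (g x) + ec (g x + expr_size re) + 1) + 1) + 1)"
    by (simp add: T_def fun_eq_iff)
  have "poly_bd T"
    unfolding T_eq ec_def dec_cost_def read_cost_def
    by (intro poly_bd_add poly_bd_mult poly_bd_power poly_bd_const poly_bd_id g poly_bd_comp[OF p(1) g(2)]
        poly_bd_comp[OF q(1) g(2)])
  moreover have "3 \<notin> com_regs C"
    by (simp add: C_def three_notin_dec_all three_notin_comp_stmt three_notin_comp_expr three_notin_enc_code)
  moreover have "\<exists>n \<tau>. lexec C (planes (enc_input vs)) n \<tau> \<and> n \<le> T (input_size vs)
      \<and> (\<forall>k<3. \<tau> k = plane k (enc_int (f vs)))" if len: "length vs = m" for vs
  proof -
    define x where "x = input_size vs"
    define \<Sigma> where "\<Sigma> = Map.empty(ps [\<mapsto>] map VInt vs)"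
    from out[OF len] obtain \<Sigma>' where ex: "execs \<Sigma> bd \<Sigma>'" and ev: "eval \<Sigma>' re (VInt (f vs))"
      unfolding prog_out_def \<Sigma>_def ps_def bd_def re_def by blast
    have b: "bounded x \<Sigma>" unfolding \<Sigma>_def x_def
      using abs_less_input_size by (intro bounded_upds) (auto simp: bounded_def)
    obtain N where N: "N \<le> g x" "bexecs (g x) \<Sigma> bd N \<Sigma>'" and b': "bounded (g x) \<Sigma>'"
      using G[OF ex b order_refl] by blast
    let ?Q = "\<lambda>\<tau>. \<forall>k<3. \<tau> k = plane k (enc_int (f vs))"
    have "runs (dec_all ps) (planes (enc_input vs)) (length ps * (dec_cost (x + 2 * m) + 1) + 1)
       (\<lambda>\<tau>. (\<forall>k<3. \<tau> k = 0) \<and> rel \<Sigma> \<tau>)"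
      unfolding \<Sigma>_def using len lenP
      by (intro runs_dec_all) (auto simp: ps_def planes_def length_enc_input x_def rel_def)
    then have "runs (dec_all ps) (planes (enc_input vs)) (length ps * (dec_cost (x + 2 * m) + 1) + 1)
       (\<lambda>\<tau>. runs (Seq (comp_stmts bd 0) (Seq (comp_expr re 0) enc_code)) \<tau>
         (Suc (g x * (p (g x) + 20) + Suc (q (g x) + ec (g x + expr_size re)))) ?Q)"
    proof (rule runs_mono[OF _ order_refl])
      fix \<tau> assume \<tau>: "(\<forall>k<3. \<tau> k = 0) \<and> rel \<Sigma> \<tau>"
      have "runs (comp_stmts bd 0) \<tau> (N * (p (g x) + 20)) (\<lambda>\<rho>. rel \<Sigma>' \<rho> \<and> keeps 0 \<tau> \<rho>)"
        using \<tau> by (intro runs_stmt(2)[where Es = "\<Union>s\<in>set bd. exprs s" and p = p, OF p(2) N(2)]) auto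
      then have "runs (comp_stmts bd 0) \<tau> (g x * (p (g x) + 20)) (\<lambda>\<rho>. runs (Seq (comp_expr re 0) enc_code) \<rho>
         (Suc (q (g x) + ec (g x + expr_size re))) ?Q)"
      proof (rule runs_mono)
        show "N * (p (g x) + 20) \<le> g x * (p (g x) + 20)" using N(1) by (rule mult_le_mono1)
        fix \<rho> assume \<rho>: "rel \<Sigma>' \<rho> \<and> keeps 0 \<tau> \<rho>"
        have "runs (comp_expr re 0) \<rho> (q (g x)) (\<lambda>\<pi>. \<pi> (tmp 0) = f vs \<and> same 0 \<rho> \<pi>)"
          using q(2) ev \<rho> b' unfolding expr_cost_def by fastforce
        then have "runs (comp_expr re 0) \<rho> (q (g x)) (\<lambda>\<pi>. runs enc_code \<pi> (ec (g x + expr_size re)) ?Q)"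
        proof (rule runs_mono[OF _ order_refl])
          fix \<pi> assume \<pi>: "\<pi> (tmp 0) = f vs \<and> same 0 \<rho> \<pi>"
          have "\<forall>k<3. \<pi> k = 0" using \<tau> \<rho> \<pi> same_io[of 0 \<rho> \<pi>] by (simp add: keeps_def)
          moreover have "\<bar>\<pi> (tmp 0)\<bar> < 2 ^ (g x + expr_size re)" using eval_bound[OF ev b'] \<pi> by simp
          ultimately show "runs enc_code \<pi> (ec (g x + expr_size re)) ?Q"
            unfolding ec_def using runs_enc[of \<pi> "g x + expr_size re"] \<pi> by simp
        qed
        then show "runs (Seq (comp_expr re 0) enc_code) \<rho> (Suc (q (g x) + ec (g x + expr_size re))) ?Q"
          by (rule runs_Seq)
      qed
      then show "runs (Seq (comp_stmts bd 0) (Seq (comp_expr re 0) enc_code)) \<tau>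
         (Suc (g x * (p (g x) + 20) + Suc (q (g x) + ec (g x + expr_size re)))) ?Q"
        by (rule runs_Seq)
    qed
    from runs_Seq[OF this] have "runs C (planes (enc_input vs)) (T x) ?Q"
      using lenP by (simp add: C_def T_def ps_def)
    then show ?thesis unfolding runs_def x_def by blast
  qed
  ultimately show ?thesis by (intro in_FP_if_lexec)
qed

subsection \<open>Straight-line programs over numbered variables\<close>

text \<open>Variable \<open>i\<close> is named by \<open>i\<close> copies of one letter, so
  \<open>length\<close> recovers its number; the evaluation functions rely on this.\<close>

definition vn :: "nat \<Rightarrow> vname" where "vn i = replicate i CHR ''v''"

lemma length_vn [simp]: "length (vn i) = i" by (simp add: vn_def)
lemma vn_eq [simp]: "vn i = vn j \<longleftrightarrow> i = j" by (metis length_vn)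

text \<open>A functional semantics on valuations of numbered variables, so that generated code can
  be evaluated by rewriting. The default 0 covers expressions outside the fragment in use.\<close>

fun int_eval :: "(nat \<Rightarrow> int) \<Rightarrow> expr \<Rightarrow> int" where
  "int_eval f (Var x) = f (length x)"
| "int_eval f (Num n) = int n"
| "int_eval f (Op ONeg [a]) = - int_eval f a"
| "int_eval f (Op OAdd [a, b]) = int_eval f a + int_eval f b"
| "int_eval f (Op OSub [a, b]) = int_eval f a - int_eval f b"
| "int_eval f (Op ODiv [a, b]) = tdiv (int_eval f a) (int_eval f b)"
| "int_eval f (Op OMod [a, b]) = tmod (int_eval f a) (int_eval f b)"
| "int_eval f _ = 0"

fun bool_eval :: "(nat \<Rightarrow> int) \<Rightarrow> expr \<Rightarrow> bool" where
  "bool_eval f (Op OLt [a, b]) = (int_eval f a < int_eval f b)"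
| "bool_eval f (Op OEq [a, b]) = (int_eval f a = int_eval f b)"
| "bool_eval f (Op OAnd [a, b]) = (bool_eval f a \<and> bool_eval f b)"
| "bool_eval f _ = False"

fun stmt_eval :: "stmt \<Rightarrow> (nat \<Rightarrow> int) \<Rightarrow> (nat \<Rightarrow> int)" and stmts_eval :: "stmt list \<Rightarrow> (nat \<Rightarrow> int) \<Rightarrow> (nat \<Rightarrow> int)" where
  "stmt_eval (Assign x e) f = f(length x := int_eval f e)"
| "stmt_eval (Block ss) f = stmts_eval ss f"
| "stmt_eval (If e s1 s2) f = (if bool_eval f e then stmt_eval s1 f else stmt_eval s2 f)"
| "stmt_eval _ f = f"
| "stmts_eval [] f = f"
| "stmts_eval (s # ss) f = stmts_eval ss (stmt_eval s f)"

text \<open>The language has no product, but shifting a numeral in a fixed base needs only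
  multiplication by a constant, an iterated sum.\<close>

fun mulc :: "nat \<Rightarrow> expr \<Rightarrow> expr" where
  "mulc 0 e = Num 0"
| "mulc (Suc n) e = Op OAdd [e, mulc n e]"

lemma int_eval_mulc [simp]: "int_eval f (mulc n e) = int n * int_eval f e"
  by (induction n) (simp_all add: algebra_simps)

locale numbered_vars =
  fixes m :: nat
begin

text \<open>Work variables 0 to 8 and the \<open>m\<close> inputs from 20 on. Numbers from
  \<open>20 + m\<close> on stay outside and serve as loop variables, so loops do not disturb a
  valuation.\<close>

definition used_vars :: "nat set" where "used_vars = {i. i \<le> 8 \<or> 20 \<le> i \<and> i < 20 + m}"

definition holds_vals :: "(nat \<Rightarrow> int) \<Rightarrow> store \<Rightarrow> bool" where
  "holds_vals f \<Sigma> \<longleftrightarrow> (\<forall>i\<in>used_vars. \<Sigma> (vn i) = Some (VInt (f i)))"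

definition good :: "tyenv \<Rightarrow> bool" where
  "good \<Gamma> \<longleftrightarrow> \<Gamma> (vn 0) = Some TIInt \<and> (\<forall>i\<in>used_vars. i \<noteq> 0 \<longrightarrow> \<Gamma> (vn i) = Some TInt)"

fun int_expr :: "expr \<Rightarrow> bool" where
  "int_expr (Var x) = (x = vn (length x) \<and> length x \<in> used_vars)"
| "int_expr (Num n) = True"
| "int_expr (Op ONeg [a]) = int_expr a"
| "int_expr (Op OAdd [a, b]) = (int_expr a \<and> int_expr b)"
| "int_expr (Op OSub [a, b]) = (int_expr a \<and> int_expr b)"
| "int_expr (Op ODiv [a, b]) = (int_expr a \<and> int_expr b)"
| "int_expr (Op OMod [a, b]) = (int_expr a \<and> int_expr b)"
| "int_expr _ = False"

fun bool_expr :: "expr \<Rightarrow> bool" where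
  "bool_expr (Op OLt [a, b]) = (int_expr a \<and> int_expr b)"
| "bool_expr (Op OEq [a, b]) = (int_expr a \<and> int_expr b)"
| "bool_expr (Op OAnd [a, b]) = (bool_expr a \<and> bool_expr b)"
| "bool_expr _ = False"

text \<open>The flag permits assignments to variable 0, the only used variable of type
  \<open>iint\<close>, which cannot be assigned inside loops.\<close>

fun straight :: "bool \<Rightarrow> stmt \<Rightarrow> bool" and straight_list :: "bool \<Rightarrow> stmt list \<Rightarrow> bool" where
  "straight toplevel (Assign x e) = (x = vn (length x) \<and> length x \<in> used_vars \<and> (length x = 0 \<longrightarrow> toplevel) \<and> int_expr e)"
| "straight toplevel (Block ss) = straight_list toplevel ss"
| "straight toplevel (If e s1 s2) = (bool_expr e \<and> straight toplevel s1 \<and> straight toplevel s2)"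
| "straight toplevel _ = False"
| "straight_list toplevel [] = True"
| "straight_list toplevel (s # ss) = (straight toplevel s \<and> straight_list toplevel ss)"

lemma int_expr_mulc [simp]: "int_expr e \<Longrightarrow> int_expr (mulc n e)"
  by (induction n) simp_all

lemma eval_int_expr: "int_expr e \<Longrightarrow> holds_vals f \<Sigma> \<Longrightarrow> eval \<Sigma> e (VInt (int_eval f e))"
proof (induction e rule: int_expr.induct)
  case (1 x)
  then have "\<Sigma> x = Some (VInt (f (length x)))" unfolding holds_vals_def by (metis int_expr.simps(1))
  then show ?case by (auto intro: eval.EVar)
qed (auto intro!: eval.EOp eval.ENum simp: list_all2_Cons1 op_sem_def)

lemma eval_bool_expr: "bool_expr e \<Longrightarrow> holds_vals f \<Sigma> \<Longrightarrow> eval \<Sigma> e (VBool (bool_eval f e))"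
proof (induction e rule: bool_expr.induct)
  case (1 a b)
  then show ?case using eval_int_expr by (auto intro!: eval.EOp[where vs = "[VInt (int_eval f a), VInt (int_eval f b)]"] simp: op_sem_def)
next
  case (2 a b)
  then show ?case using eval_int_expr by (auto intro!: eval.EOp[where vs = "[VInt (int_eval f a), VInt (int_eval f b)]"] simp: op_sem_def)
next
  case (3 a b)
  then show ?case by (auto intro!: eval.EOp[where vs = "[VBool (bool_eval f a), VBool (bool_eval f b)]"] simp: op_sem_def)
qed auto

lemma ty_int_expr: "int_expr e \<Longrightarrow> good \<Gamma> \<Longrightarrow> \<exists>t. has_ty \<Gamma> l e t \<and> is_int_ty t"
proof (induction e rule: int_expr.induct)
  case (1 x)
  then obtain i where i: "x = vn i" "i \<in> used_vars" by auto
  then show ?case using 1(2) by (cases "i = 0") (auto simp: good_def is_int_ty_def intro!: has_ty.TVar)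
next
  case (2 n)
  then show ?case by (auto simp: is_int_ty_def intro: has_ty.TNum)
next
  case (3 a)
  then obtain t where "has_ty \<Gamma> l a t" "is_int_ty t" by auto
  then show ?case by (intro exI[of _ t]) (auto intro!: has_ty.TOp[where ts = "[t]"] simp: op_ty_def)
next
  case (4 a b)
  then obtain t u where "has_ty \<Gamma> l a t" "is_int_ty t" "has_ty \<Gamma> l b u" "is_int_ty u" by auto
  then show ?case by (intro exI[of _ "ty_sup t u"])
      (auto intro!: has_ty.TOp[where ts = "[t, u]"] simp: op_ty_def arith_ty_def ty_sup_def is_int_ty_def)
next
  case (5 a b)
  then obtain t u where "has_ty \<Gamma> l a t" "is_int_ty t" "has_ty \<Gamma> l b u" "is_int_ty u" by auto
  then show ?case by (intro exI[of _ "ty_sup t u"])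
      (auto intro!: has_ty.TOp[where ts = "[t, u]"] simp: op_ty_def arith_ty_def ty_sup_def is_int_ty_def)
next
  case (6 a b)
  then obtain t u where "has_ty \<Gamma> l a t" "is_int_ty t" "has_ty \<Gamma> l b u" "is_int_ty u" by auto
  then show ?case by (intro exI[of _ "ty_sup t u"])
      (auto intro!: has_ty.TOp[where ts = "[t, u]"] simp: op_ty_def arith_ty_def ty_sup_def is_int_ty_def)
next
  case (7 a b)
  then obtain t u where "has_ty \<Gamma> l a t" "is_int_ty t" "has_ty \<Gamma> l b u" "is_int_ty u" by auto
  then show ?case by (intro exI[of _ "ty_sup t u"])
      (auto intro!: has_ty.TOp[where ts = "[t, u]"] simp: op_ty_def arith_ty_def ty_sup_def is_int_ty_def)
qed auto

lemma ty_bool_expr: "bool_expr e \<Longrightarrow> good \<Gamma> \<Longrightarrow> has_ty \<Gamma> l e TBool"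
proof (induction e rule: bool_expr.induct)
  case (1 a b)
  then obtain t u where "has_ty \<Gamma> l a t" "is_int_ty t" "has_ty \<Gamma> l b u" "is_int_ty u" using ty_int_expr by (meson bool_expr.simps(1))
  then show ?case by (auto intro!: has_ty.TOp[where ts = "[t, u]"] simp: op_ty_def cmp_ty_def)
next
  case (2 a b)
  then obtain t u where "has_ty \<Gamma> l a t" "is_int_ty t" "has_ty \<Gamma> l b u" "is_int_ty u" using ty_int_expr by (meson bool_expr.simps(2))
  then show ?case by (auto intro!: has_ty.TOp[where ts = "[t, u]"] simp: op_ty_def cmp_ty_def)
next
  case (3 a b)
  then show ?case by (auto intro!: has_ty.TOp[where ts = "[TBool, TBool]"] simp: op_ty_def bool2_ty_def)
qed auto

lemma holds_vals_upd: "holds_vals f \<Sigma> \<Longrightarrow> holds_vals (f(i := x)) (\<Sigma>(vn i \<mapsto> VInt x))"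
  by (auto simp: holds_vals_def)

lemma holds_vals_upd_other: "holds_vals f \<Sigma> \<Longrightarrow> i \<notin> used_vars \<Longrightarrow> holds_vals f (\<Sigma>(vn i \<mapsto> x))"
  by (auto simp: holds_vals_def)

text \<open>The final store may depend on the initial one outside the used variables, but the final
  valuation depends on the initial valuation only.\<close>

definition exec_to :: "(nat \<Rightarrow> int) \<Rightarrow> stmt \<Rightarrow> (nat \<Rightarrow> int) \<Rightarrow> bool" where
  "exec_to f s f' \<longleftrightarrow> (\<forall>\<Sigma>. holds_vals f \<Sigma> \<longrightarrow> (\<exists>\<Sigma>'. exec \<Sigma> s \<Sigma>' \<and> holds_vals f' \<Sigma>'))"

definition execs_to :: "(nat \<Rightarrow> int) \<Rightarrow> stmt list \<Rightarrow> (nat \<Rightarrow> int) \<Rightarrow> bool" where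
  "execs_to f ss f' \<longleftrightarrow> (\<forall>\<Sigma>. holds_vals f \<Sigma> \<longrightarrow> (\<exists>\<Sigma>'. execs \<Sigma> ss \<Sigma>' \<and> holds_vals f' \<Sigma>'))"

lemma execs_to_Nil: "execs_to f [] f" unfolding execs_to_def using XNil by blast

lemma execs_to_Cons: "exec_to f s f1 \<Longrightarrow> execs_to f1 ss f2 \<Longrightarrow> execs_to f (s # ss) f2"
  unfolding execs_to_def exec_to_def by (meson XCons)

lemma execs_append: "execs \<Sigma> ss \<Sigma>1 \<Longrightarrow> execs \<Sigma>1 ss' \<Sigma>2 \<Longrightarrow> execs \<Sigma> (ss @ ss') \<Sigma>2"
  by (induction ss arbitrary: \<Sigma>) (auto elim!: execs_NilE execs_ConsE intro: XCons)

lemma execs_to_append: "execs_to f ss f1 \<Longrightarrow> execs_to f1 ss' f2 \<Longrightarrow> execs_to f (ss @ ss') f2"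
  unfolding execs_to_def by (meson execs_append)

lemma exec_to_straight:
  "straight toplevel s \<Longrightarrow> exec_to f s (stmt_eval s f)"
  "straight_list toplevel ss \<Longrightarrow> execs_to f ss (stmts_eval ss f)"
proof (induction toplevel s and toplevel ss arbitrary: f and f rule: straight_straight_list.induct)
  case (1 toplevel x e)
  show ?case unfolding exec_to_def
  proof (intro allI impI)
    fix \<Sigma> assume \<Sigma>: "holds_vals f \<Sigma>"
    obtain i where i: "x = vn i" "i \<in> used_vars" "int_expr e" using 1 by auto
    have "x \<in> dom \<Sigma>" using i \<Sigma> by (auto simp: holds_vals_def)
    then have "exec \<Sigma> (Assign x e) (\<Sigma>(x \<mapsto> VInt (int_eval f e)))"
      using eval_int_expr[OF i(3) \<Sigma>] by (rule XAssign)
    moreover have "holds_vals (stmt_eval (Assign x e) f) (\<Sigma>(x \<mapsto> VInt (int_eval f e)))"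
      using holds_vals_upd[OF \<Sigma>, of i] i by simp
    ultimately show "\<exists>\<Sigma>'. exec \<Sigma> (Assign x e) \<Sigma>' \<and> holds_vals (stmt_eval (Assign x e) f) \<Sigma>'" by blast
  qed
next
  case (2 toplevel ss)
  then show ?case unfolding exec_to_def execs_to_def by (simp, meson XBlock)
next
  case (3 toplevel e s1 s2)
  show ?case unfolding exec_to_def
  proof (intro allI impI)
    fix \<Sigma> assume \<Sigma>: "holds_vals f \<Sigma>"
    have b: "eval \<Sigma> e (VBool (bool_eval f e))" using 3 eval_bool_expr[OF _ \<Sigma>] by simp
    have ih: "exec_to f s1 (stmt_eval s1 f)" "exec_to f s2 (stmt_eval s2 f)" using 3 by simp_all
    show "\<exists>\<Sigma>'. exec \<Sigma> (If e s1 s2) \<Sigma>' \<and> holds_vals (stmt_eval (If e s1 s2) f) \<Sigma>'"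
    proof (cases "bool_eval f e")
      case True
      then obtain \<Sigma>' where "exec \<Sigma> s1 \<Sigma>'" "holds_vals (stmt_eval s1 f) \<Sigma>'" using ih(1) \<Sigma> unfolding exec_to_def by blast
      then show ?thesis using True b XIfT[of \<Sigma> e s1 \<Sigma>' s2] by auto
    next
      case False
      then obtain \<Sigma>' where "exec \<Sigma> s2 \<Sigma>'" "holds_vals (stmt_eval s2 f) \<Sigma>'" using ih(2) \<Sigma> unfolding exec_to_def by blast
      then show ?thesis using False b XIfF[of \<Sigma> e s2 \<Sigma>' s1] by auto
    qed
  qed
qed (auto intro: execs_to_Nil execs_to_Cons)

lemma ty_straight:
  "straight toplevel s \<Longrightarrow> (toplevel \<longrightarrow> \<not> l) \<Longrightarrow> good \<Gamma> \<Longrightarrow> stmt_ty \<Gamma> l s \<Gamma>"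
  "straight_list toplevel ss \<Longrightarrow> (toplevel \<longrightarrow> \<not> l) \<Longrightarrow> good \<Gamma> \<Longrightarrow> stmts_ty \<Gamma> l ss \<Gamma>"
proof (induction toplevel s and toplevel ss rule: straight_straight_list.induct)
  case (1 toplevel x e)
  then obtain t where t: "has_ty \<Gamma> l e t" "is_int_ty t" using ty_int_expr by (meson straight.simps(1))
  obtain i where i: "x = vn i" "i \<in> used_vars" "i = 0 \<longrightarrow> toplevel" using 1 by auto
  show ?case
  proof (cases "i = 0")
    case True
    then show ?thesis using t i 1(2,3)
      by (intro stmt_ty_stmts_ty.TAssign[where tx = TIInt]) (auto simp: good_def is_int_ty_def)
  next
    case False
    then show ?thesis using t i 1(2,3)
      by (intro stmt_ty_stmts_ty.TAssign[where tx = TInt]) (auto simp: good_def is_int_ty_def)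
  qed
next
  case (3 toplevel e s1 s2)
  then show ?case using ty_bool_expr by (auto intro!: stmt_ty_stmts_ty.TIf)
qed (auto intro: stmt_ty_stmts_ty.TBlock stmt_ty_stmts_ty.TNil stmt_ty_stmts_ty.TCons)

subsection \<open>Polynomially many iterations by nested loops\<close>

primrec nest :: "nat \<Rightarrow> stmt \<Rightarrow> stmt" where
  "nest 0 s = s"
| "nest (Suc d) s = For (vn (20 + m + d)) (Var (vn 0)) (nest d s)"

text \<open>The invariant fixes variable 0, so each nested loop makes \<open>blen Nv\<close> passes
  and the innermost statement runs exactly \<open>blen Nv ^ d\<close> times; the index of
  \<open>I\<close> counts these runs.\<close>

lemma exec_to_nest:
  assumes step: "\<And>t f. I t f \<Longrightarrow> \<exists>f'. exec_to f s f' \<and> I (Suc t) f'"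
    and N: "\<And>t f. I t f \<Longrightarrow> f 0 = Nv"
  shows "I t f \<Longrightarrow> \<exists>f'. exec_to f (nest d s) f' \<and> I (t + blen Nv ^ d) f'"
proof (induction d arbitrary: t f)
  case 0
  then show ?case using step by simp
next
  case (Suc d)
  let ?X = "blen Nv"
  let ?z = "vn (20 + m + d)"
  note outer = Suc.IH
  have z: "20 + m + d \<notin> used_vars" by (simp add: used_vars_def)
  \<comment> \<open>The rest of the outermost loop from pass \<open>j\<close> on, with
    \<open>n\<close> passes left. The valuation \<open>f'\<close> is chosen before the store, on
    which it must not depend.\<close>
  have lp: "\<exists>f'. (\<forall>\<Sigma>. holds_vals f \<Sigma> \<longrightarrow> (\<exists>\<Sigma>'. loop ?z (nest d s) (int j) (int ?X) \<Sigma> \<Sigma>' \<and> holds_vals f' \<Sigma>')) \<and> I (t + n * ?X ^ d) f'"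
    if "I t f" "j + n = ?X" for j n t f
    using that
  proof (induction n arbitrary: j t f)
    case 0
    then show ?case by (intro exI[of _ f]) (auto intro!: LStop)
  next
    case (Suc n)
    obtain f1 where f1: "exec_to f (nest d s) f1" "I (t + ?X ^ d) f1" using outer[OF Suc.prems(1)] by blast
    have jn: "Suc j + n = ?X" using Suc.prems(2) by simp
    obtain f' where f': "\<And>\<Sigma>. holds_vals f1 \<Sigma> \<Longrightarrow> \<exists>\<Sigma>'. loop ?z (nest d s) (int (Suc j)) (int ?X) \<Sigma> \<Sigma>' \<and> holds_vals f' \<Sigma>'"
      and I': "I (t + ?X ^ d + n * ?X ^ d) f'"
      using Suc.IH[OF f1(2) jn] by (elim exE conjE) (rule that, simp_all)
    have "\<exists>\<Sigma>'. loop ?z (nest d s) (int j) (int ?X) \<Sigma> \<Sigma>' \<and> holds_vals f' \<Sigma>'" if "holds_vals f \<Sigma>" for \<Sigma>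
    proof -
      have "holds_vals f (\<Sigma>(?z \<mapsto> VInt (int j)))" using holds_vals_upd_other[OF that z] .
      then obtain \<Sigma>1 where 1: "exec (\<Sigma>(?z \<mapsto> VInt (int j))) (nest d s) \<Sigma>1" "holds_vals f1 \<Sigma>1"
        using f1(1) unfolding exec_to_def by blast
      then obtain \<Sigma>' where 2: "loop ?z (nest d s) (int (Suc j)) (int ?X) \<Sigma>1 \<Sigma>'" "holds_vals f' \<Sigma>'" using f' by blast
      have "loop ?z (nest d s) (int j + 1) (int ?X) \<Sigma>1 \<Sigma>'" using 2(1) by (simp add: add.commute)
      then have "loop ?z (nest d s) (int j) (int ?X) \<Sigma> \<Sigma>'"
        using Suc.prems(2) by (intro LStep[OF _ 1(1)]) simp_all
      then show ?thesis using 2 by blast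
    qed
    then show ?case using I' by (intro exI[of _ f']) (auto simp: algebra_simps)
  qed
  obtain f' where f': "\<And>\<Sigma>. holds_vals f \<Sigma> \<Longrightarrow> \<exists>\<Sigma>'. loop ?z (nest d s) 0 (int ?X) \<Sigma> \<Sigma>' \<and> holds_vals f' \<Sigma>'"
    and I': "I (t + ?X * ?X ^ d) f'"
    using lp[OF Suc.prems, of 0 ?X] by auto
  have "exec_to f (nest (Suc d) s) f'"
    unfolding exec_to_def
  proof (intro allI impI)
    fix \<Sigma> assume \<Sigma>: "holds_vals f \<Sigma>"
    then obtain \<Sigma>' where 1: "loop ?z (nest d s) 0 (int ?X) \<Sigma> \<Sigma>'" "holds_vals f' \<Sigma>'" using f' by blast
    have "eval \<Sigma> (Var (vn 0)) (VInt Nv)"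
      using \<Sigma> N[OF Suc.prems] by (auto intro!: eval.EVar simp: holds_vals_def used_vars_def)
    then have "eval \<Sigma> (Op OSize [Var (vn 0)]) (VInt (int ?X))"
      by (intro eval.EOp[where vs = "[VInt Nv]"]) (auto simp: op_sem_def size_int_blen)
    then have "exec \<Sigma> (nest (Suc d) s) \<Sigma>'" using 1(1) by (simp add: XFor)
    then show "\<exists>\<Sigma>'. exec \<Sigma> (nest (Suc d) s) \<Sigma>' \<and> holds_vals f' \<Sigma>'" using 1 by blast
  qed
  then show ?case using I' by auto
qed

lemma good_upd: "good \<Gamma> \<Longrightarrow> i \<notin> used_vars \<Longrightarrow> good (\<Gamma>(vn i \<mapsto> t))"
  by (auto simp: good_def used_vars_def)

lemma ty_nest:
  assumes "straight False s"
  shows "good \<Gamma> \<Longrightarrow> \<forall>i<d. \<Gamma> (vn (20 + m + i)) = None \<Longrightarrow> stmt_ty \<Gamma> l (nest d s) \<Gamma>"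
proof (induction d arbitrary: \<Gamma> l)
  case 0
  then show ?case using ty_straight(1)[OF assms] by simp
next
  case (Suc d)
  let ?z = "vn (20 + m + d)"
  have "has_ty \<Gamma> l (Op OSize [Var (vn 0)]) TIInt"
    using Suc.prems(1) by (intro has_ty.TOp[where ts = "[TIInt]"]) (auto simp: op_ty_def good_def intro: has_ty.TVar)
  moreover have "?z \<notin> dom \<Gamma>" using Suc.prems(2) by auto
  moreover have "stmt_ty (\<Gamma>(?z \<mapsto> TIInt)) True (nest d s) (\<Gamma>(?z \<mapsto> TIInt))"
    using Suc.prems by (intro Suc.IH good_upd) (auto simp: used_vars_def)
  ultimately show ?case by (simp add: stmt_ty_stmts_ty.TFor)
qed

end

subsection \<open>Simulating a Turing machine\<close>

lemma tdiv_nat: "tdiv (int a) (int b) = int (a div b)"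
  by (auto simp: tdiv_def sgn_if zdiv_int)

lemma tmod_nat: "b \<noteq> 0 \<Longrightarrow> tmod (int a) (int b) = int (a mod b)"
  by (simp add: tmod_eq zmod_int)

text \<open>Pushing a digit below a base-\<open>g\<close> numeral moves all others up by one;
  together with \<open>digit_pop\<close> this makes a natural number a stack of tape cells.\<close>

lemma digit_push:
  fixes g :: nat
  assumes "y < g"
  shows "(g * x + y) div g ^ i mod g = (if i = 0 then y else x div g ^ (i - 1) mod g)"
proof (cases i)
  case (Suc j)
  have "(g * x + y) div g ^ Suc j = (g * x + y) div g div g ^ j" by (simp add: div_mult2_eq)
  also have "(g * x + y) div g = x" using assms by simp
  finally show ?thesis using Suc by simp
qed (use assms in simp)

lemma digit_pop: "(x div g) div g ^ i = x div (g :: nat) ^ Suc i"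
  by (simp add: div_mult2_eq)

text \<open>The first symbol is the least significant digit, so the cell under the initial head is
  the remainder modulo \<open>g\<close>, and the absent high digits are 0, the blank.\<close>

primrec num :: "nat \<Rightarrow> nat list \<Rightarrow> nat" where
  "num g [] = 0"
| "num g (a # w) = g * num g w + a"

lemma digit_num: "\<forall>a\<in>set w. a < g \<Longrightarrow> num g w div g ^ i mod g = (if i < length w then w ! i else 0)"
proof (induction w arbitrary: i)
  case (Cons a w)
  then show ?case by (cases i) (simp_all add: digit_push del: power_Suc)
qed simp

lemma power_bit_length_le: "2 ^ bit_length v \<le> 2 * \<bar>v\<bar> + 2"
proof -
  have "0 < n \<Longrightarrow> 2 ^ length (bin n) \<le> 2 * n" for n
  proof (induction n rule: bin.induct)
    case (1 n)
    then have b: "bin n = bin (n div 2) @ [n mod 2 + 1]" by (subst bin.simps) simp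
    show ?case
    proof (cases "n div 2 = 0")
      case True
      then have "bin n = [n mod 2 + 1]" unfolding b by (simp add: bin.simps[of 0])
      then show ?thesis using 1(2) by simp
    next
      case False
      then have "2 ^ length (bin (n div 2)) \<le> 2 * (n div 2)" using 1 by simp
      then show ?thesis unfolding b by simp
    qed
  qed
  from this[of "nat \<bar>v\<bar>"] have "2 ^ length (bin (nat \<bar>v\<bar>)) \<le> 2 * nat \<bar>v\<bar> + 2"
    by (cases "v = 0") (simp_all add: bin.simps[of 0])
  then have "int (2 ^ length (bin (nat \<bar>v\<bar>))) \<le> int (2 * nat \<bar>v\<bar> + 2)" by (simp only: of_nat_le_iff)
  then show ?thesis by (simp add: bit_length_def)
qed

text \<open>Explains the loop bound: the sum dominates \<open>2 |v| + 2\<close>, hence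
  \<open>2 ^ bit_length v\<close>, for every single input, while computing it takes only additions,
  subtractions and sign tests.\<close>

lemma bit_length_le_blen:
  assumes "v \<in> set vs"
  shows "bit_length v \<le> blen (2 + (\<Sum>v\<leftarrow>vs. 2 * \<bar>v\<bar>))"
proof -
  have "2 * \<bar>v\<bar> \<le> (\<Sum>v\<leftarrow>vs. 2 * \<bar>v\<bar>)"
    using assms by (intro member_le_sum_list) auto
  then have "2 ^ bit_length v \<le> \<bar>2 + (\<Sum>v\<leftarrow>vs. 2 * \<bar>v\<bar>)\<bar>" using power_bit_length_le[of v] by linarith
  then show ?thesis using less_blen_iff[of "bit_length v"] by (metis order_less_imp_le)
qed

lemma stmts_ty_append: "stmts_ty \<Gamma> l ss \<Gamma>1 \<Longrightarrow> stmts_ty \<Gamma>1 l ss' \<Gamma>2 \<Longrightarrow> stmts_ty \<Gamma> l (ss @ ss') \<Gamma>2"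
proof (induction ss arbitrary: \<Gamma>)
  case Nil
  then show ?case by (auto elim: stmts_ty.cases)
next
  case (Cons s ss)
  from Cons.prems(1) obtain \<Gamma>' where "stmt_ty \<Gamma> l s \<Gamma>'" "stmts_ty \<Gamma>' l ss \<Gamma>1"
    by (auto elim: stmts_ty.cases)
  then show ?case using Cons.IH Cons.prems(2) by (auto intro: stmt_ty_stmts_ty.TCons)
qed

lemma stmts_ty_all: "\<forall>s\<in>set ss. stmt_ty \<Gamma> l s \<Gamma> \<Longrightarrow> stmts_ty \<Gamma> l ss \<Gamma>"
  by (induction ss) (auto intro: stmt_ty_stmts_ty.TNil stmt_ty_stmts_ty.TCons)

abbreviation (input) "V i \<equiv> Var (vn i)"

locale simulation = numbered_vars m for m :: nat +
  fixes M :: tm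
  assumes wf: "wf_tm M"
begin

abbreviation "g \<equiv> tm_syms M"

lemma g6: "6 \<le> g" using wf by (simp add: wf_tm_def)
lemma g0 [simp]: "g \<noteq> 0" "0 < g" "\<not> g = 0" using g6 by linarith+

text \<open>Variables: 0 = loop bound, 1 = state, 2 and 3 = tape left of the head and from the head on
  (base-\<open>g\<close> numerals, nearest cell least significant), 4 = head position, 5 = scanned symbol,
  6 = result, 7 = sign symbol, 8 = input being unpacked.\<close>

definition move_right :: stmt where
  "move_right = Block [Assign (vn 2) (Op OAdd [mulc g (V 2), Op OMod [V 3, Num g]]),
     Assign (vn 3) (Op ODiv [V 3, Num g]), Assign (vn 4) (Op OAdd [V 4, Num 1])]"

definition move_left :: stmt where
  "move_left = Block [Assign (vn 3) (Op OAdd [mulc g (V 3), Op OMod [V 2, Num g]]),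
     Assign (vn 2) (Op ODiv [V 2, Num g]), Assign (vn 4) (Op OSub [V 4, Num 1])]"

text \<open>Writing replaces the lowest digit of variable 3: the scanned symbol, kept in variable 5,
  is subtracted and the new one added. In the halting state nothing happens, as in
  \<open>tm_step\<close>.\<close>

definition act :: "nat \<Rightarrow> nat \<Rightarrow> stmt" where
  "act q a = (if q = tm_halt M then Block [] else case tm_delta M q a of (q', b, d) \<Rightarrow>
     Block [Assign (vn 1) (Num q'), Assign (vn 3) (Op OAdd [Op OSub [V 3, V 5], Num b]),
       (if d = 1 then move_right else if d = -1 then move_left else Block [])])"

primrec chain :: "(nat \<times> nat) list \<Rightarrow> stmt" where
  "chain [] = Block []"
| "chain (p # ps) = If (Op OAnd [Op OEq [V 1, Num (fst p)], Op OEq [V 5, Num (snd p)]])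
     (act (fst p) (snd p)) (chain ps)"

definition step :: stmt where
  "step = Block [Assign (vn 5) (Op OMod [V 3, Num g]), chain (List.product [0..<tm_states M] [0..<g])]"

text \<open>The result is read from cell 0, but the machine may halt with its head anywhere;
  variable 4 shows the direction in which to return.\<close>

definition home :: stmt where
  "home = If (Op OLt [Num 0, V 4]) move_left (If (Op OLt [V 4, Num 0]) move_right (Block []))"

text \<open>One step of Horner's rule on the digit symbols. At the blank after the word it leaves
  tape and result unchanged, so it may be iterated too often.\<close>

definition out_step :: stmt where
  "out_step = Block [Assign (vn 5) (Op OMod [V 3, Num g]), If (Op OEq [V 5, Num 0]) (Block [])
     (Block [Assign (vn 6) (Op OAdd [Op OAdd [V 6, V 6], Op OSub [V 5, Num 1]]), Assign (vn 3) (Op ODiv [V 3, Num g])])]"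

text \<open>Moves the lowest binary digit of variable 8 onto the tape as a symbol. Once variable 8
  is 0 it idles, so any sufficient number of passes is right.\<close>

definition load_step :: stmt where
  "load_step = If (Op OEq [V 8, Num 0]) (Block [])
     (Block [Assign (vn 3) (Op OAdd [mulc g (V 3), Op OAdd [Op OMod [V 8, Num 2], Num 1]]), Assign (vn 8) (Op ODiv [V 8, Num 2])])"

lemma used_vars_small [simp]: "i \<le> 8 \<Longrightarrow> i \<in> used_vars" by (simp add: used_vars_def)

lemma straight_move [simp]: "straight toplevel move_right" "straight toplevel move_left"
  by (simp_all add: move_right_def move_left_def)

lemma straight_chain: "straight toplevel (chain ps)"
  by (induction ps) (simp_all add: act_def split: prod.splits)

lemma straight_step [simp]: "straight toplevel step" "straight toplevel home" "straight toplevel out_step" "straight toplevel load_step"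
  by (simp_all add: step_def home_def out_step_def load_step_def straight_chain)

text \<open>Stated digit by digit for all \<open>i\<close>, so that the zeros above the leading
  digit of a numeral represent the blank rest of the tape.\<close>

definition trel :: "(int \<Rightarrow> nat) \<Rightarrow> int \<Rightarrow> nat \<Rightarrow> nat \<Rightarrow> bool" where
  "trel tp h l r \<longleftrightarrow> (\<forall>i. l div g ^ i mod g = tp (h - 1 - int i)) \<and> (\<forall>i. r div g ^ i mod g = tp (h + int i))"

lemma trel_right:
  assumes "trel tp h l r"
  shows "trel tp (h + 1) (g * l + r mod g) (r div g)"
proof -
  have l: "l div g ^ i mod g = tp (h - 1 - int i)" and r: "r div g ^ i mod g = tp (h + int i)" for i
    using assms by (auto simp: trel_def)
  have "(g * l + r mod g) div g ^ i mod g = tp (h + 1 - 1 - int i)" for i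
  proof -
    have "(g * l + r mod g) div g ^ i mod g = (if i = 0 then r mod g else l div g ^ (i - 1) mod g)"
      by (rule digit_push) simp
    moreover have "tp h = r mod g" using r[of 0] by simp
    ultimately show ?thesis using l[of "i - 1"] by (cases i) (simp_all add: algebra_simps)
  qed
  moreover have "r div g div g ^ i mod g = tp (h + 1 + int i)" for i
    using r[of "Suc i"] unfolding digit_pop by (simp add: algebra_simps)
  ultimately show ?thesis unfolding trel_def by blast
qed

lemma trel_left:
  assumes "trel tp h l r"
  shows "trel tp (h - 1) (l div g) (g * r + l mod g)"
proof -
  have l: "l div g ^ i mod g = tp (h - 1 - int i)" and r: "r div g ^ i mod g = tp (h + int i)" for i
    using assms by (auto simp: trel_def)
  have "(g * r + l mod g) div g ^ i mod g = tp (h - 1 + int i)" for i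
  proof -
    have "(g * r + l mod g) div g ^ i mod g = (if i = 0 then l mod g else r div g ^ (i - 1) mod g)"
      by (rule digit_push) simp
    moreover have "tp (h - 1) = l mod g" using l[of 0] by simp
    ultimately show ?thesis using r[of "i - 1"] by (cases i) (simp_all add: algebra_simps)
  qed
  moreover have "l div g div g ^ i mod g = tp (h - 1 - 1 - int i)" for i
    using l[of "Suc i"] unfolding digit_pop by (simp add: algebra_simps)
  ultimately show ?thesis unfolding trel_def by blast
qed

lemma trel_write:
  assumes "trel tp h l r" "b < g"
  shows "trel (tp(h := b)) h l (r - r mod g + b)"
proof -
  have l: "l div g ^ i mod g = tp (h - 1 - int i)" and r: "r div g ^ i mod g = tp (h + int i)" for i
    using assms by (auto simp: trel_def)
  have e: "r - r mod g + b = g * (r div g) + b" by (simp add: minus_mod_eq_mult_div)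
  have "(r - r mod g + b) div g ^ i mod g = (tp(h := b)) (h + int i)" for i
  proof (cases i)
    case (Suc j)
    have "(r - r mod g + b) div g ^ i mod g = r div g div g ^ j mod g"
      unfolding e using assms(2) Suc by (simp add: digit_push del: power_Suc)
    then show ?thesis unfolding digit_pop using r[of "Suc j"] Suc by simp
  qed (use assms(2) in \<open>simp add: e\<close>)
  then show ?thesis using l unfolding trel_def by auto
qed

lemma stmt_eval_move:
  assumes "f 2 = int l" "f 3 = int r"
  shows "stmt_eval move_right f = f(2 := int (g * l + r mod g), 3 := int (r div g), 4 := f 4 + 1)"
    and "stmt_eval move_left f = f(3 := int (g * r + l mod g), 2 := int (l div g), 4 := f 4 - 1)"
  using assms by (simp_all add: move_right_def move_left_def tmod_nat tdiv_nat)

lemma stmt_eval_chain: "f 1 = int q \<Longrightarrow> f 5 = int a \<Longrightarrow> (q, a) \<in> set ps \<Longrightarrow> stmt_eval (chain ps) f = stmt_eval (act q a) f"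
  by (induction ps) auto

definition cfg :: "(nat \<Rightarrow> int) \<Rightarrow> config \<Rightarrow> bool" where
  "cfg f c \<longleftrightarrow> (case c of (q, tp, h) \<Rightarrow>
     f 1 = int q \<and> f 4 = h \<and> (\<exists>l r. f 2 = int l \<and> f 3 = int r \<and> trel tp h l r))"

lemma stmt_eval_step:
  assumes c: "cfg f (q, tp, h)" and q: "q < tm_states M"
  shows "cfg (stmt_eval step f) (tm_step M (q, tp, h)) \<and> (\<forall>i. i \<notin> {1..5} \<longrightarrow> stmt_eval step f i = f i)"
proof -
  from c obtain l r where f: "f 1 = int q" "f 4 = h" "f 2 = int l" "f 3 = int r" and t: "trel tp h l r"
    unfolding cfg_def by auto
  have "r div g ^ 0 mod g = tp (h + int 0)" using t unfolding trel_def by blast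
  then have a: "r mod g = tp h" by simp
  have ag: "tp h < g" unfolding a[symmetric] by simp
  define f1 where "f1 = f(5 := int (tp h))"
  have s: "stmt_eval step f = stmt_eval (act q (tp h)) f1"
  proof -
    have "stmt_eval step f = stmt_eval (chain (List.product [0..<tm_states M] [0..<g])) f1"
      using f a by (simp add: step_def f1_def tmod_nat)
    also have "\<dots> = stmt_eval (act q (tp h)) f1" using f q ag by (intro stmt_eval_chain) (auto simp: f1_def)
    finally show ?thesis .
  qed
  show ?thesis
  proof (cases "q = tm_halt M")
    case True
    then have "stmt_eval step f = f1" by (simp add: s act_def)
    then show ?thesis using True f t by (auto simp: f1_def cfg_def tm_step_def)
  next
    case False
    obtain q' b d where d: "tm_delta M q (tp h) = (q', b, d)" by (metis prod_cases3)
    have w: "b < g" "d \<in> {-1, 0, 1}" using wf q ag d unfolding wf_tm_def by fastforce+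
    define R where "R = r - r mod g + b"
    define f2 where "f2 = f1(1 := int q', 3 := int R)"
    \<comment> \<open>The subtraction in \<open>R\<close> is on naturals and is exact because
      \<open>r mod g \<le> r\<close>.\<close>
    have "int r - int (tp h) + int b = int R"
      unfolding a[symmetric] R_def of_nat_add by (subst of_nat_diff) simp_all
    then have s2: "stmt_eval step f = stmt_eval (if d = 1 then move_right else if d = -1 then move_left else Block []) f2"
      using False f d by (simp add: s act_def f2_def f1_def)
    have ts: "tm_step M (q, tp, h) = (q', tp(h := b), h + d)" using False d by (simp add: tm_step_def)
    have t2: "trel (tp(h := b)) h l R" unfolding R_def by (rule trel_write[OF t w(1)])
    have f2: "f2 1 = int q'" "f2 2 = int l" "f2 3 = int R" "f2 4 = h" using f by (simp_all add: f2_def f1_def)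
    consider "d = 1" | "d = -1" | "d = 0" using w(2) by auto
    then show ?thesis
    proof cases
      case 1
      have "stmt_eval step f = f2(2 := int (g * l + R mod g), 3 := int (R div g), 4 := f2 4 + 1)"
        unfolding s2 using 1 stmt_eval_move(1)[OF f2(2,3)] by simp
      then show ?thesis unfolding ts cfg_def using 1 f2 trel_right[OF t2]
        by (auto simp: f2_def f1_def simp del: of_nat_add of_nat_mult)
    next
      case 2
      have "stmt_eval step f = f2(3 := int (g * R + l mod g), 2 := int (l div g), 4 := f2 4 - 1)"
        unfolding s2 using 2 stmt_eval_move(2)[OF f2(2,3)] by simp
      then show ?thesis unfolding ts cfg_def using 2 f2 trel_left[OF t2]
        by (auto simp: f2_def f1_def simp del: of_nat_add of_nat_mult)
    next
      case 3
      then have "stmt_eval step f = f2" unfolding s2 by simp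
      then show ?thesis unfolding ts cfg_def using 3 f2 t2 by (auto simp: f2_def f1_def)
    qed
  qed
qed

lemma tm_step_eq: "tm_step M (q, tp, h) = (if q = tm_halt M then (q, tp, h)
     else case tm_delta M q (tp h) of (q', b, d) \<Rightarrow> (q', tp(h := b), h + d))"
  by (simp add: tm_step_def)

text \<open>Limits what \<open>t\<close> steps can reach: the head is at distance at most
  \<open>t\<close>, which bounds the way home, and cells from \<open>length w + t\<close> on are
  blank, which bounds the length of the output.\<close>

lemma config_invariant:
  assumes "\<forall>a\<in>set w. a < g"
  shows "case (tm_step M ^^ t) (init_config M w) of (q, tp, h) \<Rightarrow>
     q < tm_states M \<and> \<bar>h\<bar> \<le> int t \<and> (\<forall>x. tp x < g) \<and> (\<forall>x. int (length w + t) \<le> x \<longrightarrow> tp x = 0)"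
proof (induction t)
  case 0
  show ?case using assms wf by (auto simp: init_config_def wf_tm_def)
next
  case (Suc t)
  obtain q tp h where c: "(tm_step M ^^ t) (init_config M w) = (q, tp, h)" by (metis prod_cases3)
  with Suc have i: "q < tm_states M" "\<bar>h\<bar> \<le> int t" "\<forall>x. tp x < g" "\<forall>x. int (length w + t) \<le> x \<longrightarrow> tp x = 0" by auto
  obtain q' b d where d: "tm_delta M q (tp h) = (q', b, d)" by (metis prod_cases3)
  have "\<forall>q<tm_states M. \<forall>a<g.
      case tm_delta M q a of (q', b, d) \<Rightarrow> q' < tm_states M \<and> b < g \<and> d \<in> {-1, 0, 1}"
    using wf unfolding wf_tm_def by (elim conjE)
  then have "case tm_delta M q (tp h) of (q', b, d) \<Rightarrow> q' < tm_states M \<and> b < g \<and> d \<in> {-1, 0, 1}"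
    using i(1,3) by (metis (no_types, lifting))
  then have w: "q' < tm_states M" "b < g" "d \<in> {-1, 0, 1}" unfolding d by simp_all
  show ?case
  proof (cases "q = tm_halt M")
    case True
    then have "(tm_step M ^^ Suc t) (init_config M w) = (q, tp, h)" using c by (simp add: tm_step_eq)
    then show ?thesis using i by auto
  next
    case False
    then have eq: "(tm_step M ^^ Suc t) (init_config M w) = (q', tp(h := b), h + d)"
      using c d by (simp add: tm_step_eq)
    have "\<bar>h + d\<bar> \<le> int (Suc t)" using i(2) w(3) by auto
    moreover have "(tp(h := b)) x < g" for x using i(3) w(2) by simp
    moreover have "(tp(h := b)) x = 0" if "int (length w + Suc t) \<le> x" for x
    proof -
      have "h < x" using i(2) abs_ge_self[of h] that by simp
      then show ?thesis using i(4) that by simp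
    qed
    ultimately show ?thesis unfolding eq prod.case using w(1) by blast
  qed
qed

lemma halted_stays:
  assumes "(tm_step M ^^ t) c = (tm_halt M, tp, h)" "t \<le> T"
  shows "(tm_step M ^^ T) c = (tm_halt M, tp, h)"
proof -
  have "(tm_step M ^^ n) (tm_halt M, tp, h) = (tm_halt M, tp, h)" for n
    by (induction n) (simp_all add: tm_step_def)
  then have "(tm_step M ^^ ((T - t) + t)) c = (tm_halt M, tp, h)"
    by (simp only: funpow_add o_apply assms(1))
  then show ?thesis using assms(2) by simp
qed

text \<open>Adds \<open>2 |v|\<close> to variable 0, splitting on the sign as there is no absolute
  value. Here an \<open>int\<close> enters an \<open>iint\<close> variable, which the typing rules
  admit only outside loops.\<close>

definition add_bound :: "nat \<Rightarrow> stmt" where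
  "add_bound i = If (Op OLt [V i, Num 0]) (Assign (vn 0) (Op OSub [V 0, Op OAdd [V i, V i]]))
     (Assign (vn 0) (Op OAdd [V 0, Op OAdd [V i, V i]]))"

text \<open>Symbols are pushed in front of the word, so an encoding is produced backwards: separator
  5, digits from the least significant, sign. For the same reason \<open>load\<close> starts with
  the last input.\<close>

definition load_one :: "nat \<Rightarrow> stmt list" where
  "load_one i = [Assign (vn 3) (Op OAdd [mulc g (V 3), Num 5]),
     If (Op OLt [V i, Num 0]) (Assign (vn 8) (Op ONeg [V i])) (Assign (vn 8) (V i)),
     nest 1 load_step,
     If (Op OLt [V i, Num 0]) (Assign (vn 3) (Op OAdd [mulc g (V 3), Num 4]))
       (Assign (vn 3) (Op OAdd [mulc g (V 3), Num 3]))]"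

primrec load :: "nat list \<Rightarrow> stmt list" where
  "load [] = []"
| "load (i # is) = load is @ load_one i"

definition decls :: "stmt list" where
  "decls = [Decl TIInt (vn 0), Decl TInt (vn 1), Decl TInt (vn 2), Decl TInt (vn 3), Decl TInt (vn 4),
     Decl TInt (vn 5), Decl TInt (vn 6), Decl TInt (vn 7), Decl TInt (vn 8)]"

text \<open>Variable 7 saves the sign symbol while the digits are read off. The exponent
  \<open>K\<close> is left open, to be fixed by the time bound of the machine.\<close>

definition main :: "nat \<Rightarrow> stmt list" where
  "main K = [Assign (vn 0) (Num 2)] @ map add_bound [20..<20 + m] @ load [20..<20 + m] @
     [Assign (vn 1) (Num (tm_start M)), nest K step, nest K home,
      Assign (vn 7) (Op OMod [V 3, Num g]), Assign (vn 3) (Op ODiv [V 3, Num g]), nest K out_step,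
      If (Op OEq [V 7, Num 4]) (Assign (vn 6) (Op ONeg [V 6])) (Block [])]"

definition prog :: "nat \<Rightarrow> prog" where
  "prog K = \<lparr>params = map vn [20..<20 + m], body = decls @ main K, ret = V 6\<rparr>"

section \<open>Typing of the simulating program\<close>

lemma map_upds_vn:
  "length ys = n \<Longrightarrow> (F(map vn [a..<a + n] [\<mapsto>] ys)) (vn i) =
     (if a \<le> i \<and> i < a + n then Some (ys ! (i - a)) else F (vn i))"
proof (induction n arbitrary: a ys F)
  case (Suc n)
  then obtain y ys' where ys: "ys = y # ys'" "length ys' = n" by (cases ys) auto
  have "[a..<a + Suc n] = a # [Suc a..<Suc a + n]" by (simp add: upt_conv_Cons)
  then have "(F(map vn [a..<a + Suc n] [\<mapsto>] ys)) (vn i) = ((F(vn a \<mapsto> y))(map vn [Suc a..<Suc a + n] [\<mapsto>] ys')) (vn i)"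
    using ys by (simp del: upt_Suc fun_upd_apply)
  also have "\<dots> = (if Suc a \<le> i \<and> i < Suc a + n then Some (ys' ! (i - Suc a)) else (F(vn a \<mapsto> y)) (vn i))"
    by (rule Suc.IH[OF ys(2)])
  also have "\<dots> = (if a \<le> i \<and> i < a + Suc n then Some (ys ! (i - a)) else F (vn i))"
    using ys by (auto simp: nth_Cons')
  finally show ?case .
qed auto

lemma stmts_ty_Decl:
  "x \<notin> dom \<Gamma> \<Longrightarrow> \<not> (l \<and> t = TIInt) \<Longrightarrow> stmts_ty (\<Gamma>(x \<mapsto> t)) l ss \<Gamma>' \<Longrightarrow> stmts_ty \<Gamma> l (Decl t x # ss) \<Gamma>'"
  by (rule stmt_ty_stmts_ty.TCons[OF stmt_ty_stmts_ty.TDecl])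

lemma execs_Decl:
  "is_int_ty t \<Longrightarrow> execs (\<Sigma>(x \<mapsto> VInt 0)) ss \<Sigma>' \<Longrightarrow> execs \<Sigma> (Decl t x # ss) \<Sigma>'"
  by (rule XCons[OF XDeclI])

lemma exec_to_straightI: "straight True s \<Longrightarrow> stmt_eval s f = f' \<Longrightarrow> exec_to f s f'"
  using exec_to_straight(1) by blast

lemma well_typed_prog: "well_typed (prog K)"
proof -
  define \<Gamma>0 where "\<Gamma>0 = (Map.empty(map vn [20..<20 + m] [\<mapsto>] replicate m TInt) :: tyenv)"
  have g0: "\<Gamma>0 (vn i) = (if 20 \<le> i \<and> i < 20 + m then Some TInt else None)" for i
    unfolding \<Gamma>0_def by (subst map_upds_vn) (auto simp: less_diff_conv2)
  define \<Gamma> where "\<Gamma> = \<Gamma>0(vn 0 \<mapsto> TIInt, vn 1 \<mapsto> TInt, vn 2 \<mapsto> TInt, vn 3 \<mapsto> TInt, vn 4 \<mapsto> TInt,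
     vn 5 \<mapsto> TInt, vn 6 \<mapsto> TInt, vn 7 \<mapsto> TInt, vn 8 \<mapsto> TInt)"
  have dec: "stmts_ty \<Gamma>0 False decls \<Gamma>"
    unfolding decls_def \<Gamma>_def
    by (intro stmts_ty_Decl stmt_ty_stmts_ty.TNil) (auto simp: g0 domIff)
  have good: "good \<Gamma>"
    unfolding good_def used_vars_def \<Gamma>_def by (auto simp: g0)
  have fresh: "\<forall>i<d. \<Gamma> (vn (20 + m + i)) = None" for d by (simp add: \<Gamma>_def g0)
  have nest: "stmt_ty \<Gamma> False (nest d s) \<Gamma>" if "straight False s" for d s
    by (rule ty_nest[OF that good fresh])
  have iD: "i \<in> used_vars" if "i \<in> set [20..<20 + m]" for i using that by (auto simp: used_vars_def)
  have ld: "\<forall>s\<in>set (load is). stmt_ty \<Gamma> False s \<Gamma>" if "set is \<subseteq> used_vars" for "is"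
    using that
  proof (induction "is")
    case (Cons i "is")
    have "stmt_ty \<Gamma> False s \<Gamma>" if "s \<in> set (load_one i)" for s
    proof -
      have "s = nest 1 load_step \<or> straight True s" using that Cons.prems by (auto simp: load_one_def simp del: nest.simps)
      then show ?thesis using nest[OF straight_step(4)] ty_straight(1)[of True s False \<Gamma>] good by blast
    qed
    then show ?case using Cons by auto
  qed simp
  have "\<forall>s\<in>set (main K). stmt_ty \<Gamma> False s \<Gamma>"
  proof
    fix s assume "s \<in> set (main K)"
    then consider "s \<in> set (load [20..<20 + m])" | "s = nest K step" | "s = nest K home" | "s = nest K out_step" | "straight True s"
      using iD by (auto simp: main_def add_bound_def)
    then show "stmt_ty \<Gamma> False s \<Gamma>"
    proof cases
      case 1
      then show ?thesis using ld[of "[20..<20 + m]"] iD by blast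
    next
      case 5
      then show ?thesis using ty_straight(1)[of True s False \<Gamma>] good by blast
    qed (use nest straight_step in auto)
  qed
  then have "stmts_ty \<Gamma> False (main K) \<Gamma>" by (rule stmts_ty_all)
  then have "stmts_ty \<Gamma>0 False (decls @ main K) \<Gamma>" using dec stmts_ty_append by blast
  moreover have "has_ty \<Gamma> False (V 6) TInt" using good by (intro has_ty.TVar) (auto simp: good_def)
  ultimately show ?thesis
    unfolding well_typed_def prog_def \<Gamma>0_def by (auto simp: is_int_ty_def)
qed

section \<open>Correctness of the simulating program\<close>

lemma stmts_eval_add_bound:
  assumes "\<forall>i\<in>set is. i \<noteq> 0"
  shows "stmts_eval (map add_bound is) f = f(0 := f 0 + (\<Sum>i\<leftarrow>is. 2 * \<bar>f i\<bar>))"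
  using assms
proof (induction "is" arbitrary: f)
  case (Cons i "is")
  have s: "stmt_eval (add_bound i) f = f(0 := f 0 + 2 * \<bar>f i\<bar>)" using Cons.prems by (simp add: add_bound_def)
  let ?A = "f 0 + 2 * \<bar>f i\<bar>"
  have eq: "map (\<lambda>j. 2 * \<bar>(f(0 := ?A)) j\<bar>) is = map (\<lambda>j. 2 * \<bar>f j\<bar>) is"
    using Cons.prems by auto
  have "stmts_eval (map add_bound (i # is)) f = stmts_eval (map add_bound is) (f(0 := ?A))" by (simp add: s)
  also have "\<dots> = (f(0 := ?A))(0 := (f(0 := ?A)) 0 + (\<Sum>j\<leftarrow>is. 2 * \<bar>(f(0 := ?A)) j\<bar>))"
    using Cons.prems by (intro Cons.IH) simp
  also have "\<dots> = f(0 := f 0 + (\<Sum>i\<leftarrow>i # is. 2 * \<bar>f i\<bar>))"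
    unfolding eq by (simp add: add.assoc)
  finally show ?case .
qed simp

lemma exec_to_load_step:
  assumes "f 8 = int n" "f 3 = int (num g u)" "f 0 = Nv" "length (bin n) \<le> blen Nv"
  shows "\<exists>f'. exec_to f (nest 1 load_step) f' \<and> f' 3 = int (num g (bin n @ u)) \<and> (\<forall>i. i \<noteq> 3 \<longrightarrow> i \<noteq> 8 \<longrightarrow> f' i = f i)"
proof -
  \<comment> \<open>The digits still in variable 8 followed by the word on the tape always make up
    the final word. Truncated subtraction covers the idle passes after variable 8 has reached
    0.\<close>
  define I where "I t f' \<longleftrightarrow> (\<exists>n' u'. f' 8 = int n' \<and> f' 3 = int (num g u') \<and> bin n' @ u' = bin n @ u \<and>
     length (bin n') = length (bin n) - t \<and> (\<forall>i. i \<noteq> 3 \<longrightarrow> i \<noteq> 8 \<longrightarrow> f' i = f i))" for t f'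
  have I0: "I 0 f" unfolding I_def using assms by (intro exI[of _ n] exI[of _ u]) simp
  have "\<exists>f'. exec_to f (nest 1 load_step) f' \<and> I (0 + blen Nv ^ 1) f'"
  proof (rule exec_to_nest[where I = I, OF _ _ I0])
    fix t f1 assume I: "I t f1"
    then show "f1 0 = Nv" unfolding I_def using assms by auto
    from I obtain n' u' where n': "f1 8 = int n'" "f1 3 = int (num g u')" "bin n' @ u' = bin n @ u"
      "length (bin n') = length (bin n) - t" and fr: "\<forall>i. i \<noteq> 3 \<longrightarrow> i \<noteq> 8 \<longrightarrow> f1 i = f i" unfolding I_def by blast
    have "I (Suc t) (stmt_eval load_step f1)"
    proof (cases "n' = 0")
      case True
      then have "stmt_eval load_step f1 = f1" using n' by (simp add: load_step_def)
      moreover have "length (bin n) - t = 0" using n'(4) True by (simp add: bin.simps[of 0])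
      ultimately show ?thesis unfolding I_def using n' fr True
        by (intro exI[of _ n'] exI[of _ u']) (auto simp: bin.simps[of 0])
    next
      case False
      have b: "bin n' = bin (n' div 2) @ [n' mod 2 + 1]" using False by (subst bin.simps) simp
      have t2: "tmod (int n') 2 = int (n' mod 2)" "tdiv (int n') 2 = int (n' div 2)"
        using tmod_nat[of 2 n'] tdiv_nat[of n' 2] by simp_all
      have "stmt_eval load_step f1 = f1(3 := int (num g ((n' mod 2 + 1) # u')), 8 := int (n' div 2))"
        using False n' t2 by (simp add: load_step_def algebra_simps)
      then show ?thesis unfolding I_def using n' fr b
        by (intro exI[of _ "n' div 2"] exI[of _ "(n' mod 2 + 1) # u'"]) auto
    qed
    then show "\<exists>f'. exec_to f1 load_step f' \<and> I (Suc t) f'" using exec_to_straight(1)[OF straight_step(4)] by blast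
  qed
  then obtain f' where f': "exec_to f (nest 1 load_step) f'" "I (blen Nv) f'" by auto
  from f'(2) obtain n' u' where n': "f' 3 = int (num g u')" "bin n' @ u' = bin n @ u" "length (bin n') = 0"
    "\<forall>i. i \<noteq> 3 \<longrightarrow> i \<noteq> 8 \<longrightarrow> f' i = f i" unfolding I_def using assms(4) by auto
  then have "u' = bin n @ u" by simp
  then show ?thesis using f'(1) n' by blast
qed

lemma execs_to_load_one:
  assumes i: "20 \<le> i" "i < 20 + m" and f: "f i = v" "f 3 = int (num g w)" "f 0 = Nv" "bit_length v \<le> blen Nv"
  shows "\<exists>f'. execs_to f (load_one i) f' \<and> f' 3 = int (num g (enc_int v @ 5 # w)) \<and> (\<forall>j. j \<noteq> 3 \<longrightarrow> j \<noteq> 8 \<longrightarrow> f' j = f j)"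
proof -
  have iD: "i \<in> used_vars" using i by (simp add: used_vars_def)
  define f1 where "f1 = f(3 := int (num g (5 # w)))"
  have 1: "exec_to f (Assign (vn 3) (Op OAdd [mulc g (V 3), Num 5])) f1"
    using f by (intro exec_to_straightI) (simp_all add: f1_def)
  define f2 where "f2 = f1(8 := int (nat \<bar>v\<bar>))"
  have 2: "exec_to f1 (If (Op OLt [V i, Num 0]) (Assign (vn 8) (Op ONeg [V i])) (Assign (vn 8) (V i))) f2"
    using f i iD by (intro exec_to_straightI) (simp_all add: f2_def f1_def)
  obtain f3 where 3: "exec_to f2 (nest 1 load_step) f3" "f3 3 = int (num g (bin (nat \<bar>v\<bar>) @ 5 # w))"
    "\<forall>j. j \<noteq> 3 \<longrightarrow> j \<noteq> 8 \<longrightarrow> f3 j = f2 j"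
    using exec_to_load_step[of f2 "nat \<bar>v\<bar>" "5 # w" Nv] f by (auto simp: f2_def f1_def bit_length_def simp del: nest.simps)
  define f4 where "f4 = f3(3 := int (num g (enc_int v @ 5 # w)))"
  have fi: "f3 i = v" using 3(3) i f by (simp add: f2_def f1_def)
  have 4: "exec_to f3 (If (Op OLt [V i, Num 0]) (Assign (vn 3) (Op OAdd [mulc g (V 3), Num 4]))
       (Assign (vn 3) (Op OAdd [mulc g (V 3), Num 3]))) f4"
    using fi 3(2) iD by (intro exec_to_straightI) (simp_all add: f4_def enc_int_def)
  have "execs_to f (load_one i) f4"
    unfolding load_one_def by (intro execs_to_Cons[OF 1] execs_to_Cons[OF 2] execs_to_Cons[OF 3(1)] execs_to_Cons[OF 4] execs_to_Nil)
  moreover have "\<forall>j. j \<noteq> 3 \<longrightarrow> j \<noteq> 8 \<longrightarrow> f4 j = f j" using 3(3) by (simp add: f4_def f2_def f1_def)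
  ultimately show ?thesis by (intro exI[of _ f4]) (simp add: f4_def)
qed

lemma execs_to_load:
  assumes "\<forall>i\<in>set is. 20 \<le> i \<and> i < 20 + m \<and> bit_length (f i) \<le> blen Nv" "f 3 = 0" "f 0 = Nv"
  shows "\<exists>f'. execs_to f (load is) f' \<and> f' 3 = int (num g (enc_input (map f is))) \<and> (\<forall>j. j \<noteq> 3 \<longrightarrow> j \<noteq> 8 \<longrightarrow> f' j = f j)"
  using assms(1)
proof (induction "is")
  case Nil
  then show ?case using assms execs_to_Nil by (auto simp: enc_input_def intro!: exI[of _ f])
next
  case (Cons i "is")
  then obtain f1 where f1: "execs_to f (load is) f1" "f1 3 = int (num g (enc_input (map f is)))"
    "\<forall>j. j \<noteq> 3 \<longrightarrow> j \<noteq> 8 \<longrightarrow> f1 j = f j" by auto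
  obtain f2 where f2: "execs_to f1 (load_one i) f2" "f2 3 = int (num g (enc_int (f i) @ 5 # enc_input (map f is)))"
    "\<forall>j. j \<noteq> 3 \<longrightarrow> j \<noteq> 8 \<longrightarrow> f2 j = f1 j"
    using execs_to_load_one[of i f1 "f i" "enc_input (map f is)" Nv] Cons.prems f1 assms(3) by auto
  show ?case using execs_to_append[OF f1(1) f2(1)] f1(3) f2(2,3) by (intro exI[of _ f2]) (simp add: enc_input_Cons)
qed

lemma prog_out_prog:
  assumes len: "length vs = m" and halt: "(tm_step M ^^ t) (init_config M (enc_input vs)) = (tm_halt M, tp, h)"
    and holds: "tape_holds tp (enc_int y)"
    and Nv: "Nv = 2 + (\<Sum>v\<leftarrow>vs. 2 * \<bar>v\<bar>)" and T: "length (enc_input vs) + t + 1 \<le> blen Nv ^ K"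
  shows "prog_out (prog K) vs y"
proof -
  let ?T = "blen Nv ^ K"
  let ?w = "enc_input vs"
  define \<Sigma>0 where "\<Sigma>0 = (Map.empty(map vn [20..<20 + m] [\<mapsto>] map VInt vs) :: store)"
  define f0 :: "nat \<Rightarrow> int" where "f0 i = (if 20 \<le> i then vs ! (i - 20) else 0)" for i
  have \<Sigma>0: "\<Sigma>0 (vn i) = (if 20 \<le> i \<and> i < 20 + m then Some (VInt (vs ! (i - 20))) else None)" for i
    unfolding \<Sigma>0_def using len by (subst map_upds_vn) (auto simp: less_diff_conv2)
  define \<Sigma>1 where "\<Sigma>1 = \<Sigma>0(vn 0 \<mapsto> VInt 0, vn 1 \<mapsto> VInt 0, vn 2 \<mapsto> VInt 0, vn 3 \<mapsto> VInt 0, vn 4 \<mapsto> VInt 0,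
     vn 5 \<mapsto> VInt 0, vn 6 \<mapsto> VInt 0, vn 7 \<mapsto> VInt 0, vn 8 \<mapsto> VInt 0)"
  have dec: "execs \<Sigma>0 decls \<Sigma>1"
    unfolding decls_def \<Sigma>1_def by (intro execs_Decl XNil) (simp_all add: is_int_ty_def)
  have st0: "holds_vals f0 \<Sigma>1"
    unfolding holds_vals_def used_vars_def \<Sigma>1_def f0_def by (auto simp: \<Sigma>0)

  let ?is = "[20..<20 + m]"
  have mapis: "map f0 ?is = vs" using len by (intro nth_equalityI) (auto simp: f0_def)
  define f1 where "f1 = f0(0 := Nv)"
  have e1: "execs_to f0 ([Assign (vn 0) (Num 2)] @ map add_bound ?is) f1"
  proof -
    have straight: "straight_list True ([Assign (vn 0) (Num 2)] @ map add_bound ?is)"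
    proof -
      have "set is \<subseteq> {20..<20 + m} \<Longrightarrow> straight_list True (map add_bound is)" for "is"
        by (induction "is") (auto simp: add_bound_def used_vars_def)
      then show ?thesis by simp
    qed
    have "map (\<lambda>i. 2 * \<bar>(f0(0 := 2)) i\<bar>) ?is = map (\<lambda>v. 2 * \<bar>v\<bar>) (map f0 ?is)" by simp
    then have s: "(\<Sum>i\<leftarrow>?is. 2 * \<bar>(f0(0 := 2)) i\<bar>) = (\<Sum>v\<leftarrow>vs. 2 * \<bar>v\<bar>)" unfolding mapis by simp
    have "stmts_eval ([Assign (vn 0) (Num 2)] @ map add_bound ?is) f0 = stmts_eval (map add_bound ?is) (f0(0 := 2))" by simp
    also have "\<dots> = (f0(0 := 2))(0 := (f0(0 := 2)) 0 + (\<Sum>i\<leftarrow>?is. 2 * \<bar>(f0(0 := 2)) i\<bar>))"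
      by (rule stmts_eval_add_bound) simp
    also have "\<dots> = f1" unfolding s by (simp add: f1_def Nv)
    finally show ?thesis using exec_to_straight(2)[OF straight, of f0] by simp
  qed
  have bl: "bit_length v \<le> blen Nv" if "v \<in> set vs" for v
    using bit_length_le_blen[OF that] by (simp add: Nv)
  have map1: "map f1 ?is = vs" using mapis by (simp add: f1_def)
  obtain f2 where e2: "execs_to f1 (load ?is) f2" and f23: "f2 3 = int (num g ?w)"
    and f2: "\<And>j. j \<noteq> 3 \<Longrightarrow> j \<noteq> 8 \<Longrightarrow> f2 j = f1 j"
  proof -
    have "f1 i \<in> set vs" if "i \<in> set ?is" for i using that map1 by (metis list.set_map imageI)
    then have "\<forall>i\<in>set ?is. 20 \<le> i \<and> i < 20 + m \<and> bit_length (f1 i) \<le> blen Nv" using bl by auto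
    moreover have "f1 3 = 0" "f1 0 = Nv" by (simp_all add: f1_def f0_def)
    ultimately have "\<exists>f'. execs_to f1 (load ?is) f' \<and> f' 3 = int (num g (enc_input (map f1 ?is))) \<and>
        (\<forall>j. j \<noteq> 3 \<longrightarrow> j \<noteq> 8 \<longrightarrow> f' j = f1 j)"
      by (rule execs_to_load)
    then show thesis unfolding map1 using that by blast
  qed
  define f3 where "f3 = f2(1 := int (tm_start M))"
  have e3: "exec_to f2 (Assign (vn 1) (Num (tm_start M))) f3" by (intro exec_to_straightI) (simp_all add: f3_def)
  have wg: "\<forall>a\<in>set ?w. a < g" using set_enc_input[of vs] g6 by fastforce
  have c3: "cfg f3 (init_config M ?w)"
  proof -
    have "trel (\<lambda>i. if 0 \<le> i \<and> i < int (length ?w) then ?w ! nat i else 0) 0 0 (num g ?w)"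
      unfolding trel_def using digit_num[OF wg] by auto
    then show ?thesis unfolding cfg_def init_config_def
      using f23 f2[of 2] f2[of 4] by (auto simp: f3_def f1_def f0_def intro!: exI[of _ 0])
  qed
  define I1 :: "nat \<Rightarrow> (nat \<Rightarrow> int) \<Rightarrow> bool" where "I1 n f \<longleftrightarrow> cfg f ((tm_step M ^^ n) (init_config M ?w)) \<and> f 0 = Nv \<and> f 6 = 0" for n f
  have I10: "I1 0 f3" using c3 f2[of 0] f2[of 6] by (simp add: I1_def f3_def f1_def f0_def)
  have "\<exists>f'. exec_to f3 (nest K step) f' \<and> I1 (0 + ?T) f'"
  proof (rule exec_to_nest[where I = I1, OF _ _ I10])
    fix n f assume I: "I1 n f"
    then show "f 0 = Nv" by (simp add: I1_def)
    obtain q tp1 h1 where c: "(tm_step M ^^ n) (init_config M ?w) = (q, tp1, h1)" by (metis prod_cases3)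
    have "q < tm_states M" using config_invariant[OF wg, of n] c by simp
    from stmt_eval_step[OF _ this, of f tp1 h1] I c have "I1 (Suc n) (stmt_eval step f)" by (simp add: I1_def)
    then show "\<exists>f'. exec_to f step f' \<and> I1 (Suc n) f'" using exec_to_straight(1)[OF straight_step(1)] by blast
  qed
  then obtain f4 where e4: "exec_to f3 (nest K step) f4" and "I1 ?T f4" by auto
  moreover have cT: "(tm_step M ^^ ?T) (init_config M ?w) = (tm_halt M, tp, h)"
    using T by (intro halted_stays[OF halt]) simp
  ultimately obtain l4 r4 where f4: "f4 0 = Nv" "f4 6 = 0" "f4 4 = h" "f4 2 = int l4" "f4 3 = int r4" "trel tp h l4 r4"
    by (auto simp: I1_def cfg_def)
  have hT: "\<bar>h\<bar> \<le> int ?T" using config_invariant[OF wg, of ?T] cT by simp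

  define A where "A = ?T"
  \<comment> \<open>The head is at most \<open>A - n\<close> cells from home, so after
    \<open>A\<close> iterations it is at cell 0.\<close>
  define I2 :: "nat \<Rightarrow> (nat \<Rightarrow> int) \<Rightarrow> bool" where "I2 n f \<longleftrightarrow> f 0 = Nv \<and> f 6 = 0 \<and> \<bar>f 4\<bar> \<le> int (A - n) \<and>
     (\<exists>l r. f 2 = int l \<and> f 3 = int r \<and> trel tp (f 4) l r)" for n f
  have I20: "I2 0 f4" using f4 hT by (auto simp: I2_def A_def)
  have "\<exists>f'. exec_to f4 (nest K home) f' \<and> I2 (0 + ?T) f'"
  proof (rule exec_to_nest[where I = I2, OF _ _ I20])
    fix n f assume I: "I2 n f"
    then show "f 0 = Nv" by (simp add: I2_def)
    from I obtain l r where f: "f 0 = Nv" "f 6 = 0" "\<bar>f 4\<bar> \<le> int (A - n)" "f 2 = int l" "f 3 = int r"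
      and tr: "trel tp (f 4) l r" by (auto simp: I2_def)
    have "I2 (Suc n) (stmt_eval home f)"
    proof -
      consider "0 < f 4" | "f 4 < 0" | "f 4 = 0" by linarith
      then show ?thesis
      proof cases
        case 1
        then have "stmt_eval home f = f(3 := int (g * r + l mod g), 2 := int (l div g), 4 := f 4 - 1)"
          using stmt_eval_move(2)[OF f(4,5)] by (simp add: home_def)
        then show ?thesis unfolding I2_def using 1 f trel_left[OF tr]
          by (auto simp del: of_nat_add of_nat_mult)
      next
        case 2
        then have "stmt_eval home f = f(2 := int (g * l + r mod g), 3 := int (r div g), 4 := f 4 + 1)"
          using stmt_eval_move(1)[OF f(4,5)] by (simp add: home_def)
        then show ?thesis unfolding I2_def using 2 f trel_right[OF tr]
          by (auto simp del: of_nat_add of_nat_mult)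
      next
        case 3
        then have "stmt_eval home f = f" by (simp add: home_def)
        then show ?thesis unfolding I2_def using 3 f tr by auto
      qed
    qed
    then show "\<exists>f'. exec_to f home f' \<and> I2 (Suc n) f'" using exec_to_straight(1)[OF straight_step(2)] by blast
  qed
  then obtain f5 where e5: "exec_to f4 (nest K home) f5" and "I2 ?T f5" by auto
  then obtain l5 r5 where f5: "f5 0 = Nv" "f5 6 = 0" "f5 3 = int r5" "trel tp 0 l5 r5"
    by (auto simp: I2_def A_def)
  have dig: "r5 div g ^ i mod g = tp (int i)" for i using f5(4) by (simp add: trel_def)
  define bs where "bs = bin (nat \<bar>y\<bar>)"
  define sy :: nat where "sy = (if y < 0 then 4 else 3)"
  have w: "enc_int y = sy # bs" by (simp add: enc_int_def bs_def sy_def)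
  have "tape_holds tp (sy # bs)" using holds w by simp
  then have th: "\<And>i. i < length (sy # bs) \<Longrightarrow> tp (int i) = (sy # bs) ! i" and thl: "tp (int (length (sy # bs))) = 0"
    unfolding tape_holds_def by blast+
  have tp0: "tp 0 = sy" using th[of 0] by simp
  have tpS: "tp (int (Suc i)) = bs ! i" if "i < length bs" for i using th[of "Suc i"] that by simp
  have bs12: "b = 1 \<or> b = 2" if "b \<in> set bs" for b using that set_bin[of "nat \<bar>y\<bar>"] by (auto simp: bs_def)
  \<comment> \<open>The last digit symbol is not blank, so it lies on a cell that the input or the
    head has reached within time \<open>t\<close>.\<close>
  have lenbs: "length bs \<le> ?T"
  proof (cases "length bs = 0")
    case False
    then have "bs ! (length bs - 1) \<in> set bs" by simp
    then have "bs ! (length bs - 1) \<noteq> 0" using bs12 by fastforce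
    moreover have "tp (int (Suc (length bs - 1))) = bs ! (length bs - 1)" using False by (intro tpS) simp
    moreover have "Suc (length bs - 1) = length bs" using False by simp
    ultimately have nz: "tp (int (length bs)) \<noteq> 0" by metis
    have "tp x = 0" if "int (length ?w + t) \<le> x" for x using config_invariant[OF wg, of t] halt that by simp
    with nz have "\<not> int (length ?w + t) \<le> int (length bs)" by metis
    then have "length bs < length ?w + t" by simp
    then show ?thesis using T by simp
  qed simp

  define f6 where "f6 = f5(7 := int sy)"
  have r5m: "r5 mod g = sy" using dig[of 0] tp0 by simp
  have e6: "exec_to f5 (Assign (vn 7) (Op OMod [V 3, Num g])) f6"
    using f5 r5m by (intro exec_to_straightI) (simp_all add: f6_def tmod_nat)
  define f7 where "f7 = f6(3 := int (r5 div g))"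
  have e7: "exec_to f6 (Assign (vn 3) (Op ODiv [V 3, Num g])) f7"
    using f5 by (intro exec_to_straightI) (simp_all add: f7_def f6_def tdiv_nat)
  \<comment> \<open>The \<open>min\<close> halts the reading at the blank that follows the output
    word.\<close>
  define I3 :: "nat \<Rightarrow> (nat \<Rightarrow> int) \<Rightarrow> bool" where "I3 n f \<longleftrightarrow> f 0 = Nv \<and> f 7 = int sy \<and> f 6 = bits_val 0 (take n bs) \<and>
     (\<exists>r. f 3 = int r \<and> (\<forall>i. r div g ^ i mod g = tp (int (Suc (min n (length bs) + i)))))" for n f
  have I30: "I3 0 f7"
    unfolding I3_def using f5 dig[of "Suc _"] unfolding digit_pop[symmetric]
    by (auto simp: f7_def f6_def bits_val_def)
  have "\<exists>f'. exec_to f7 (nest K out_step) f' \<and> I3 (0 + ?T) f'"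
  proof (rule exec_to_nest[where I = I3, OF _ _ I30])
    fix n f assume I: "I3 n f"
    then show "f 0 = Nv" by (simp add: I3_def)
    from I obtain r where f: "f 0 = Nv" "f 7 = int sy" "f 6 = bits_val 0 (take n bs)" "f 3 = int r"
      and dr: "\<And>i. r div g ^ i mod g = tp (int (Suc (min n (length bs) + i)))" by (auto simp: I3_def)
    have rm: "r mod g = tp (int (Suc (min n (length bs))))" using dr[of 0] by simp
    have "I3 (Suc n) (stmt_eval out_step f)"
    proof (cases "n < length bs")
      case True
      then have a: "r mod g = bs ! n" using rm tpS[OF True] by simp
      have b: "bs ! n = 1 \<or> bs ! n = 2" using True bs12 by simp
      have "of_bool (bit (bs ! n) 1) = int (bs ! n) - 1" using b by (auto simp: bit_iff_odd)
      then have v: "bits_val 0 (take (Suc n) bs) = f 6 + f 6 + (int (bs ! n) - 1)"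
        unfolding f(3) take_Suc_conv_app_nth[OF True] by (simp add: bits_val_def)
      have "stmt_eval out_step f = f(5 := int (bs ! n), 6 := f 6 + f 6 + (int (bs ! n) - 1), 3 := int (r div g))"
        using f(4) a b by (auto simp: out_step_def tmod_nat tdiv_nat)
      moreover have "r div g div g ^ i mod g = tp (int (Suc (min (Suc n) (length bs) + i)))" for i
        unfolding digit_pop using dr[of "Suc i"] True by simp
      ultimately show ?thesis unfolding I3_def using f v by auto
    next
      case False
      then have "r mod g = 0" using rm thl by simp
      then have "stmt_eval out_step f = f(5 := 0)" using f(4) by (simp add: out_step_def tmod_nat)
      then show ?thesis unfolding I3_def using f dr False by auto
    qed
    then show "\<exists>f'. exec_to f out_step f' \<and> I3 (Suc n) f'" using exec_to_straight(1)[OF straight_step(3)] by blast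
  qed
  then obtain f8 where e8: "exec_to f7 (nest K out_step) f8" and "I3 ?T f8" by auto
  then have f8: "f8 7 = int sy" "f8 6 = \<bar>y\<bar>"
    using lenbs by (simp_all add: I3_def bs_def bits_val_bin)
  have e9: "exec_to f8 (If (Op OEq [V 7, Num 4]) (Assign (vn 6) (Op ONeg [V 6])) (Block [])) (f8(6 := y))"
    using f8 by (intro exec_to_straightI) (auto simp: sy_def)
  have "execs_to f0 (main K) (f8(6 := y))"
    unfolding main_def append_assoc[symmetric]
    by (rule execs_to_append[OF execs_to_append[OF e1 e2] execs_to_Cons[OF e3 execs_to_Cons[OF e4 execs_to_Cons[OF e5
       execs_to_Cons[OF e6 execs_to_Cons[OF e7 execs_to_Cons[OF e8 execs_to_Cons[OF e9 execs_to_Nil]]]]]]]])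
  then obtain \<Sigma>2 where m2: "execs \<Sigma>1 (main K) \<Sigma>2" "holds_vals (f8(6 := y)) \<Sigma>2" using st0 unfolding execs_to_def by blast
  have "execs \<Sigma>0 (decls @ main K) \<Sigma>2"
    using dec m2(1) by (rule execs_append)
  moreover have "eval \<Sigma>2 (V 6) (VInt y)" using m2(2) by (intro eval.EVar) (simp add: holds_vals_def)
  ultimately show ?thesis unfolding prog_out_def prog_def \<Sigma>0_def by auto
qed

end

text \<open>For \<open>2 \<le> X\<close> every \<open>n\<close> is at most \<open>X ^ n\<close>, and
  \<open>x + 1 \<le> X ^ (m + 1)\<close>, so both terms fit under one power of \<open>X\<close>; the
  last factor \<open>X\<close> pays for adding them.\<close>

lemma exponent_bound:
  fixes X c k m x :: nat
  assumes "2 \<le> X" "x \<le> m * X"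
  shows "(x + 2 * m) + c * (x + 1) ^ k + 1 \<le> X ^ (c + k * (m + 1) + (3 * m + 2) + 1)"
proof -
  have p: "n \<le> X ^ n" for n
    by (meson assms(1) less_exp order_less_imp_le order_trans power_mono zero_le)
  have X1: "1 \<le> X" using assms(1) by simp
  have x1: "x + 1 \<le> X ^ (m + 1)"
  proof -
    have "x + 1 \<le> (m + 1) * X" using assms by simp
    also have "m + 1 \<le> X ^ m" using assms(1)
      by (metis Suc_eq_plus1 Suc_leI less_exp order_trans power_mono zero_le)
    then have "(m + 1) * X \<le> X ^ m * X" by (rule mult_le_mono1)
    finally show ?thesis by (simp add: mult.commute)
  qed
  let ?e = "c + k * (m + 1) + (3 * m + 2)"
  have "c * (x + 1) ^ k \<le> X ^ c * (X ^ (m + 1)) ^ k" by (intro mult_le_mono p power_mono x1) simp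
  also have "\<dots> = X ^ (c + k * (m + 1))" 
    unfolding power_add[of X c] by (simp only: power_mult[symmetric] mult.commute)
  also have "\<dots> \<le> X ^ ?e" by (intro power_increasing X1) simp
  finally have a: "c * (x + 1) ^ k \<le> X ^ ?e" .
  have "x + 2 * m + 1 \<le> (x + 1) * (2 * m + 1)" by simp
  also have "\<dots> \<le> X ^ (m + 1) * X ^ (2 * m + 1)" by (intro mult_le_mono x1 p)
  also have "\<dots> = X ^ (3 * m + 2)" unfolding power_add[symmetric] by (rule arg_cong[of _ _ "power X"]) simp
  also have "\<dots> \<le> X ^ ?e" by (intro power_increasing X1) simp
  finally have b: "x + 2 * m + 1 \<le> X ^ ?e" .
  have "(x + 2 * m) + c * (x + 1) ^ k + 1 \<le> 2 * X ^ ?e" using a b by linarith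
  also have "\<dots> \<le> X * X ^ ?e" using assms(1) by (rule mult_le_mono1)
  finally show ?thesis by simp
qed

lemma in_FP_imp_in_FPC:
  assumes "in_FP m f"
  shows "in_FPC m f"
proof -
  from assms obtain M c k where wf: "wf_tm M" and run: "\<And>vs. length vs = m \<Longrightarrow>
        \<exists>t \<le> c * (input_size vs + 1) ^ k.
           (case (tm_step M ^^ t) (init_config M (enc_input vs)) of (q, tp, h) \<Rightarrow>
              q = tm_halt M \<and> tape_holds tp (enc_int (f vs)))"
    unfolding in_FP_def by blast
  interpret simulation m M by unfold_locales (rule wf)
  define K where "K = c + k * (m + 1) + (3 * m + 2) + 1"
  have "prog_out (prog K) vs (f vs)" if len: "length vs = m" for vs
  proof -
    from run[OF len] obtain t tp h where t: "t \<le> c * (input_size vs + 1) ^ k"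
      and ht: "(tm_step M ^^ t) (init_config M (enc_input vs)) = (tm_halt M, tp, h)"
      and th: "tape_holds tp (enc_int (f vs))" by auto
    define Nv where "Nv = 2 + (\<Sum>v\<leftarrow>vs. 2 * \<bar>v\<bar>)"
    have nn: "0 \<le> (\<Sum>v\<leftarrow>vs. 2 * \<bar>v\<bar>)" by (intro sum_list_nonneg) auto
    \<comment> \<open>The summand 2 of \<open>Nv\<close> gives \<open>2 \<le> blen Nv\<close> even
      for \<open>m = 0\<close> or zero inputs, so that its powers can outgrow constants.\<close>
    have "2 ^ 1 \<le> \<bar>Nv\<bar>" using nn by (simp add: Nv_def)
    then have X2: "2 \<le> blen Nv" using less_blen_iff[of 1 Nv] by simp
    have bl: "bit_length v \<le> blen Nv" if "v \<in> set vs" for v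
      using bit_length_le_blen[OF that] by (simp add: Nv_def)
    have "input_size vs \<le> (\<Sum>v\<leftarrow>vs. blen Nv)"
      unfolding input_size_def by (intro sum_list_mono bl)
    then have "input_size vs \<le> length vs * blen Nv" by (simp add: sum_list_triv)
    then have "(input_size vs + 2 * m) + c * (input_size vs + 1) ^ k + 1 \<le> blen Nv ^ K"
      unfolding K_def len by (rule exponent_bound[OF X2])
    then have "length (enc_input vs) + t + 1 \<le> blen Nv ^ K" using t len by (simp add: length_enc_input)
    then show ?thesis by (rule prog_out_prog[OF len ht th Nv_def])
  qed
  moreover have "length (params (prog K)) = m" by (simp add: prog_def)
  ultimately show ?thesis unfolding in_FPC_def using well_typed_prog by blast
qed

theorem theorem2:
  fixes m :: nat and f :: "int list \<Rightarrow> int"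
  shows "in_FPC m f \<longleftrightarrow> in_FP m f"
  using in_FPC_imp_in_FP in_FP_imp_in_FPC by blast

end
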